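(* Let $A$ be an algebra in a congruence-modular variety, and let $\mathcal U_i$ ($i\in I$) and $\mathcal V$ belong to $\operatorname{Unif}A$. Then $$\bigvee_{i\in I}[\mathcal U_i,\mathcal V]\le\Big[\bigvee_{i\in I}\mathcal U_i,\mathcal V\Big],$$ with equality if $\mathcal V$ is of the form $\operatorname{Ug}\{\alpha\}$ for some $\alpha\in\operatorname{Con}A$ and $A$ has an underlying group structure, or if $I$ is finite and the $\mathcal U_i$ permute pairwise.
   Context: Algebras have finitary operations (the underlying set may be empty). A uniformity on a set $S$ is a filter $\mathcal U$ of binary relations on $S$ such that every $U\in\mathcal U$ is reflexive, $U\in\mathcal U$ implies $U^{-1}\in\mathcal U$, and for each $U\in\mathcal U$ there is $V\in\mathcal U$ with $V\circ V\subseteq U$. A uniformity $\mathcal U$ on an algebra $A$ is compatible if for each basic operation $\omega$ and $U\in\mathcal U$ there is $\bar U\in\mathcal U$ such that $x_i\mathrel{\bar U}y_i$ for all $i$ implies $\omega(\mathbf x)\mathrel U\omega(\mathbf y)$. $\operatorname{Unif}A$ is the complete lattice of compatible uniformities on $A$, ordered by reverse inclusion ($\mathcal U\le\mathcal V$ iff $\mathcal V\subseteq\mathcal U$); joins are taken in this lattice. For a congruence $\alpha$, $\operatorname{Ug}\{\alpha\}=\{U\subseteq A^2:\alpha\subseteq U\}$. For filters $\mathcal U,\mathcal V$ of binary relations, $\mathcal U\circ\mathcal V$ is the filter with base $\{U\circ V:U\in\mathcal U,V\in\mathcal V\}$; $\mathcal U$ and $\mathcal V$ permute if $\mathcal U\circ\mathcal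 V=\mathcal V\circ\mathcal U$. "$A$ has an underlying group structure" means that $A$ has term operations (multiplication, inverse, identity) that make its underlying set a group. For binary relations $U,V$ on $A$, $n,n'\ge0$ and an $(n+n')$-ary term $t$, $\mathrm M_{n,n',t}(U,V)$ is the set of matrices $\begin{pmatrix}t(\mathbf a,\mathbf b)&t(\mathbf a,\mathbf c)\\t(\mathbf a',\mathbf b)&t(\mathbf a',\mathbf c)\end{pmatrix}$ with $\mathbf a,\mathbf a'\in A^n$, $\mathbf b,\mathbf c\in A^{n'}$, $a_i\mathrel Ua'_i$ and $b_j\mathrel Vc_j$ for all $i,j$. The commutator $[\mathcal U,\mathcal V]$ of $\mathcal U,\mathcal V\in\operatorname{Unif}A$ ($A$ in a congruence-modular variety) is the least $\mathcal W\in\operatorname{Unif}A$ such that for all $n,n',t$ and all $W\in\mathcal W$ there are $U\in\mathcal U$, $V\in\mathcal V$, $\bar W\in\mathcal W$ such that $(u_{ij})\in\mathrm M_{n,n',t}(U,V)$ and $u_{11}\mathrel{\bar W}u_{12}$ imply $u_{21}\mathrel Wu_{22}$. *)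

theory Defs
  imports "HOL-Algebra.Group" "HOL-Library.Countable_Set"
begin

section \<open>Algebras, terms and varieties\<close>

text \<open>
  The signature is part of the algebra: \<open>arity A f = Some n\<close> means that \<open>f\<close> is an \<open>n\<close>-ary
  operation symbol, \<open>arity A f = None\<close> that \<open>f\<close> is not a symbol of the signature.  An \<open>n\<close>-tuple is
  a list of length \<open>n\<close>.
\<close>

record ('a, 'f) ualgebra = "'a partial_object" +
  arity :: "'f \<Rightarrow> nat option"
  oper :: "'f \<Rightarrow> 'a list \<Rightarrow> 'a"

definition tuples :: "'a set \<Rightarrow> nat \<Rightarrow> 'a list set" where
  "tuples S n = {xs. length xs = n \<and> set xs \<subseteq> S}"

definition is_algebra :: "('a, 'f) ualgebra \<Rightarrow> bool" where
  "is_algebra A \<longleftrightarrow>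
     (\<forall>f n. arity A f = Some n \<longrightarrow> (\<forall>xs \<in> tuples (carrier A) n. oper A f xs \<in> carrier A))"

datatype (syms: 'f, vars: 'v) trm = Var 'v | Fn 'f "('f, 'v) trm list"

fun wf_trm :: "('f \<Rightarrow> nat option) \<Rightarrow> ('f, 'v) trm \<Rightarrow> bool" where
  "wf_trm sig (Var x) \<longleftrightarrow> True"
| "wf_trm sig (Fn f ts) \<longleftrightarrow> sig f = Some (length ts) \<and> (\<forall>t \<in> set ts. wf_trm sig t)"

fun eval :: "('a, 'f) ualgebra \<Rightarrow> ('v \<Rightarrow> 'a) \<Rightarrow> ('f, 'v) trm \<Rightarrow> 'a" where
  "eval A v (Var x) = v x"
| "eval A v (Fn f ts) = oper A f (map (eval A v) ts)"

definition nary_terms :: "('a, 'f) ualgebra \<Rightarrow> nat \<Rightarrow> ('f, nat) trm set" where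
  "nary_terms A n = {t. wf_trm (arity A) t \<and> vars t \<subseteq> {..<n}}"

definition term_op :: "('a, 'f) ualgebra \<Rightarrow> ('f, nat) trm \<Rightarrow> 'a list \<Rightarrow> 'a" where
  "term_op A t xs = eval A (\<lambda>i. xs ! i) t"

definition congruence :: "('a, 'f) ualgebra \<Rightarrow> ('a \<times> 'a) set \<Rightarrow> bool" where
  "congruence A \<theta> \<longleftrightarrow> equiv (carrier A) \<theta> \<and>
     (\<forall>f n xs ys. arity A f = Some n \<longrightarrow> length xs = n \<longrightarrow>
        list_all2 (\<lambda>x y. (x, y) \<in> \<theta>) xs ys \<longrightarrow> (oper A f xs, oper A f ys) \<in> \<theta>)"

definition cong_join :: "('a, 'f) ualgebra \<Rightarrow> ('a \<times> 'a) set \<Rightarrow> ('a \<times> 'a) set \<Rightarrow> ('a \<times> 'a) set" where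
  "cong_join A \<alpha> \<beta> = \<Inter> {\<theta>. congruence A \<theta> \<and> \<alpha> \<union> \<beta> \<subseteq> \<theta>}"

definition modular_Con :: "('a, 'f) ualgebra \<Rightarrow> bool" where
  "modular_Con A \<longleftrightarrow>
     (\<forall>\<alpha> \<beta> \<gamma>. congruence A \<alpha> \<longrightarrow> congruence A \<beta> \<longrightarrow> congruence A \<gamma> \<longrightarrow> \<alpha> \<subseteq> \<gamma> \<longrightarrow>
        cong_join A \<alpha> \<beta> \<inter> \<gamma> = cong_join A \<alpha> (\<beta> \<inter> \<gamma>))"

text \<open>
  The variety of signature \<open>sig\<close> defined by the identities \<open>E\<close>, i.e. its members with carrier in
  the type \<open>'a\<close>.
\<close>

definition variety ::
    "('f \<Rightarrow> nat option) \<Rightarrow> (('f, nat) trm \<times> ('f, nat) trm) set \<Rightarrow> ('a, 'f) ualgebra set" where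
  "variety sig E = {A. is_algebra A \<and> arity A = sig \<and>
     (\<forall>(s, t) \<in> E. \<forall>v. range v \<subseteq> carrier A \<longrightarrow> eval A v s = eval A v t)}"

text \<open>
  A formula cannot quantify over all types, so the members of the variety are taken here with
  carriers in the type \<open>('f, nat) trm set\<close>, where all countably generated members live up to
  isomorphism, as quotients of term algebras.  This is no restriction: by the theorem
  \<open>congruence_modular_varietyD\<close> below, the members of the variety over every type then have
  modular congruence lattices.
\<close>

definition congruence_modular_variety ::
    "('f \<Rightarrow> nat option) \<Rightarrow> (('f, nat) trm \<times> ('f, nat) trm) set \<Rightarrow> bool" where
  "congruence_modular_variety sig E \<longleftrightarrow>
     (\<forall>(s, t) \<in> E. wf_trm sig s \<and> wf_trm sig t) \<and>
     (\<forall>B :: (('f, nat) trm set, 'f) ualgebra. B \<in> variety sig E \<longrightarrow> modular_Con B)"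

definition in_congruence_modular_variety :: "('a, 'f) ualgebra \<Rightarrow> bool" where
  "in_congruence_modular_variety A \<longleftrightarrow>
     (\<exists>sig E. congruence_modular_variety sig E \<and> A \<in> variety sig E)"

text \<open>
  The identity may be given by a term in any number of variables whose value is constant.
  This covers signatures without constant symbols.
\<close>

definition has_underlying_group :: "('a, 'f) ualgebra \<Rightarrow> bool" where
  "has_underlying_group A \<longleftrightarrow>
     (\<exists>G :: 'a monoid. group G \<and> carrier G = carrier A \<and>
        (\<exists>m \<in> nary_terms A 2. \<forall>x \<in> carrier A. \<forall>y \<in> carrier A. x \<otimes>\<^bsub>G\<^esub> y = term_op A m [x, y]) \<and>
        (\<exists>i \<in> nary_terms A 1. \<forall>x \<in> carrier A. inv\<^bsub>G\<^esub> x = term_op A i [x]) \<and>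
        (\<exists>k. \<exists>e \<in> nary_terms A k. \<forall>xs \<in> tuples (carrier A) k. \<one>\<^bsub>G\<^esub> = term_op A e xs))"


section \<open>Compatible uniformities\<close>

text \<open>
  A filter of binary relations on \<open>S\<close> is represented by a filter \<open>F\<close> on the type \<open>'a \<times> 'a\<close> with
  \<open>F \<le> principal (S \<times> S)\<close>; its members are the sets in \<open>entourages S F\<close>.  The library order on
  filters is reverse inclusion, hence the order of \<open>Unif\<close>.  Note that \<open>Ug {\<alpha>}\<close> is
  \<open>principal \<alpha>\<close>, and that \<open>bot\<close> is the uniformity on the empty set.
\<close>

definition entourages :: "'a set \<Rightarrow> ('a \<times> 'a) filter \<Rightarrow> ('a \<times> 'a) set set" where
  "entourages S F = {U. U \<subseteq> S \<times> S \<and> eventually (\<lambda>p. p \<in> U) F}"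

definition uniformity_on :: "'a set \<Rightarrow> ('a \<times> 'a) filter \<Rightarrow> bool" where
  "uniformity_on S F \<longleftrightarrow> F \<le> principal (S \<times> S) \<and>
     (\<forall>U \<in> entourages S F.
        refl_on S U \<and> U\<inverse> \<in> entourages S F \<and> (\<exists>V \<in> entourages S F. V O V \<subseteq> U))"

definition compatible :: "('a, 'f) ualgebra \<Rightarrow> ('a \<times> 'a) filter \<Rightarrow> bool" where
  "compatible A F \<longleftrightarrow>
     (\<forall>f n. arity A f = Some n \<longrightarrow>
        (\<forall>U \<in> entourages (carrier A) F. \<exists>U' \<in> entourages (carrier A) F.
           \<forall>xs \<in> tuples (carrier A) n. \<forall>ys \<in> tuples (carrier A) n.
             list_all2 (\<lambda>x y. (x, y) \<in> U') xs ys \<longrightarrow> (oper A f xs, oper A f ys) \<in> U))"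

definition Unif :: "('a, 'f) ualgebra \<Rightarrow> ('a \<times> 'a) filter set" where
  "Unif A = {F. uniformity_on (carrier A) F \<and> compatible A F}"

text \<open>
  The join in \<open>Unif A\<close>.  It is in general larger than the supremum in the lattice of all filters,
  which need not be a uniformity.  That the least elements denoted here and in \<open>commutator\<close>
  exist is shown in \<open>Unif_Join_is_lub\<close> and \<open>commutator_is_least\<close>.
\<close>

definition Unif_Join :: "('a, 'f) ualgebra \<Rightarrow> ('a \<times> 'a) filter set \<Rightarrow> ('a \<times> 'a) filter" where
  "Unif_Join A X = (LEAST W. W \<in> Unif A \<and> (\<forall>F \<in> X. F \<le> W))"

definition Ug :: "('a \<times> 'a) set \<Rightarrow> ('a \<times> 'a) filter" where
  "Ug \<alpha> = principal \<alpha>"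

lemma entourages_Ug: "entourages S (Ug \<alpha>) = {U. U \<subseteq> S \<times> S \<and> \<alpha> \<subseteq> U}"
  by (auto simp: entourages_def Ug_def eventually_principal)

definition filter_comp ::
    "'a set \<Rightarrow> ('a \<times> 'a) filter \<Rightarrow> ('a \<times> 'a) filter \<Rightarrow> ('a \<times> 'a) filter" where
  "filter_comp S F G = (INF (U, V) \<in> entourages S F \<times> entourages S G. principal (U O V))"

lemma eventually_filter_comp:
  assumes "F \<le> principal (S \<times> S)" "G \<le> principal (S \<times> S)"
  shows "eventually P (filter_comp S F G) \<longleftrightarrow>
    (\<exists>U \<in> entourages S F. \<exists>V \<in> entourages S G. \<forall>p \<in> U O V. P p)"
proof -
  have ne: "S \<times> S \<in> entourages S F" "S \<times> S \<in> entourages S G"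
    using assms by (auto simp: entourages_def le_principal)
  have int: "U \<inter> U' \<in> entourages S H" if "U \<in> entourages S H" "U' \<in> entourages S H" for U U' H
    using that by (auto simp: entourages_def eventually_conj)
  have "eventually P (filter_comp S F G) \<longleftrightarrow>
      (\<exists>b \<in> entourages S F \<times> entourages S G.
         eventually P (case b of (U, V) \<Rightarrow> principal (U O V)))"
    unfolding filter_comp_def
  proof (rule eventually_INF_base)
    show "entourages S F \<times> entourages S G \<noteq> {}" using ne by auto
  next
    fix a b assume "a \<in> entourages S F \<times> entourages S G" "b \<in> entourages S F \<times> entourages S G"
    then show "\<exists>x \<in> entourages S F \<times> entourages S G.
        (case x of (U, V) \<Rightarrow> principal (U O V)) \<le>
        inf (case a of (U, V) \<Rightarrow> principal (U O V)) (case b of (U, V) \<Rightarrow> principal (U O V))"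
      by (intro bexI[of _ "(fst a \<inter> fst b, snd a \<inter> snd b)"]) (auto intro: int)
  qed
  then show ?thesis by (auto simp: eventually_principal)
qed

definition permute :: "('a, 'f) ualgebra \<Rightarrow> ('a \<times> 'a) filter \<Rightarrow> ('a \<times> 'a) filter \<Rightarrow> bool" where
  "permute A F G \<longleftrightarrow> filter_comp (carrier A) F G = filter_comp (carrier A) G F"


section \<open>The commutator\<close>

text \<open>The matrix with entries \<open>u11\<close>, \<open>u12\<close>, \<open>u21\<close>, \<open>u22\<close> is encoded as \<open>(u11, u12, u21, u22)\<close>.\<close>

definition matrices :: "('a, 'f) ualgebra \<Rightarrow> nat \<Rightarrow> nat \<Rightarrow> ('f, nat) trm \<Rightarrow>
    ('a \<times> 'a) set \<Rightarrow> ('a \<times> 'a) set \<Rightarrow> ('a \<times> 'a \<times> 'a \<times> 'a) set" where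
  "matrices A n n' t U V =
     {(term_op A t (a @ b), term_op A t (a @ c), term_op A t (a' @ b), term_op A t (a' @ c)) |
        a a' b c.
        a \<in> tuples (carrier A) n \<and> a' \<in> tuples (carrier A) n \<and>
        b \<in> tuples (carrier A) n' \<and> c \<in> tuples (carrier A) n' \<and>
        list_all2 (\<lambda>x y. (x, y) \<in> U) a a' \<and> list_all2 (\<lambda>x y. (x, y) \<in> V) b c}"

definition centralizes ::
    "('a, 'f) ualgebra \<Rightarrow> ('a \<times> 'a) filter \<Rightarrow> ('a \<times> 'a) filter \<Rightarrow> ('a \<times> 'a) filter \<Rightarrow> bool" where
  "centralizes A F G H \<longleftrightarrow>
     (\<forall>n n'. \<forall>t \<in> nary_terms A (n + n'). \<forall>W \<in> entourages (carrier A) H.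
        \<exists>U \<in> entourages (carrier A) F. \<exists>V \<in> entourages (carrier A) G.
        \<exists>W' \<in> entourages (carrier A) H.
          \<forall>(u11, u12, u21, u22) \<in> matrices A n n' t U V. (u11, u12) \<in> W' \<longrightarrow> (u21, u22) \<in> W)"

definition commutator ::
    "('a, 'f) ualgebra \<Rightarrow> ('a \<times> 'a) filter \<Rightarrow> ('a \<times> 'a) filter \<Rightarrow> ('a \<times> 'a) filter" where
  "commutator A F G = (LEAST H. H \<in> Unif A \<and> centralizes A F G H)"

section \<open>The lattice of compatible uniformities is complete, and commutators exist\<close>

lemma entourages_mono: "F \<le> G \<Longrightarrow> entourages S G \<subseteq> entourages S F"
  by (auto simp: entourages_def filter_leD)

lemma entourages_inf:
  assumes "U \<in> entourages S (inf F G)" "F \<le> principal (S \<times> S)" "G \<le> principal (S \<times> S)"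
  obtains U1 U2 where "U1 \<in> entourages S F" "U2 \<in> entourages S G" "U1 \<inter> U2 \<subseteq> U"
proof -
  obtain P Q where PQ: "eventually P F" "eventually Q G" "\<And>p. P p \<and> Q p \<Longrightarrow> p \<in> U"
    using assms(1) by (auto simp: entourages_def eventually_inf)
  have "{p \<in> S \<times> S. P p} \<in> entourages S F" "{p \<in> S \<times> S. Q p} \<in> entourages S G"
    using PQ(1,2) assms(2,3) by (auto simp: entourages_def le_principal eventually_conj_iff
        simp flip: mem_Times_iff)
  then show ?thesis using PQ(3) by (intro that) auto
qed

lemma entourages_infI:
  "U \<in> entourages S F \<Longrightarrow> V \<in> entourages S G \<Longrightarrow> U \<inter> V \<in> entourages S (inf F G)"
  by (auto simp: entourages_def eventually_inf)

lemma entourages_Int: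
  "U \<in> entourages S F \<Longrightarrow> V \<in> entourages S F \<Longrightarrow> U \<inter> V \<in> entourages S F"
  by (auto simp: entourages_def eventually_conj)

lemma entourages_superset:
  "U \<in> entourages S F \<Longrightarrow> U \<subseteq> V \<Longrightarrow> V \<subseteq> S \<times> S \<Longrightarrow> V \<in> entourages S F"
  by (auto simp: entourages_def elim: eventually_mono)

lemma entourages_sub: "U \<in> entourages S F \<Longrightarrow> U \<subseteq> S \<times> S"
  by (simp add: entourages_def)

lemma Unif_top:
  assumes "is_algebra A"
  shows "principal (carrier A \<times> carrier A) \<in> Unif A"
proof -
  let ?S = "carrier A"
  have e: "entourages ?S (principal (?S \<times> ?S)) = {?S \<times> ?S}"
    by (auto simp: entourages_def eventually_principal)
  have "compatible A (principal (?S \<times> ?S))"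
    using assms unfolding compatible_def e by (auto simp: is_algebra_def)
  moreover have "uniformity_on ?S (principal (?S \<times> ?S))"
    unfolding uniformity_on_def e by (auto simp: refl_on_def)
  ultimately show ?thesis by (simp add: Unif_def)
qed

lemma Unif_le: "F \<in> Unif A \<Longrightarrow> F \<le> principal (carrier A \<times> carrier A)"
  by (simp add: Unif_def uniformity_on_def)

lemma Unif_inf:
  assumes "F \<in> Unif A" "G \<in> Unif A"
  shows "inf F G \<in> Unif A"
proof -
  let ?S = "carrier A"
  note le = assms[THEN Unif_le]
  have u: "uniformity_on ?S F" "uniformity_on ?S G" and c: "compatible A F" "compatible A G"
    using assms by (auto simp: Unif_def)
  have "uniformity_on ?S (inf F G)"
    unfolding uniformity_on_def
  proof (intro conjI ballI)
    show "inf F G \<le> principal (?S \<times> ?S)" using le(1) by (rule le_infI1)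
  next
    fix U assume U: "U \<in> entourages ?S (inf F G)"
    obtain U1 U2 where U12: "U1 \<in> entourages ?S F" "U2 \<in> entourages ?S G" "U1 \<inter> U2 \<subseteq> U"
      using entourages_inf[OF U le] by blast
    have 1: "refl_on ?S U1" "U1\<inverse> \<in> entourages ?S F" "\<exists>V \<in> entourages ?S F. V O V \<subseteq> U1"
      using u(1) U12(1) unfolding uniformity_on_def by blast+
    have 2: "refl_on ?S U2" "U2\<inverse> \<in> entourages ?S G" "\<exists>V \<in> entourages ?S G. V O V \<subseteq> U2"
      using u(2) U12(2) unfolding uniformity_on_def by blast+
    show "refl_on ?S U" using 1(1) 2(1) U12(3) by (auto simp: refl_on_def)
    show "U\<inverse> \<in> entourages ?S (inf F G)"
      using entourages_infI[OF 1(2) 2(2)] by (rule entourages_superset)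
        (use U12(3) entourages_sub[OF U] in auto)
    obtain V1 V2 where V: "V1 \<in> entourages ?S F" "V1 O V1 \<subseteq> U1" "V2 \<in> entourages ?S G" "V2 O V2 \<subseteq> U2"
      using 1(3) 2(3) by blast
    then have "(V1 \<inter> V2) O (V1 \<inter> V2) \<subseteq> U" using U12(3) by blast
    then show "\<exists>V \<in> entourages ?S (inf F G). V O V \<subseteq> U" using entourages_infI[OF V(1,3)] by blast
  qed
  moreover have "compatible A (inf F G)"
    unfolding compatible_def
  proof (intro allI impI ballI)
    fix f n U assume f: "arity A f = Some n" and U: "U \<in> entourages ?S (inf F G)"
    obtain U1 U2 where U12: "U1 \<in> entourages ?S F" "U2 \<in> entourages ?S G" "U1 \<inter> U2 \<subseteq> U"
      using entourages_inf[OF U le] by blast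
    obtain V1 where V1: "V1 \<in> entourages ?S F"
      "\<forall>xs \<in> tuples ?S n. \<forall>ys \<in> tuples ?S n.
        list_all2 (\<lambda>x y. (x, y) \<in> V1) xs ys \<longrightarrow> (oper A f xs, oper A f ys) \<in> U1"
      using c(1)[unfolded compatible_def, rule_format, OF f U12(1)] by blast
    obtain V2 where V2: "V2 \<in> entourages ?S G"
      "\<forall>xs \<in> tuples ?S n. \<forall>ys \<in> tuples ?S n.
        list_all2 (\<lambda>x y. (x, y) \<in> V2) xs ys \<longrightarrow> (oper A f xs, oper A f ys) \<in> U2"
      using c(2)[unfolded compatible_def, rule_format, OF f U12(2)] by blast
    have "(oper A f xs, oper A f ys) \<in> U"
      if "xs \<in> tuples ?S n" "ys \<in> tuples ?S n" "list_all2 (\<lambda>x y. (x, y) \<in> V1 \<inter> V2) xs ys" for xs ys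
    proof -
      have "list_all2 (\<lambda>x y. (x, y) \<in> V1) xs ys" "list_all2 (\<lambda>x y. (x, y) \<in> V2) xs ys"
        using that(3) by (auto elim: list_all2_mono)
      then show ?thesis using V1(2) V2(2) that(1,2) U12(3) by blast
    qed
    then show "\<exists>U' \<in> entourages ?S (inf F G). \<forall>xs \<in> tuples ?S n. \<forall>ys \<in> tuples ?S n.
        list_all2 (\<lambda>x y. (x, y) \<in> U') xs ys \<longrightarrow> (oper A f xs, oper A f ys) \<in> U"
      using entourages_infI[OF V1(1) V2(1)] by blast
  qed
  ultimately show ?thesis by (simp add: Unif_def)
qed

lemma centralizes_inf:
  assumes "H \<in> Unif A" "K \<in> Unif A" "centralizes A F G H" "centralizes A F G K"
  shows "centralizes A F G (inf H K)"
  unfolding centralizes_def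
proof (intro allI ballI)
  let ?S = "carrier A"
  fix n n' t W assume t: "t \<in> nary_terms A (n + n')" and W: "W \<in> entourages ?S (inf H K)"
  obtain W1 W2 where W12: "W1 \<in> entourages ?S H" "W2 \<in> entourages ?S K" "W1 \<inter> W2 \<subseteq> W"
    using entourages_inf[OF W assms(1,2)[THEN Unif_le]] by blast
  obtain U1 V1 X1 where 1: "U1 \<in> entourages ?S F" "V1 \<in> entourages ?S G" "X1 \<in> entourages ?S H"
    "\<forall>(u11, u12, u21, u22) \<in> matrices A n n' t U1 V1. (u11, u12) \<in> X1 \<longrightarrow> (u21, u22) \<in> W1"
    using assms(3)[unfolded centralizes_def, rule_format, OF t W12(1)] by blast
  obtain U2 V2 X2 where 2: "U2 \<in> entourages ?S F" "V2 \<in> entourages ?S G" "X2 \<in> entourages ?S K"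
    "\<forall>(u11, u12, u21, u22) \<in> matrices A n n' t U2 V2. (u11, u12) \<in> X2 \<longrightarrow> (u21, u22) \<in> W2"
    using assms(4)[unfolded centralizes_def, rule_format, OF t W12(2)] by blast
  have m: "matrices A n n' t (U1 \<inter> U2) (V1 \<inter> V2) \<subseteq> matrices A n n' t U V"
    if "U1 \<inter> U2 \<subseteq> U" "V1 \<inter> V2 \<subseteq> V" for U V
  proof -
    have "list_all2 (\<lambda>x y. (x, y) \<in> R) xs ys" if "list_all2 (\<lambda>x y. (x, y) \<in> Q) xs ys" "Q \<subseteq> R"
      for Q R :: "('a \<times> 'a) set" and xs ys
      using that by (auto elim!: list_all2_mono)
    then show ?thesis using that unfolding matrices_def by blast
  qed
  have "\<forall>(u11, u12, u21, u22) \<in> matrices A n n' t (U1 \<inter> U2) (V1 \<inter> V2).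
      (u11, u12) \<in> X1 \<inter> X2 \<longrightarrow> (u21, u22) \<in> W"
    using m[of U1 V1] m[of U2 V2] 1(4) 2(4) W12(3) by fast
  then show "\<exists>U \<in> entourages ?S F. \<exists>V \<in> entourages ?S G. \<exists>W' \<in> entourages ?S (inf H K).
      \<forall>(u11, u12, u21, u22) \<in> matrices A n n' t U V. (u11, u12) \<in> W' \<longrightarrow> (u21, u22) \<in> W"
    using entourages_Int[OF 1(1) 2(1)] entourages_Int[OF 1(2) 2(2)] entourages_infI[OF 1(3) 2(3)]
    by blast
qed

lemma eval_vars_closed:
  assumes "is_algebra A" "wf_trm (arity A) t" "\<And>i. i \<in> vars t \<Longrightarrow> v i \<in> carrier A"
  shows "eval A v t \<in> carrier A"
  using assms(2,3)
proof (induction t)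
  case (Fn f ts)
  then have "set (map (eval A v) ts) \<subseteq> carrier A" by auto
  then show ?case using assms(1) Fn.prems(1) by (auto simp: is_algebra_def tuples_def)
qed auto

lemma term_op_closed:
  assumes "is_algebra A" "t \<in> nary_terms A n" "xs \<in> tuples (carrier A) n"
  shows "term_op A t xs \<in> carrier A"
  unfolding term_op_def
proof (rule eval_vars_closed[OF assms(1)])
  show "wf_trm (arity A) t" using assms(2) by (simp add: nary_terms_def)
  fix i assume "i \<in> vars t"
  then have "i < length xs" using assms(2,3) by (auto simp: nary_terms_def tuples_def)
  then show "xs ! i \<in> carrier A" using assms(3) nth_mem[of i xs] by (auto simp: tuples_def)
qed

lemma centralizes_top:
  assumes "is_algebra A" "F \<in> Unif A" "G \<in> Unif A"
  shows "centralizes A F G (principal (carrier A \<times> carrier A))"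
proof -
  let ?S = "carrier A"
  have e: "entourages ?S (principal (?S \<times> ?S)) = {?S \<times> ?S}"
    by (auto simp: entourages_def eventually_principal)
  have full: "?S \<times> ?S \<in> entourages ?S F" "?S \<times> ?S \<in> entourages ?S G"
    using assms(2,3)[THEN Unif_le] by (auto simp: entourages_def le_principal)
  have app: "xs @ ys \<in> tuples ?S (n + n')" if "xs \<in> tuples ?S n" "ys \<in> tuples ?S n'" for xs ys n n'
    using that by (auto simp: tuples_def)
  have "\<forall>(u11, u12, u21, u22) \<in> matrices A n n' t U V. (u21, u22) \<in> ?S \<times> ?S"
    if "t \<in> nary_terms A (n + n')" for n n' t U V
    unfolding matrices_def using term_op_closed[OF assms(1) that app] by blast
  then have "\<forall>(u11, u12, u21, u22) \<in> matrices A n n' t (?S \<times> ?S) (?S \<times> ?S).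
      (u11, u12) \<in> ?S \<times> ?S \<longrightarrow> (u21, u22) \<in> ?S \<times> ?S"
    if "t \<in> nary_terms A (n + n')" for n n' t
    using that by fast
  then show ?thesis
    unfolding centralizes_def e by (intro allI ballI bexI[OF _ full(1)] bexI[OF _ full(2)]) simp
qed

lemma Unif_Inf_gen:
  assumes P: "\<And>F. P F \<Longrightarrow> F \<in> Unif A" and top: "P (principal (carrier A \<times> carrier A))"
    and inf: "\<And>F G. P F \<Longrightarrow> P G \<Longrightarrow> P (inf F G)"
    and X: "\<And>F. F \<in> X \<Longrightarrow> P F"
    and U: "U \<in> entourages (carrier A) (Inf (insert (principal (carrier A \<times> carrier A)) X))"
  shows "\<exists>G. P G \<and> Inf (insert (principal (carrier A \<times> carrier A)) X) \<le> G \<and>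
    U \<in> entourages (carrier A) G"
proof -
  let ?T = "principal (carrier A \<times> carrier A)"
  have "eventually (\<lambda>p. p \<in> U) (Inf (insert ?T X))" using U unfolding entourages_def by blast
  then have "\<exists>B \<subseteq> insert ?T X. finite B \<and> eventually (\<lambda>p. p \<in> U) (Inf B)"
    by (rule eventually_Inf[THEN iffD1])
  then obtain B where B: "B \<subseteq> insert ?T X" "finite B" "eventually (\<lambda>p. p \<in> U) (Inf B)"
    by (elim exE conjE)
  have "P (Inf (insert ?T B))" using B(2,1)
  proof (induction B rule: finite_induct)
    case empty
    then show ?case using top by simp
  next
    case (insert F B)
    then have "P (inf F (Inf (insert ?T B)))" using X top by (intro inf) auto
    then show ?case by (simp add: inf_left_commute)
  qed
  moreover have "Inf (insert ?T X) \<le> Inf (insert ?T B)"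
    using B(1) by (intro Inf_superset_mono) auto
  moreover have "eventually (\<lambda>p. p \<in> U) (Inf (insert ?T B))"
    by (rule filter_leD[OF _ B(3)]) (auto intro: Inf_superset_mono)
  then have "U \<in> entourages (carrier A) (Inf (insert ?T B))"
    using U by (auto simp: entourages_def)
  ultimately show ?thesis by blast
qed

lemma Unif_Inf:
  assumes "is_algebra A" "X \<subseteq> Unif A"
  shows "Inf (insert (principal (carrier A \<times> carrier A)) X) \<in> Unif A" (is "?F \<in> _")
proof -
  let ?S = "carrier A"
  have ex: "\<exists>G. G \<in> Unif A \<and> ?F \<le> G \<and> U \<in> entourages ?S G" if "U \<in> entourages ?S ?F" for U
    by (rule Unif_Inf_gen) (use assms that in \<open>auto intro: Unif_top Unif_inf\<close>)
  have "uniformity_on ?S ?F"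
    unfolding uniformity_on_def
  proof (intro conjI ballI)
    show "?F \<le> principal (?S \<times> ?S)" by (rule Inf_lower) simp
  next
    fix U assume "U \<in> entourages ?S ?F"
    then obtain G where G: "G \<in> Unif A" "?F \<le> G" "U \<in> entourages ?S G" using ex by blast
    have "refl_on ?S U \<and> U\<inverse> \<in> entourages ?S G \<and> (\<exists>V \<in> entourages ?S G. V O V \<subseteq> U)"
      using G(1,3) unfolding Unif_def uniformity_on_def by blast
    then show "refl_on ?S U" "U\<inverse> \<in> entourages ?S ?F" "\<exists>V \<in> entourages ?S ?F. V O V \<subseteq> U"
      using entourages_mono[OF G(2)] by blast+
  qed
  moreover have "compatible A ?F"
    unfolding compatible_def
  proof (intro allI impI ballI)
    fix f n U assume f: "arity A f = Some n" and "U \<in> entourages ?S ?F"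
    then obtain G where G: "G \<in> Unif A" "?F \<le> G" "U \<in> entourages ?S G" using ex by blast
    then have "compatible A G" by (simp add: Unif_def)
    from this[unfolded compatible_def, rule_format, OF f G(3)]
    show "\<exists>U' \<in> entourages ?S ?F. \<forall>xs \<in> tuples ?S n. \<forall>ys \<in> tuples ?S n.
        list_all2 (\<lambda>x y. (x, y) \<in> U') xs ys \<longrightarrow> (oper A f xs, oper A f ys) \<in> U"
      using entourages_mono[OF G(2)] by blast
  qed
  ultimately show ?thesis by (simp add: Unif_def)
qed

lemma centralizes_Inf:
  assumes "is_algebra A" "F \<in> Unif A" "G \<in> Unif A"
    and X: "\<And>H. H \<in> X \<Longrightarrow> H \<in> Unif A \<and> centralizes A F G H"
  shows "centralizes A F G (Inf (insert (principal (carrier A \<times> carrier A)) X))" (is "centralizes _ _ _ ?H")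
  unfolding centralizes_def
proof (intro allI ballI)
  let ?S = "carrier A"
  fix n n' t W assume t: "t \<in> nary_terms A (n + n')" and W: "W \<in> entourages ?S ?H"
  have "\<exists>K. (K \<in> Unif A \<and> centralizes A F G K) \<and> ?H \<le> K \<and> W \<in> entourages ?S K"
    by (rule Unif_Inf_gen)
      (use assms W in \<open>auto intro: Unif_top Unif_inf centralizes_top centralizes_inf\<close>)
  then obtain K where K: "centralizes A F G K" "?H \<le> K" "W \<in> entourages ?S K" by blast
  from K(1)[unfolded centralizes_def, rule_format, OF t K(3)]
  show "\<exists>U \<in> entourages ?S F. \<exists>V \<in> entourages ?S G. \<exists>W' \<in> entourages ?S ?H.
      \<forall>(u11, u12, u21, u22) \<in> matrices A n n' t U V. (u11, u12) \<in> W' \<longrightarrow> (u21, u22) \<in> W"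
    using entourages_mono[OF K(2)] by blast
qed

theorem Unif_Join_is_lub:
  assumes "is_algebra A" "X \<subseteq> Unif A"
  shows "Unif_Join A X \<in> Unif A" and "F \<in> X \<Longrightarrow> F \<le> Unif_Join A X"
    and "W \<in> Unif A \<Longrightarrow> (\<And>F. F \<in> X \<Longrightarrow> F \<le> W) \<Longrightarrow> Unif_Join A X \<le> W"
proof -
  let ?Q = "\<lambda>W. W \<in> Unif A \<and> (\<forall>F \<in> X. F \<le> W)"
  let ?J = "Inf (insert (principal (carrier A \<times> carrier A)) (Collect ?Q))"
  have "?J \<in> Unif A" using assms(1) by (rule Unif_Inf) auto
  moreover have "\<forall>F \<in> X. F \<le> ?J"
    using assms(2) Unif_le by (blast intro: Inf_greatest)
  moreover have low: "?J \<le> W" if "?Q W" for W using that by (intro Inf_lower) auto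
  ultimately have J: "Unif_Join A X = ?J" "?Q ?J"
    unfolding Unif_Join_def by (auto intro!: Least_equality)
  show "Unif_Join A X \<in> Unif A" "F \<in> X \<Longrightarrow> F \<le> Unif_Join A X"
    using J(2) unfolding J(1) by blast+
  show "W \<in> Unif A \<Longrightarrow> (\<And>F. F \<in> X \<Longrightarrow> F \<le> W) \<Longrightarrow> Unif_Join A X \<le> W"
    unfolding J(1) by (rule low) blast
qed

theorem commutator_is_least:
  assumes "is_algebra A" "F \<in> Unif A" "G \<in> Unif A"
  shows "commutator A F G \<in> Unif A" and "centralizes A F G (commutator A F G)"
    and "W \<in> Unif A \<Longrightarrow> centralizes A F G W \<Longrightarrow> commutator A F G \<le> W"
proof -
  let ?Q = "\<lambda>W. W \<in> Unif A \<and> centralizes A F G W"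
  let ?J = "Inf (insert (principal (carrier A \<times> carrier A)) (Collect ?Q))"
  have "?J \<in> Unif A" using assms(1) by (rule Unif_Inf) auto
  moreover have "centralizes A F G ?J" using assms by (rule centralizes_Inf) auto
  moreover have low: "?J \<le> W" if "?Q W" for W using that by (intro Inf_lower) auto
  ultimately have J: "commutator A F G = ?J" "?Q ?J"
    unfolding commutator_def by (auto intro!: Least_equality)
  show "commutator A F G \<in> Unif A" "centralizes A F G (commutator A F G)"
    using J(2) unfolding J(1) by blast+
  show "W \<in> Unif A \<Longrightarrow> centralizes A F G W \<Longrightarrow> commutator A F G \<le> W"
    unfolding J(1) by (rule low) blast
qed


section \<open>Adequacy of the universe in \<open>congruence_modular_variety\<close>\<close>

lemma eval_closed:
  assumes "is_algebra A" "range v \<subseteq> carrier A" "wf_trm (arity A) t"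
  shows "eval A v t \<in> carrier A"
  using assms(3)
proof (induction t)
  case (Var x)
  then show ?case using assms(2) by auto
next
  case (Fn f ts)
  then show ?case
    using assms(1) by (auto simp: is_algebra_def tuples_def image_subset_iff)
qed

lemma cong_join_least: "congruence A \<theta> \<Longrightarrow> \<alpha> \<union> \<beta> \<subseteq> \<theta> \<Longrightarrow> cong_join A \<alpha> \<beta> \<subseteq> \<theta>"
  by (auto simp: cong_join_def)

lemma congruence_sub: "congruence A \<theta> \<Longrightarrow> \<theta> \<subseteq> carrier A \<times> carrier A"
  by (auto simp: congruence_def equiv_def)

lemma congruence_oper:
  "congruence A \<theta> \<Longrightarrow> arity A f = Some (length xs) \<Longrightarrow> list_all2 (\<lambda>x y. (x, y) \<in> \<theta>) xs ys \<Longrightarrow>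
    (oper A f xs, oper A f ys) \<in> \<theta>"
  by (auto simp: congruence_def)

lemma congruence_top:
  assumes "is_algebra A"
  shows "congruence A (carrier A \<times> carrier A)"
proof -
  have "xs \<in> tuples (carrier A) (length xs) \<and> ys \<in> tuples (carrier A) (length xs)"
    if "list_all2 (\<lambda>x y. x \<in> carrier A \<and> y \<in> carrier A) xs ys" for xs ys
    using that by (induction xs ys rule: list_all2_induct) (auto simp: tuples_def)
  then show ?thesis
    using assms by (auto simp: congruence_def is_algebra_def equiv_def refl_on_def sym_def trans_def)
qed

lemma congruence_Inter:
  assumes "T \<noteq> {}" "\<And>\<theta>. \<theta> \<in> T \<Longrightarrow> congruence A \<theta>"
  shows "congruence A (\<Inter> T)"
  unfolding congruence_def equiv_def
proof (intro conjI allI impI)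
  have e: "refl_on (carrier A) \<theta>" "sym \<theta>" "trans \<theta>" if "\<theta> \<in> T" for \<theta>
    using assms(2)[OF that] by (auto simp: congruence_def equiv_def)
  show "\<Inter> T \<subseteq> carrier A \<times> carrier A" using assms congruence_sub by blast
  show "refl_on (carrier A) (\<Inter> T)" using e(1) by (auto simp: refl_on_def)
  show "sym (\<Inter> T)" using symD[OF e(2)] by (intro symI) blast
  show "trans (\<Inter> T)" using transD[OF e(3)] by (intro transI) blast
next
  fix f n xs ys
  assume *: "arity A f = Some n" "length xs = n" "list_all2 (\<lambda>x y. (x, y) \<in> \<Inter> T) xs ys"
  show "(oper A f xs, oper A f ys) \<in> \<Inter> T"
  proof
    fix \<theta> assume \<theta>: "\<theta> \<in> T"
    then have "list_all2 (\<lambda>x y. (x, y) \<in> \<theta>) xs ys"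
      using *(3) by (auto elim: list_all2_mono)
    then show "(oper A f xs, oper A f ys) \<in> \<theta>"
      using congruence_oper[OF assms(2)[OF \<theta>], of f xs ys] *(1,2) by simp
  qed
qed

lemma congruence_cong_join:
  assumes "is_algebra A" "congruence A \<alpha>" "congruence A \<beta>"
  shows "congruence A (cong_join A \<alpha> \<beta>)"
  unfolding cong_join_def
proof (rule congruence_Inter)
  have "carrier A \<times> carrier A \<in> {\<theta>. congruence A \<theta> \<and> \<alpha> \<union> \<beta> \<subseteq> \<theta>}"
    using congruence_top[OF assms(1)] assms(2,3)[THEN congruence_sub] by simp
  then show "{\<theta>. congruence A \<theta> \<and> \<alpha> \<union> \<beta> \<subseteq> \<theta>} \<noteq> {}" by blast
qed simp

lemma congruence_Int: "congruence A \<alpha> \<Longrightarrow> congruence A \<beta> \<Longrightarrow> congruence A (\<alpha> \<inter> \<beta>)"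
  using congruence_Inter[of "{\<alpha>, \<beta>}" A] by auto

lemma modular_ConI:
  assumes "\<And>\<alpha> \<beta> \<gamma> x y. congruence A \<alpha> \<Longrightarrow> congruence A \<beta> \<Longrightarrow> congruence A \<gamma> \<Longrightarrow> \<alpha> \<subseteq> \<gamma> \<Longrightarrow>
    (x, y) \<in> cong_join A \<alpha> \<beta> \<Longrightarrow> (x, y) \<in> \<gamma> \<Longrightarrow> (x, y) \<in> cong_join A \<alpha> (\<beta> \<inter> \<gamma>)"
  shows "modular_Con A"
  unfolding modular_Con_def
proof (intro allI impI equalityI)
  fix \<alpha> \<beta> \<gamma> assume c: "congruence A \<alpha>" "congruence A \<beta>" "congruence A \<gamma>" "\<alpha> \<subseteq> \<gamma>"
  show "cong_join A \<alpha> \<beta> \<inter> \<gamma> \<subseteq> cong_join A \<alpha> (\<beta> \<inter> \<gamma>)" using assms c by auto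
  have "cong_join A \<alpha> (\<beta> \<inter> \<gamma>) \<subseteq> \<gamma>" using c by (intro cong_join_least) auto
  moreover have "cong_join A \<alpha> (\<beta> \<inter> \<gamma>) \<subseteq> cong_join A \<alpha> \<beta>" by (auto simp: cong_join_def)
  ultimately show "cong_join A \<alpha> (\<beta> \<inter> \<gamma>) \<subseteq> cong_join A \<alpha> \<beta> \<inter> \<gamma>" by blast
qed

definition restr :: "('a, 'f) ualgebra \<Rightarrow> 'a set \<Rightarrow> ('a, 'f) ualgebra" where
  "restr A S = A\<lparr>carrier := S\<rparr>"

lemma restr_simps [simp]:
  "carrier (restr A S) = S" "arity (restr A S) = arity A" "oper (restr A S) = oper A"
  by (simp_all add: restr_def)

lemma eval_restr [simp]: "eval (restr A S) v t = eval A v t"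
  by (induction t) (auto cong: map_cong)

lemma congruence_restr:
  assumes "congruence A \<theta>" "S \<subseteq> carrier A" "is_algebra (restr A S)"
  shows "congruence (restr A S) (\<theta> \<inter> S \<times> S)"
  unfolding congruence_def equiv_def
proof (intro conjI allI impI)
  have e: "refl_on (carrier A) \<theta>" "sym \<theta>" "trans \<theta>"
    using assms(1) by (auto simp: congruence_def equiv_def)
  show "refl_on (carrier (restr A S)) (\<theta> \<inter> S \<times> S)" using e(1) assms(2) by (auto simp: refl_on_def)
  show "sym (\<theta> \<inter> S \<times> S)" using e(2) by (intro symI) (auto dest: symD)
  show "trans (\<theta> \<inter> S \<times> S)" using e(3) by (intro transI) (auto dest: transD)
  show "\<theta> \<inter> S \<times> S \<subseteq> carrier (restr A S) \<times> carrier (restr A S)" by simp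
next
  fix f n xs ys
  assume *: "arity (restr A S) f = Some n" "length xs = n"
    "list_all2 (\<lambda>x y. (x, y) \<in> \<theta> \<inter> S \<times> S) xs ys"
  have "list_all2 (\<lambda>x y. (x, y) \<in> \<theta>) xs ys" using *(3) by (auto elim: list_all2_mono)
  moreover have "xs \<in> tuples S n \<and> ys \<in> tuples S n"
    using *(3) unfolding *(2)[symmetric]
    by (induction xs ys rule: list_all2_induct) (auto simp: tuples_def)
  ultimately show "(oper (restr A S) f xs, oper (restr A S) f ys) \<in> \<theta> \<inter> S \<times> S"
    using * assms congruence_oper[of A \<theta> f xs ys] by (auto simp: is_algebra_def)
qed

lemma cong_join_restr_mono:
  assumes "S \<subseteq> T" "is_algebra (restr A S)" "is_algebra (restr A T)"
  shows "cong_join (restr A S) (\<alpha> \<inter> S \<times> S) (\<beta> \<inter> S \<times> S)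
    \<subseteq> cong_join (restr A T) (\<alpha> \<inter> T \<times> T) (\<beta> \<inter> T \<times> T)"
  unfolding cong_join_def[of "restr A T"]
proof (rule Inter_greatest)
  fix \<theta> assume \<theta>: "\<theta> \<in> {\<theta>. congruence (restr A T) \<theta> \<and> \<alpha> \<inter> T \<times> T \<union> \<beta> \<inter> T \<times> T \<subseteq> \<theta>}"
  have "congruence (restr (restr A T) S) (\<theta> \<inter> S \<times> S)"
    using \<theta> assms by (intro congruence_restr) (auto simp: restr_def)
  then have "congruence (restr A S) (\<theta> \<inter> S \<times> S)" by (simp add: restr_def)
  then have "cong_join (restr A S) (\<alpha> \<inter> S \<times> S) (\<beta> \<inter> S \<times> S) \<subseteq> \<theta> \<inter> S \<times> S"
    using \<theta> assms(1) by (intro cong_join_least) auto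
  then show "cong_join (restr A S) (\<alpha> \<inter> S \<times> S) (\<beta> \<inter> S \<times> S) \<subseteq> \<theta>" by blast
qed

inductive_set gen :: "('a, 'f) ualgebra \<Rightarrow> 'a set \<Rightarrow> 'a set" for A S where
  base: "x \<in> S \<Longrightarrow> x \<in> gen A S"
| oper: "arity A f = Some (length xs) \<Longrightarrow> \<forall>x \<in> set xs. x \<in> gen A S \<Longrightarrow> oper A f xs \<in> gen A S"

lemma is_algebra_gen: "is_algebra (restr A (gen A S))"
  by (auto simp: is_algebra_def tuples_def intro!: gen.oper)

lemma gen_mono: assumes "S \<subseteq> T" shows "gen A S \<subseteq> gen A T"
proof
  fix x assume "x \<in> gen A S"
  then show "x \<in> gen A T" by induction (use assms in \<open>auto intro: gen.intros\<close>)
qed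

lemma gen_sub: assumes "is_algebra A" "S \<subseteq> carrier A" shows "gen A S \<subseteq> carrier A"
proof
  fix x assume "x \<in> gen A S"
  then show "x \<in> carrier A"
  proof induction
    case (oper f xs)
    then have "xs \<in> tuples (carrier A) (length xs)" by (auto simp: tuples_def)
    then show ?case using assms(1) oper by (auto simp: is_algebra_def)
  qed (use assms in auto)
qed

lemma gen_eval:
  assumes "x \<in> gen A (range v)"
  shows "\<exists>t. wf_trm (arity A) t \<and> eval A v t = x"
  using assms
proof induction
  case (base x)
  then obtain i where "x = v i" by auto
  then show ?case by (intro exI[of _ "Var i"]) auto
next
  case (oper f xs)
  then obtain g where g: "\<forall>x \<in> set xs. wf_trm (arity A) (g x) \<and> eval A v (g x) = x" by metis
  then have "map (eval A v) (map g xs) = xs" by (auto simp: map_idI)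
  then show ?case using oper g by (intro exI[of _ "Fn f (map g xs)"]) (auto simp: comp_def)
qed

lemma variety_restr:
  assumes "A \<in> variety sig E" "S \<subseteq> carrier A" "is_algebra (restr A S)"
  shows "restr A S \<in> variety sig E"
  using assms by (fastforce simp: variety_def)

text \<open>A pair in a join of congruences is so in some finitely generated subalgebra.\<close>

lemma cong_join_fin:
  assumes "is_algebra A" "congruence A \<alpha>" "congruence A \<beta>" "(x, y) \<in> cong_join A \<alpha> \<beta>"
  shows "\<exists>S. finite S \<and> S \<subseteq> carrier A \<and>
    (x, y) \<in> cong_join (restr A (gen A S)) (\<alpha> \<inter> gen A S \<times> gen A S) (\<beta> \<inter> gen A S \<times> gen A S)"
proof -
  define J where "J S = cong_join (restr A (gen A S)) (\<alpha> \<inter> gen A S \<times> gen A S)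
    (\<beta> \<inter> gen A S \<times> gen A S)" for S
  define R where "R = {(x, y). \<exists>S. finite S \<and> S \<subseteq> carrier A \<and> (x, y) \<in> J S}"
  have J_cong: "congruence (restr A (gen A S)) (J S)" if "S \<subseteq> carrier A" for S
    unfolding J_def using gen_sub[OF assms(1) that] assms that is_algebra_gen
    by (intro congruence_cong_join congruence_restr) auto
  have J_mono: "J S \<subseteq> J T" if "S \<subseteq> T" for S T
    unfolding J_def by (intro cong_join_restr_mono gen_mono is_algebra_gen that)
  have J_sup: "\<alpha> \<inter> gen A S \<times> gen A S \<union> \<beta> \<inter> gen A S \<times> gen A S \<subseteq> J S" for S
    unfolding J_def cong_join_def by blast
  have "congruence A R"
    unfolding congruence_def equiv_def
  proof (intro conjI allI impI)
    show "R \<subseteq> carrier A \<times> carrier A"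
    proof safe
      fix x y assume "(x, y) \<in> R"
      then obtain S where S: "S \<subseteq> carrier A" "(x, y) \<in> J S" by (auto simp: R_def)
      then show "x \<in> carrier A" "y \<in> carrier A"
        using congruence_sub[OF J_cong[OF S(1)]] gen_sub[OF assms(1) S(1)] by auto
    qed
    show "refl_on (carrier A) R"
    proof (rule refl_onI)
      fix x assume x: "x \<in> carrier A"
      have "refl_on (gen A {x}) (J {x})"
        using J_cong[of "{x}"] x by (auto simp: congruence_def equiv_def)
      then have "(x, x) \<in> J {x}" by (auto simp: refl_on_def intro: gen.base)
      then show "(x, x) \<in> R" unfolding R_def using x by auto
    qed
    show "sym R"
    proof (rule symI)
      fix x y assume "(x, y) \<in> R"
      then obtain S where S: "finite S" "S \<subseteq> carrier A" "(x, y) \<in> J S" by (auto simp: R_def)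
      then have "(y, x) \<in> J S" using J_cong[of S] by (auto simp: congruence_def equiv_def dest: symD)
      then show "(y, x) \<in> R" using S by (auto simp: R_def)
    qed
    show "trans R"
    proof (rule transI)
      fix x y z assume "(x, y) \<in> R" "(y, z) \<in> R"
      then obtain S T where S: "finite S" "S \<subseteq> carrier A" "(x, y) \<in> J S"
        and T: "finite T" "T \<subseteq> carrier A" "(y, z) \<in> J T" by (auto simp: R_def)
      have "(x, y) \<in> J (S \<union> T)" "(y, z) \<in> J (S \<union> T)"
        using S T J_mono[of S "S \<union> T"] J_mono[of T "S \<union> T"] by auto
      then have "(x, z) \<in> J (S \<union> T)"
        using J_cong[of "S \<union> T"] S T by (auto simp: congruence_def equiv_def dest: transD)
      then show "(x, z) \<in> R" using S T unfolding R_def by (auto intro!: exI[of _ "S \<union> T"])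
    qed
  next
    fix f n xs ys
    assume *: "arity A f = Some n" "length xs = n" "list_all2 (\<lambda>x y. (x, y) \<in> R) xs ys"
    from *(3) have "\<exists>S. finite S \<and> S \<subseteq> carrier A \<and> list_all2 (\<lambda>x y. (x, y) \<in> J S) xs ys"
    proof (induction xs ys rule: list_all2_induct)
      case Nil
      then show ?case by (intro exI[of _ "{}"]) auto
    next
      case (Cons x xs y ys)
      then obtain S T where S: "finite S" "S \<subseteq> carrier A" "(x, y) \<in> J S"
        and T: "finite T" "T \<subseteq> carrier A" "list_all2 (\<lambda>x y. (x, y) \<in> J T) xs ys"
        by (auto simp: R_def)
      have "list_all2 (\<lambda>x y. (x, y) \<in> J (S \<union> T)) xs ys"
        using T(3) J_mono[of T "S \<union> T"] by (auto elim!: list_all2_mono)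
      then show ?case using S T J_mono[of S "S \<union> T"] by (intro exI[of _ "S \<union> T"]) auto
    qed
    then obtain S where S: "finite S" "S \<subseteq> carrier A" "list_all2 (\<lambda>x y. (x, y) \<in> J S) xs ys" by blast
    then have "(oper A f xs, oper A f ys) \<in> J S"
      using congruence_oper[OF J_cong[OF S(2)], of f xs ys] * by auto
    then show "(oper A f xs, oper A f ys) \<in> R" using S by (auto simp: R_def)
  qed
  moreover have "\<alpha> \<union> \<beta> \<subseteq> R"
  proof
    fix p assume p: "p \<in> \<alpha> \<union> \<beta>"
    obtain a b where ab: "p = (a, b)" by (cases p)
    have "a \<in> carrier A" "b \<in> carrier A" using p ab assms congruence_sub by blast+
    moreover have "a \<in> gen A {a, b}" "b \<in> gen A {a, b}" by (auto intro: gen.base)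
    then have "(a, b) \<in> J {a, b}" using J_sup[of "{a, b}"] p ab by blast
    ultimately show "p \<in> R" unfolding R_def ab by (auto intro!: exI[of _ "{a, b}"])
  qed
  ultimately have "cong_join A \<alpha> \<beta> \<subseteq> R" by (rule cong_join_least)
  then show ?thesis using assms(4) unfolding R_def J_def by blast
qed

context
  fixes C :: "('a, 'f) ualgebra" and D :: "('b, 'f) ualgebra" and h :: "'a \<Rightarrow> 'b"
  assumes inj: "inj_on h (carrier C)" and car: "carrier D = h ` carrier C"
    and ar: "arity D = arity C" and C: "is_algebra C"
    and op: "\<And>f xs. arity C f = Some (length xs) \<Longrightarrow> set xs \<subseteq> carrier C \<Longrightarrow>
      oper D f (map h xs) = h (oper C f xs)"
begin

lemma iso_is_algebra: "is_algebra D"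
  unfolding is_algebra_def
proof (intro allI impI ballI)
  fix f n ys assume *: "arity D f = Some n" "ys \<in> tuples (carrier D) n"
  then have "ys \<in> lists (h ` carrier C)" by (auto simp: tuples_def car)
  then obtain xs where xs: "xs \<in> lists (carrier C)" "ys = map h xs"
    by (auto simp: lists_image)
  then have "oper C f xs \<in> carrier C" using * C by (auto simp: ar is_algebra_def tuples_def)
  then show "oper D f ys \<in> carrier D" using op[of f xs] xs * by (auto simp: ar car tuples_def)
qed

lemma iso_eval:
  assumes "range w \<subseteq> carrier C" "wf_trm (arity C) t"
  shows "eval D (h \<circ> w) t = h (eval C w t)"
  using assms(2)
proof (induction t)
  case (Fn f ts)
  have eq: "map (eval D (h \<circ> w)) ts = map h (map (eval C w) ts)"
    using Fn by (simp add: comp_def)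
  have "set (map (eval C w) ts) \<subseteq> carrier C"
    using Fn eval_closed[OF C assms(1)] by auto
  then have "oper D f (map h (map (eval C w) ts)) = h (oper C f (map (eval C w) ts))"
    using Fn(2) by (intro op) auto
  then show ?case unfolding eval.simps eq .
qed auto

lemma iso_variety:
  assumes "C \<in> variety sig E" "\<forall>(s, t) \<in> E. wf_trm sig s \<and> wf_trm sig t"
  shows "D \<in> variety sig E"
proof -
  have "eval D v s = eval D v t" if st: "(s, t) \<in> E" and v: "range v \<subseteq> carrier D" for s t v
  proof -
    define w where "w = inv_into (carrier C) h \<circ> v"
    have v_mem: "v i \<in> h ` carrier C" for i using v car by auto
    then have "range w \<subseteq> carrier C" by (auto simp: w_def intro: inv_into_into)
    moreover have "v = h \<circ> w" using v_mem by (auto simp: w_def f_inv_into_f fun_eq_iff)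
    moreover have "wf_trm (arity C) s" "wf_trm (arity C) t" using assms st by (auto simp: variety_def)
    moreover have "eval C w s = eval C w t"
      using assms(1) st \<open>range w \<subseteq> carrier C\<close> by (fastforce simp: variety_def)
    ultimately show ?thesis using iso_eval[of w] by metis
  qed
  then show ?thesis using assms(1) iso_is_algebra by (auto simp: variety_def ar)
qed

lemma iso_congruence_image:
  assumes "congruence C \<theta>"
  shows "congruence D (map_prod h h ` \<theta>)"
proof -
  have sub: "\<theta> \<subseteq> carrier C \<times> carrier C" and r: "refl_on (carrier C) \<theta>" and s: "sym \<theta>" and t: "trans \<theta>"
    using assms by (auto simp: congruence_def equiv_def)
  show ?thesis
    unfolding congruence_def equiv_def
  proof (intro conjI allI impI)
    show "map_prod h h ` \<theta> \<subseteq> carrier D \<times> carrier D" using sub by (auto simp: car)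
    show "refl_on (carrier D) (map_prod h h ` \<theta>)" using r by (force simp: car refl_on_def)
    show "sym (map_prod h h ` \<theta>)"
    proof (rule symI)
      fix x y assume "(x, y) \<in> map_prod h h ` \<theta>"
      then obtain a b where "(a, b) \<in> \<theta>" "x = h a" "y = h b" by auto
      then show "(y, x) \<in> map_prod h h ` \<theta>" using symD[OF s] by force
    qed
    show "trans (map_prod h h ` \<theta>)"
    proof (rule transI)
      fix x y z assume "(x, y) \<in> map_prod h h ` \<theta>" "(y, z) \<in> map_prod h h ` \<theta>"
      then obtain a b b' c where "(a, b) \<in> \<theta>" "(b', c) \<in> \<theta>" "x = h a" "y = h b" "y = h b'" "z = h c"
        by auto
      moreover from this have "b = b'" using sub inj by (auto dest: inj_onD)
      ultimately show "(x, z) \<in> map_prod h h ` \<theta>" using t by (force dest: transD)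
    qed
  next
    fix f n xs ys
    assume *: "arity D f = Some n" "length xs = n" "list_all2 (\<lambda>x y. (x, y) \<in> map_prod h h ` \<theta>) xs ys"
    from *(3) have "\<exists>as bs. xs = map h as \<and> ys = map h bs \<and> list_all2 (\<lambda>x y. (x, y) \<in> \<theta>) as bs \<and>
        set as \<subseteq> carrier C \<and> set bs \<subseteq> carrier C"
    proof (induction xs ys rule: list_all2_induct)
      case (Cons x xs y ys)
      then obtain as bs a b where "xs = map h as" "ys = map h bs" "list_all2 (\<lambda>x y. (x, y) \<in> \<theta>) as bs"
        "set as \<subseteq> carrier C" "set bs \<subseteq> carrier C" "(a, b) \<in> \<theta>" "x = h a" "y = h b" by auto
      then show ?case using sub by (intro exI[of _ "a # as"] exI[of _ "b # bs"]) auto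
    qed simp
    then obtain as bs where ab: "xs = map h as" "ys = map h bs" "list_all2 (\<lambda>x y. (x, y) \<in> \<theta>) as bs"
      "set as \<subseteq> carrier C" "set bs \<subseteq> carrier C" by blast
    have len: "length as = length bs" using ab(3) by (rule list_all2_lengthD)
    have "(oper C f as, oper C f bs) \<in> \<theta>"
      using congruence_oper[OF assms, of f as bs] ab * by (auto simp: ar)
    then show "(oper D f xs, oper D f ys) \<in> map_prod h h ` \<theta>"
      using op[of f as] op[of f bs] ab * len by (force simp: ar)
  qed
qed

lemma iso_congruence_vimage:
  assumes "congruence D \<theta>"
  shows "congruence C {(x, y). x \<in> carrier C \<and> y \<in> carrier C \<and> (h x, h y) \<in> \<theta>}" (is "congruence C ?R")
proof -
  have r: "refl_on (carrier D) \<theta>" and s: "sym \<theta>" and t: "trans \<theta>"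
    using assms by (auto simp: congruence_def equiv_def)
  show ?thesis
    unfolding congruence_def equiv_def
  proof (intro conjI allI impI)
    show "?R \<subseteq> carrier C \<times> carrier C" by auto
    show "refl_on (carrier C) ?R" using r by (auto simp: refl_on_def car)
    show "sym ?R" by (rule symI) (use s in \<open>auto dest: symD\<close>)
    show "trans ?R" by (rule transI) (use t in \<open>auto dest: transD\<close>)
  next
    fix f n xs ys
    assume *: "arity C f = Some n" "length xs = n" "list_all2 (\<lambda>x y. (x, y) \<in> ?R) xs ys"
    from *(3) have l: "set xs \<subseteq> carrier C \<and> set ys \<subseteq> carrier C \<and> length xs = length ys \<and>
        list_all2 (\<lambda>x y. (x, y) \<in> \<theta>) (map h xs) (map h ys)"
      by (induction xs ys rule: list_all2_induct) auto
    then have "(oper D f (map h xs), oper D f (map h ys)) \<in> \<theta>"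
      using congruence_oper[OF assms, of f "map h xs" "map h ys"] * by (auto simp: ar)
    moreover have "oper C f xs \<in> carrier C" "oper C f ys \<in> carrier C"
      using l * C by (auto simp: is_algebra_def tuples_def)
    ultimately show "(oper C f xs, oper C f ys) \<in> ?R"
      using l * op[of f xs] op[of f ys] by auto
  qed
qed

lemma iso_modular:
  assumes "modular_Con D"
  shows "modular_Con C"
proof (rule modular_ConI)
  fix \<alpha> \<beta> \<gamma> x y
  assume c: "congruence C \<alpha>" "congruence C \<beta>" "congruence C \<gamma>" "\<alpha> \<subseteq> \<gamma>"
    and xy: "(x, y) \<in> cong_join C \<alpha> \<beta>" "(x, y) \<in> \<gamma>"
  let ?h = "\<lambda>\<theta>. map_prod h h ` \<theta>"
  note sub = c(1-3)[THEN congruence_sub]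
  have inj2: "inj_on (map_prod h h) (carrier C \<times> carrier C)" using inj by (simp add: map_prod_inj_on)
  have "(h x, h y) \<in> cong_join D (?h \<alpha>) (?h \<beta>)"
    unfolding cong_join_def
  proof safe
    fix \<theta> assume \<theta>: "congruence D \<theta>" "?h \<alpha> \<union> ?h \<beta> \<subseteq> \<theta>"
    have "cong_join C \<alpha> \<beta> \<subseteq> {(x, y). x \<in> carrier C \<and> y \<in> carrier C \<and> (h x, h y) \<in> \<theta>}"
      using \<theta> sub by (intro cong_join_least iso_congruence_vimage) auto
    then show "(h x, h y) \<in> \<theta>" using xy by auto
  qed
  moreover have "(h x, h y) \<in> ?h \<gamma>" using xy by force
  moreover have "cong_join D (?h \<alpha>) (?h \<beta>) \<inter> ?h \<gamma> = cong_join D (?h \<alpha>) (?h \<beta> \<inter> ?h \<gamma>)"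
    using assms[unfolded modular_Con_def, rule_format, of "?h \<alpha>" "?h \<beta>" "?h \<gamma>"]
      c(1-3)[THEN iso_congruence_image] image_mono[OF c(4), of "map_prod h h"] by simp
  ultimately have "(h x, h y) \<in> cong_join D (?h \<alpha>) (?h \<beta> \<inter> ?h \<gamma>)" by (metis IntI)
  then have 1: "(h x, h y) \<in> cong_join D (?h \<alpha>) (?h (\<beta> \<inter> \<gamma>))"
    using inj_on_image_Int[OF inj2 sub(2,3)] by simp
  show "(x, y) \<in> cong_join C \<alpha> (\<beta> \<inter> \<gamma>)"
    unfolding cong_join_def
  proof safe
    fix \<theta> assume \<theta>: "congruence C \<theta>" "\<alpha> \<union> \<beta> \<inter> \<gamma> \<subseteq> \<theta>"
    have "cong_join D (?h \<alpha>) (?h (\<beta> \<inter> \<gamma>)) \<subseteq> ?h \<theta>"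
      using \<theta> by (intro cong_join_least iso_congruence_image) auto
    then have "map_prod h h (x, y) \<in> ?h \<theta>" using 1 by (simp add: subset_iff)
    moreover have mem: "(x, y) \<in> carrier C \<times> carrier C" using xy(2) sub(3) by blast
    ultimately show "(x, y) \<in> \<theta>"
      by (intro inj_on_image_mem_iff[OF inj2 mem congruence_sub[OF \<theta>(1)], THEN iffD1])
  qed
qed

end

theorem congruence_modular_varietyD:
  fixes B :: "('b, 'f) ualgebra"
  assumes cm: "congruence_modular_variety sig E" and B: "B \<in> variety sig E"
  shows "modular_Con B"
proof (rule modular_ConI)
  fix \<alpha> \<beta> \<gamma> x y
  assume c: "congruence B \<alpha>" "congruence B \<beta>" "congruence B \<gamma>" "\<alpha> \<subseteq> \<gamma>"
    and xy: "(x, y) \<in> cong_join B \<alpha> \<beta>" "(x, y) \<in> \<gamma>"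
  have alg: "is_algebra B" using B by (auto simp: variety_def)
  obtain S where S: "finite S" "S \<subseteq> carrier B"
    "(x, y) \<in> cong_join (restr B (gen B S)) (\<alpha> \<inter> gen B S \<times> gen B S) (\<beta> \<inter> gen B S \<times> gen B S)"
    using cong_join_fin[OF alg c(1,2) xy(1)] by blast
  define S' where "S' = insert x (insert y S)"
  have "x \<in> carrier B" "y \<in> carrier B" using xy(2) congruence_sub[OF c(3)] by auto
  then have S': "countable S'" "S' \<noteq> {}" "S' \<subseteq> carrier B"
    using S by (auto simp: S'_def intro: countable_finite)
  define v where "v = from_nat_into S'"
  have rv: "range v = S'" unfolding v_def using S' by (intro range_from_nat_into) auto
  define G where "G = gen B S'"
  define C where "C = restr B G"
  have G: "G \<subseteq> carrier B" unfolding G_def using alg S'(3) by (rule gen_sub)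
  have algC: "is_algebra C" unfolding C_def G_def by (rule is_algebra_gen)
  have CV: "C \<in> variety sig E" using B G algC unfolding C_def by (rule variety_restr)
  define h where "h = (\<lambda>x. {t :: ('f, nat) trm. wf_trm (arity B) t \<and> eval B v t = x})"
  have inj: "inj_on h (carrier C)"
  proof (rule inj_onI)
    fix a b assume ab: "a \<in> carrier C" "b \<in> carrier C" "h a = h b"
    then obtain t where "wf_trm (arity B) t" "eval B v t = a"
      using gen_eval[of a B v] by (auto simp: C_def G_def rv)
    then have "t \<in> h a" by (simp add: h_def)
    then have "t \<in> h b" using ab(3) by simp
    then show "a = b" using \<open>eval B v t = a\<close> by (simp add: h_def)
  qed
  define D :: "(('f, nat) trm set, 'f) ualgebra" where
    "D = \<lparr>carrier = h ` carrier C, arity = arity C,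
      oper = \<lambda>f ys. h (oper C f (map (inv_into (carrier C) h) ys))\<rparr>"
  have opD: "oper D f (map h xs) = h (oper C f xs)" if "set xs \<subseteq> carrier C" for f xs
  proof -
    have "map (inv_into (carrier C) h \<circ> h) xs = xs"
      using that inj by (intro map_idI) (auto simp: inv_into_f_f)
    then show ?thesis by (simp add: D_def)
  qed
  have D: "carrier D = h ` carrier C" "arity D = arity C" by (simp_all add: D_def)
  have E: "\<forall>(s, t) \<in> E. wf_trm sig s \<and> wf_trm sig t"
    using cm by (simp add: congruence_modular_variety_def)
  have "D \<in> variety sig E"
    using iso_variety[OF inj D(1,2) algC opD CV E] by blast
  then have "modular_Con D" using cm by (simp add: congruence_modular_variety_def)
  then have modC: "modular_Con C"
    using iso_modular[OF inj D(1,2) algC opD] by blast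
  let ?r = "\<lambda>\<theta>. \<theta> \<inter> G \<times> G"
  have r: "congruence C (?r \<theta>)" if "congruence B \<theta>" for \<theta>
    using that G algC unfolding C_def by (rule congruence_restr)
  have "(x, y) \<in> cong_join C (?r \<alpha>) (?r \<beta>)"
  proof -
    have "gen B S \<subseteq> G" unfolding G_def S'_def by (intro gen_mono) auto
    from cong_join_restr_mono[OF this, of B \<alpha> \<beta>] show ?thesis
      using S(3) is_algebra_gen algC unfolding C_def by blast
  qed
  moreover have "(x, y) \<in> ?r \<gamma>" using xy(2) by (auto simp: G_def S'_def intro: gen.base)
  moreover have "cong_join C (?r \<alpha>) (?r \<beta>) \<inter> ?r \<gamma> = cong_join C (?r \<alpha>) (?r \<beta> \<inter> ?r \<gamma>)"
  proof -
    have "?r \<alpha> \<subseteq> ?r \<gamma>" using c(4) by auto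
    then show ?thesis
      using modC[unfolded modular_Con_def, rule_format, of "?r \<alpha>" "?r \<beta>" "?r \<gamma>"] c(1-3)[THEN r] by simp
  qed
  ultimately have 1: "(x, y) \<in> cong_join C (?r \<alpha>) (?r \<beta> \<inter> ?r \<gamma>)" by (metis IntI)
  show "(x, y) \<in> cong_join B \<alpha> (\<beta> \<inter> \<gamma>)"
    unfolding cong_join_def
  proof safe
    fix \<theta> assume \<theta>: "congruence B \<theta>" "\<alpha> \<union> \<beta> \<inter> \<gamma> \<subseteq> \<theta>"
    have "cong_join C (?r \<alpha>) (?r \<beta> \<inter> ?r \<gamma>) \<subseteq> ?r \<theta>"
      using \<theta> by (intro cong_join_least r) auto
    then show "(x, y) \<in> \<theta>" using 1 by blast
  qed
qed

end

theory Submission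
  imports Defs
begin

text \<open>
  Monotonicity of centrality in its first argument gives the inequality, and equality amounts to
  \<open>\<Or>\<U>\<^sub>i\<close> centralizing \<open>\<V>\<close> modulo \<open>\<W> = \<Or>[\<U>\<^sub>i, \<V>]\<close>.

  If the \<open>\<U>\<^sub>i\<close> permute, their join is a composite and it suffices that each \<open>\<U>\<^sub>i\<close> centralizes \<open>\<V>\<close>
  modulo \<open>\<W>\<close>, which is larger than \<open>[\<U>\<^sub>i, \<V>]\<close>.  Centrality is not evidently monotone in its last
  argument.  But for Day terms \<open>d\<close> it forces \<open>d (u11, u11, u21, u21)\<close> and
  \<open>d (u11, u12, u22, u21)\<close> to be close for all matrices; this condition has no premise on a row, so
  it is monotone, and the Day terms recover from it centrality with the two uniformities exchanged.

  If \<open>A\<close> has an underlying group and \<open>\<V> = Ug {\<alpha>}\<close>, then \<open>u12 * inverse u11\<close> measures the distance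
  in a row, and centrality of \<open>\<U>\<close> says that its value at \<open>(t(a, b), t(a, c))\<close> depends
  uniformly continuously on \<open>a\<close>, uniformly in \<open>(b, c) \<in> \<alpha>\<close>.  Hence there is a largest such \<open>\<U>\<close>,
  and it lies above all \<open>\<U>\<^sub>i\<close>, hence above their join.
\<close>

section \<open>Term functions\<close>

text \<open>Variables may be indexed by any type. Sum types then serve as disjoint blocks of
  variables and composites need no renumbering.\<close>

definition term_fun :: "('a, 'f) ualgebra \<Rightarrow> (('v \<Rightarrow> 'a) \<Rightarrow> 'a) \<Rightarrow> bool" where
  "term_fun A p \<longleftrightarrow> (\<exists>t. wf_trm (arity A) t \<and> p = (\<lambda>v. eval A v t))"

text \<open>The two arguments are the blocks \<open>a\<close> and \<open>b\<close> of variables in a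
  commutator matrix.\<close>

definition term_fun2 :: "('a, 'f) ualgebra \<Rightarrow> (('v \<Rightarrow> 'a) \<Rightarrow> ('w \<Rightarrow> 'a) \<Rightarrow> 'a) \<Rightarrow> bool" where
  "term_fun2 A p \<longleftrightarrow> term_fun A (\<lambda>v. p (v \<circ> Inl) (v \<circ> Inr))"

lemma eval_cong_vars: "(\<And>i. i \<in> vars t \<Longrightarrow> v i = w i) \<Longrightarrow> eval A v t = eval A w t"
proof (induction t)
  case (Fn f ts)
  then have "map (eval A v) ts = map (eval A w) ts" by (intro map_cong) auto
  then show ?case by (simp del: map_eq_conv)
qed simp

lemma wf_map_trm: "wf_trm sig (map_trm id g t) = wf_trm sig t"
  by (induction t) auto

lemma eval_map_trm: "eval A v (map_trm id g t) = eval A (\<lambda>i. v (g i)) t"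
  by (induction t) (auto simp: comp_def intro!: arg_cong[of _ _ "oper A _"])

lemma finite_vars: "finite (vars t)"
  by (induction t) auto

lemma term_fun_proj: "term_fun A (\<lambda>v. v i)"
  unfolding term_fun_def by (intro exI[of _ "Var i"]) auto

lemma term_fun_oper:
  assumes "arity A f = Some n" "\<And>k. k < n \<Longrightarrow> term_fun A (q k)"
  shows "term_fun A (\<lambda>v. oper A f (map (\<lambda>k. q k v) [0..<n]))"
proof -
  obtain s where s: "\<And>k. k < n \<Longrightarrow> wf_trm (arity A) (s k) \<and> q k = (\<lambda>v. eval A v (s k))"
    using assms(2) unfolding term_fun_def by metis
  have "map (\<lambda>k. q k v) [0..<n] = map (eval A v) (map s [0..<n])" for v
    using s by simp
  then show ?thesis
    using assms(1) s unfolding term_fun_def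
    by (intro exI[of _ "Fn f (map s [0..<n])"]) (auto simp del: map_map)
qed

lemma term_fun_comp:
  assumes "term_fun A p" "\<And>w. term_fun A (q w)"
  shows "term_fun A (\<lambda>v. p (\<lambda>w. q w v))"
proof -
  have "term_fun A (\<lambda>v. eval A (\<lambda>w. q w v) t)" if "wf_trm (arity A) t" for t
    using that
  proof (induction t)
    case (Var x)
    then show ?case using assms(2) by simp
  next
    case (Fn f ts)
    have eq: "map (eval A (\<lambda>w. q w v)) ts = map (\<lambda>k. eval A (\<lambda>w. q w v) (ts ! k)) [0..<length ts]" for v
      by (rule nth_equalityI) auto
    show ?case unfolding eval.simps eq
      by (rule term_fun_oper[where q = "\<lambda>k v. eval A (\<lambda>w. q w v) (ts ! k)"]) (use Fn in auto)
  qed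
  then show ?thesis using assms(1) unfolding term_fun_def[of A p] by auto
qed

lemma term_fun2_comp:
  assumes "term_fun2 A p" "\<And>i. term_fun A (x i)" "\<And>j. term_fun A (y j)"
  shows "term_fun A (\<lambda>v. p (\<lambda>i. x i v) (\<lambda>j. y j v))"
proof -
  have "term_fun A (case_sum x y k)" for k using assms(2,3) by (cases k) auto
  from term_fun_comp[OF assms(1)[unfolded term_fun2_def] this]
  have "term_fun A (\<lambda>v. p ((\<lambda>k. case_sum x y k v) \<circ> Inl) ((\<lambda>k. case_sum x y k v) \<circ> Inr))" .
  then show ?thesis by (simp add: comp_def)
qed

lemma term_fun2I:
  assumes "term_fun A (\<lambda>v. p (\<lambda>i. v (Inl i)) (\<lambda>j. v (Inr j)))"
  shows "term_fun2 A p"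
  using assms by (simp add: term_fun2_def comp_def)

lemma term_fun_closed:
  assumes "is_algebra A" "term_fun A p" "range v \<subseteq> carrier A"
  shows "p v \<in> carrier A"
  using assms eval_closed unfolding term_fun_def by fast

lemma term_fun2_closed:
  assumes "is_algebra A" "term_fun2 A p" "range x \<subseteq> carrier A" "range y \<subseteq> carrier A"
  shows "p x y \<in> carrier A"
proof -
  have "range (case_sum x y) \<subseteq> carrier A"
    using assms(3,4) by (auto simp: image_subset_iff split: sum.split)
  from term_fun_closed[OF assms(1) assms(2)[unfolded term_fun2_def] this]
  show ?thesis by (simp add: comp_def)
qed

section \<open>Entourages of compatible uniformities and uniform continuity of term
  functions\<close>

lemma entourages_Unif:
  assumes "F \<in> Unif A" "U \<in> entourages (carrier A) F"
  shows entourages_refl: "x \<in> carrier A \<Longrightarrow> (x, x) \<in> U"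
    and entourages_converse: "U\<inverse> \<in> entourages (carrier A) F"
    and entourages_O: "\<exists>V \<in> entourages (carrier A) F. V O V \<subseteq> U"
  using assms unfolding Unif_def uniformity_on_def refl_on_def by blast+

lemma entourages_full:
  assumes "F \<in> Unif A"
  shows "carrier A \<times> carrier A \<in> entourages (carrier A) F"
  using Unif_le[OF assms] by (auto simp: entourages_def le_principal)

text \<open>Since \<open>Q\<close> passes to smaller entourages, those chosen for the finitely many
  elements can be intersected.\<close>

lemma entourages_finite_ball:
  assumes "S \<times> S \<in> entourages S F" "finite X" "\<And>x. x \<in> X \<Longrightarrow> \<exists>W \<in> entourages S F. Q x W"
    and "\<And>x W W'. Q x W \<Longrightarrow> W' \<subseteq> W \<Longrightarrow> Q x W'"
  shows "\<exists>W \<in> entourages S F. \<forall>x \<in> X. Q x W"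
  using assms(2,3)
proof (induction X rule: finite_induct)
  case empty
  then show ?case using assms(1) by auto
next
  case (insert x X)
  then obtain W W' where "W \<in> entourages S F" "\<forall>x \<in> X. Q x W" "W' \<in> entourages S F" "Q x W'"
    by blast
  then show ?case using assms(4) by (intro bexI[of _ "W \<inter> W'"]) (auto intro: entourages_Int)
qed

text \<open>Compatibility extends from the basic operations to terms by induction. An operation has
  finitely many arguments, so the entourages found for the subterms can be intersected.\<close>

lemma term_fun_uniform:
  assumes "F \<in> Unif A" "term_fun A p" "W \<in> entourages (carrier A) F"
  obtains W' where "W' \<in> entourages (carrier A) F"
    "\<And>v w. (\<And>i. (v i, w i) \<in> W') \<Longrightarrow> (p v, p w) \<in> W"
proof -
  let ?ent = "entourages (carrier A) F"
  have "\<exists>W' \<in> ?ent. \<forall>v w. (\<forall>i. (v i, w i) \<in> W') \<longrightarrow> (eval A v t, eval A w t) \<in> W"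
    if "wf_trm (arity A) t" for t
    using that assms(3)
  proof (induction t arbitrary: W)
    case (Var x)
    then show ?case by auto
  next
    case (Fn f ts)
    have "compatible A F" using assms(1) by (simp add: Unif_def)
    then obtain U where U: "U \<in> ?ent" "\<And>xs ys. xs \<in> tuples (carrier A) (length ts) \<Longrightarrow>
        ys \<in> tuples (carrier A) (length ts) \<Longrightarrow> list_all2 (\<lambda>x y. (x, y) \<in> U) xs ys \<Longrightarrow>
        (oper A f xs, oper A f ys) \<in> W"
      using Fn.prems unfolding compatible_def wf_trm.simps by meson
    have "\<exists>W' \<in> ?ent. \<forall>t \<in> set ts. \<forall>v w. (\<forall>i. (v i, w i) \<in> W') \<longrightarrow> (eval A v t, eval A w t) \<in> U"
    proof (rule entourages_finite_ball[OF entourages_full[OF assms(1)]])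
      show "\<exists>W' \<in> ?ent. \<forall>v w. (\<forall>i. (v i, w i) \<in> W') \<longrightarrow> (eval A v t, eval A w t) \<in> U"
        if "t \<in> set ts" for t using Fn.IH[OF that _ U(1)] Fn.prems that by simp
      show "\<forall>v w. (\<forall>i. (v i, w i) \<in> X') \<longrightarrow> (eval A v t, eval A w t) \<in> U"
        if "\<forall>v w. (\<forall>i. (v i, w i) \<in> X) \<longrightarrow> (eval A v t, eval A w t) \<in> U" "X' \<subseteq> X" for t X X'
        using that by (meson subsetD)
    qed simp
    then obtain W' where W': "W' \<in> ?ent"
      "\<And>t v w. t \<in> set ts \<Longrightarrow> (\<And>i. (v i, w i) \<in> W') \<Longrightarrow> (eval A v t, eval A w t) \<in> U"
      by meson
    have "(eval A v (Fn f ts), eval A w (Fn f ts)) \<in> W" if "\<forall>i. (v i, w i) \<in> W'" for v w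
    proof -
      have *: "(eval A v t, eval A w t) \<in> U" if "t \<in> set ts" for t
        using W'(2)[OF that, of v w] \<open>\<forall>i. (v i, w i) \<in> W'\<close> by blast
      then have "eval A v t \<in> carrier A \<and> eval A w t \<in> carrier A" if "t \<in> set ts" for t
        using that entourages_sub[OF U(1)] by blast
      then show ?thesis
        unfolding eval.simps using *
        by (intro U(2)) (auto simp: tuples_def list_all2_conv_all_nth)
    qed
    then show ?case using W'(1) by blast
  qed
  then show thesis using assms(2) that unfolding term_fun_def by meson
qed

text \<open>Centrality is defined with numbered variables; here they may have any types. Only
  finitely many occur in the term: the lists \<open>vs\<close> and \<open>ws\<close> enumerate those
  of the two blocks, and \<open>g\<close> and \<open>h\<close> give their positions.\<close>

lemma centralizesD:
  fixes p :: "('v \<Rightarrow> 'a) \<Rightarrow> ('w \<Rightarrow> 'a) \<Rightarrow> 'a"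
  assumes "centralizes A F G H" "term_fun2 A p" "W \<in> entourages (carrier A) H"
  obtains U V W' where "U \<in> entourages (carrier A) F" "V \<in> entourages (carrier A) G"
    "W' \<in> entourages (carrier A) H"
    "\<And>a a' b c. (\<And>i. (a i, a' i) \<in> U) \<Longrightarrow> (\<And>j. (b j, c j) \<in> V) \<Longrightarrow> (p a b, p a c) \<in> W' \<Longrightarrow>
      (p a' b, p a' c) \<in> W"
proof -
  let ?S = "carrier A"
  obtain t where t: "wf_trm (arity A) t" "\<And>v. p (v \<circ> Inl) (v \<circ> Inr) = eval A v t"
    using assms(2) unfolding term_fun2_def term_fun_def by metis
  have p: "p a b = eval A (case_sum a b) t" for a b
    using t(2)[of "case_sum a b"] by (simp add: comp_def)
  obtain vs where vs: "set vs = Inl -` vars t"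
    using finite_list[OF finite_vimageI[OF finite_vars[of t] inj_Inl]] by blast
  obtain ws where ws: "set ws = Inr -` vars t"
    using finite_list[OF finite_vimageI[OF finite_vars[of t] inj_Inr]] by blast
  obtain g where g: "\<And>i. i \<in> set vs \<Longrightarrow> g i < length vs \<and> vs ! g i = i"
    using in_set_conv_nth[of _ vs] by metis
  obtain h where h: "\<And>j. j \<in> set ws \<Longrightarrow> h j < length ws \<and> ws ! h j = j"
    using in_set_conv_nth[of _ ws] by metis
  define t' where "t' = map_trm id (case_sum g (\<lambda>j. length vs + h j)) t"
  have t': "t' \<in> nary_terms A (length vs + length ws)"
  proof -
    have "case_sum g (\<lambda>j. length vs + h j) k < length vs + length ws" if "k \<in> vars t" for k
    proof (cases k)
      case (Inl i)
      then show ?thesis using g[of i] vs that by auto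
    next
      case (Inr j)
      then show ?thesis using h[of j] ws that by auto
    qed
    then show ?thesis using t(1) by (auto simp: nary_terms_def t'_def wf_map_trm trm.set_map)
  qed
  have ev: "term_op A t' (map a vs @ map b ws) = p a b" for a b
    unfolding term_op_def t'_def eval_map_trm p
  proof (rule eval_cong_vars)
    fix k assume k: "k \<in> vars t"
    show "(map a vs @ map b ws) ! case_sum g (\<lambda>j. length vs + h j) k = case_sum a b k"
    proof (cases k)
      case (Inl i)
      then show ?thesis using g[of i] vs k by (auto simp: nth_append)
    next
      case (Inr j)
      then show ?thesis using h[of j] ws k by (auto simp: nth_append)
    qed
  qed
  obtain U V W' where 1: "U \<in> entourages ?S F" "V \<in> entourages ?S G" "W' \<in> entourages ?S H"
    and 2: "\<forall>(u11, u12, u21, u22) \<in> matrices A (length vs) (length ws) t' U V.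
      (u11, u12) \<in> W' \<longrightarrow> (u21, u22) \<in> W"
    using assms(1)[unfolded centralizes_def, rule_format, OF t' assms(3)] by blast
  have "(p a' b, p a' c) \<in> W"
    if "\<And>i. (a i, a' i) \<in> U" "\<And>j. (b j, c j) \<in> V" "(p a b, p a c) \<in> W'" for a a' b c
  proof -
    have "a i \<in> ?S" "a' i \<in> ?S" "b j \<in> ?S" "c j \<in> ?S" for i j
      using that(1)[of i] that(2)[of j] entourages_sub[OF 1(1)] entourages_sub[OF 1(2)] by auto
    then have "(p a b, p a c, p a' b, p a' c) \<in> matrices A (length vs) (length ws) t' U V"
      unfolding matrices_def using that(1,2)
      by (intro CollectI exI[of _ "map a vs"] exI[of _ "map a' vs"] exI[of _ "map b ws"]
          exI[of _ "map c ws"])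
        (auto simp: ev tuples_def list_all2_conv_all_nth)
    then show ?thesis using 2 that(3) by fast
  qed
  then show thesis using that 1 by blast
qed

text \<open>Conversely, centrality may be verified on infinite sequences of arguments, which avoids
  all bookkeeping of lengths. A matrix of tuples is obtained by padding them to sequences.\<close>

lemma centralizesI:
  assumes A: "is_algebra A" and "F \<in> Unif A" "G \<in> Unif A" "H \<in> Unif A"
    and ex: "\<And>(p :: (nat \<Rightarrow> 'a) \<Rightarrow> (nat \<Rightarrow> 'a) \<Rightarrow> 'a) W. term_fun2 A p \<Longrightarrow>
      W \<in> entourages (carrier A) H \<Longrightarrow>
      \<exists>U \<in> entourages (carrier A) F. \<exists>V \<in> entourages (carrier A) G. \<exists>W' \<in> entourages (carrier A) H.
        \<forall>a a' b c. (\<forall>i. (a i, a' i) \<in> U) \<longrightarrow> (\<forall>j. (b j, c j) \<in> V) \<longrightarrow> (p a b, p a c) \<in> W' \<longrightarrow>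
          (p a' b, p a' c) \<in> W"
  shows "centralizes A F G H"
  unfolding centralizes_def
proof (intro allI ballI)
  let ?S = "carrier A"
  fix n n' t W assume t: "t \<in> nary_terms A (n + n')" and W: "W \<in> entourages ?S H"
  \<comment> \<open>Variables below \<open>n\<close> belong to the first block; the others belong to
    the second and are shifted down by \<open>n\<close>.\<close>
  define p where "p = (\<lambda>(a :: nat \<Rightarrow> 'a) b. eval A (\<lambda>k. if k < n then a k else b (k - n)) t)"
  have "(\<lambda>k. v (if k < n then Inl k else Inr (k - n)))
      = (\<lambda>k. if k < n then (v \<circ> Inl) k else (v \<circ> Inr) (k - n))" for v :: "nat + nat \<Rightarrow> 'a"
    by auto
  then have "p (v \<circ> Inl) (v \<circ> Inr) =
      eval A v (map_trm id (\<lambda>k. if k < n then Inl k else Inr (k - n)) t)" for v :: "nat + nat \<Rightarrow> 'a"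
    unfolding p_def eval_map_trm by simp
  then have "term_fun2 A p"
    unfolding term_fun2_def term_fun_def using t
    by (intro exI[of _ "map_trm id (\<lambda>k. if k < n then Inl k else Inr (k - n)) t"])
      (simp add: wf_map_trm nary_terms_def)
  from ex[OF this W] obtain U V W' where
    1: "U \<in> entourages ?S F" "V \<in> entourages ?S G" "W' \<in> entourages ?S H"
    and 2: "\<And>a a' b c. (\<And>i. (a i, a' i) \<in> U) \<Longrightarrow> (\<And>j. (b j, c j) \<in> V) \<Longrightarrow> (p a b, p a c) \<in> W' \<Longrightarrow>
      (p a' b, p a' c) \<in> W" by metis
  have "(u21, u22) \<in> W"
    if m: "(u11, u12, u21, u22) \<in> matrices A n n' t U V" and u: "(u11, u12) \<in> W'" for u11 u12 u21 u22
  proof -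
    \<comment> \<open>Any element can serve as padding. The carrier may be empty, but the premise on
      the first row supplies an element.\<close>
    obtain s where s: "s \<in> ?S" using u entourages_sub[OF 1(3)] by auto
    obtain a a' b c where abc: "u11 = term_op A t (a @ b)" "u12 = term_op A t (a @ c)"
      "u21 = term_op A t (a' @ b)" "u22 = term_op A t (a' @ c)"
      "length a = n" "length a' = n" "length b = n'" "length c = n'"
      "list_all2 (\<lambda>x y. (x, y) \<in> U) a a'" "list_all2 (\<lambda>x y. (x, y) \<in> V) b c"
      using m unfolding matrices_def tuples_def by blast
    define ext where "ext xs i = (if i < length xs then xs ! i else s)" for xs i
    have p: "p (ext x) (ext y) = term_op A t (x @ y)" if "length x = n" "length y = n'" for x y
      unfolding p_def term_op_def
      by (rule eval_cong_vars) (use that t in \<open>auto simp: ext_def nth_append nary_terms_def subset_iff\<close>)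
    have "(ext a i, ext a' i) \<in> U" "(ext b i, ext c i) \<in> V" for i
      using abc entourages_refl[OF assms(2) 1(1) s] entourages_refl[OF assms(3) 1(2) s]
      by (auto simp: ext_def list_all2_conv_all_nth)
    then have "(p (ext a') (ext b), p (ext a') (ext c)) \<in> W"
      using 2[of "ext a" "ext a'" "ext b" "ext c"] u abc by (simp add: p)
    then show ?thesis using abc by (simp add: p)
  qed
  then have "\<forall>(u11, u12, u21, u22) \<in> matrices A n n' t U V. (u11, u12) \<in> W' \<longrightarrow> (u21, u22) \<in> W"
    by blast
  then show "\<exists>U \<in> entourages ?S F. \<exists>V \<in> entourages ?S G. \<exists>W' \<in> entourages ?S H.
      \<forall>(u11, u12, u21, u22) \<in> matrices A n n' t U V. (u11, u12) \<in> W' \<longrightarrow> (u21, u22) \<in> W"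
    using 1 by blast
qed

lemma centralizes_mono_left: "centralizes A F' G H \<Longrightarrow> F \<le> F' \<Longrightarrow> centralizes A F G H"
  unfolding centralizes_def using entourages_mono[of F F' "carrier A"] by (meson subsetD)

section \<open>Day terms\<close>

text \<open>The variables x, y, z, u of a Day term are indexed by the four elements of
  \<open>bool \<times> bool\<close>.\<close>

definition quad :: "'a \<Rightarrow> 'a \<Rightarrow> 'a \<Rightarrow> 'a \<Rightarrow> bool \<times> bool \<Rightarrow> 'a" where
  "quad x y z u = (\<lambda>(i, j). if i then if j then x else y else if j then z else u)"

lemma quad_simps [simp]:
  "quad x y z u (True, True) = x" "quad x y z u (True, False) = y"
  "quad x y z u (False, True) = z" "quad x y z u (False, False) = u"
  by (simp_all add: quad_def)

lemma range_quad: "range (quad x y z u) = {x, y, z, u}"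
  by (auto simp: quad_def image_iff split: if_splits) (metis (full_types))+

definition day_fun :: "('a, 'f) ualgebra \<Rightarrow> ((bool \<times> bool \<Rightarrow> 'a) \<Rightarrow> 'a) \<Rightarrow> bool" where
  "day_fun A p \<longleftrightarrow> term_fun A p \<and> (\<forall>x \<in> carrier A. \<forall>y \<in> carrier A. p (quad x y y x) = x)"

text \<open>These are the two identities that link consecutive Day terms. Their alternation is not
  recorded, so that a sequence of Day terms becomes a path in the reflexive transitive
  closure.\<close>

definition day_step ::
    "('a, 'f) ualgebra \<Rightarrow> (((bool \<times> bool \<Rightarrow> 'a) \<Rightarrow> 'a) \<times> ((bool \<times> bool \<Rightarrow> 'a) \<Rightarrow> 'a)) set" where
  "day_step A = {(p, q). day_fun A p \<and> day_fun A q \<and>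
     ((\<forall>x \<in> carrier A. \<forall>u \<in> carrier A. p (quad x x u u) = q (quad x x u u)) \<or>
      (\<forall>x \<in> carrier A. \<forall>y \<in> carrier A. \<forall>u \<in> carrier A. p (quad x y y u) = q (quad x y y u)))}"

text \<open>The right-hand side, restricted to the carrier, is itself a congruence: paths between
  the arguments of an operation give a path between its values when the arguments are changed one at
  a time.\<close>

lemma cong_join_rtrancl:
  assumes "congruence A \<alpha>" "congruence A \<beta>"
  shows "cong_join A \<alpha> \<beta> \<subseteq> (\<alpha> \<union> \<beta>)\<^sup>*"
proof -
  let ?S = "carrier A"
  let ?R = "\<alpha> \<union> \<beta>"
  let ?\<theta> = "?R\<^sup>* \<inter> ?S \<times> ?S"
  have e: "refl_on ?S \<gamma>" "sym \<gamma>" "\<gamma> \<subseteq> ?S \<times> ?S" if "\<gamma> = \<alpha> \<or> \<gamma> = \<beta>" for \<gamma>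
    using that assms by (auto simp: congruence_def equiv_def)
  have "sym ?R" using e(2)[of \<alpha>] e(2)[of \<beta>] by (auto simp: sym_def)
  then have s: "sym (?R\<^sup>*)" by (rule sym_rtrancl)
  have one: "(oper A f (ps @ x # xs), oper A f (ps @ y # xs)) \<in> ?\<theta>"
    if "arity A f = Some (length ps + length xs + 1)" "set ps \<subseteq> ?S" "set xs \<subseteq> ?S" "(x, y) \<in> ?R"
    for f ps xs x y
  proof -
    have "(oper A f (ps @ x # xs), oper A f (ps @ y # xs)) \<in> \<gamma>"
      if "congruence A \<gamma>" "(x, y) \<in> \<gamma>" for \<gamma>
    proof -
      have "\<forall>z \<in> ?S. (z, z) \<in> \<gamma>" using \<open>congruence A \<gamma>\<close>
        by (auto simp: congruence_def equiv_def refl_on_def)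
      then have "list_all2 (\<lambda>x y. (x, y) \<in> \<gamma>) ps ps" "list_all2 (\<lambda>x y. (x, y) \<in> \<gamma>) xs xs"
        using \<open>set ps \<subseteq> ?S\<close> \<open>set xs \<subseteq> ?S\<close> by (auto intro!: list.rel_refl_strong)
      then show ?thesis
        using that \<open>arity A f = _\<close> by (intro congruence_oper) (auto intro!: list_all2_appendI)
    qed
    then show ?thesis using that(4) assms e(3) by blast
  qed
  have step: "(oper A f (ps @ x # xs), oper A f (ps @ y # xs)) \<in> ?R\<^sup>*"
    if "arity A f = Some (length ps + length xs + 1)" "set ps \<subseteq> ?S" "set xs \<subseteq> ?S" "(x, y) \<in> ?R\<^sup>*"
    for f ps xs x y
    using that(4)
  proof (induction rule: rtrancl_induct)
    case (step y z)
    then show ?case using one[OF that(1-3) step(2)] by (meson IntD1 rtrancl_trans)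
  qed simp
  \<comment> \<open>The arguments are changed from left to right; \<open>ps\<close> is the part that
    is already changed.\<close>
  have ops: "(oper A f (ps @ xs), oper A f (ps @ ys)) \<in> ?R\<^sup>*"
    if "list_all2 (\<lambda>x y. (x, y) \<in> ?\<theta>) xs ys" "arity A f = Some (length ps + length xs)" "set ps \<subseteq> ?S"
    for f ps xs ys
    using that
  proof (induction xs ys arbitrary: ps rule: list_all2_induct)
    case (Cons x xs y ys)
    have "set xs \<subseteq> ?S" using Cons(2) by (induction xs ys rule: list_all2_induct) auto
    then have "(oper A f (ps @ x # xs), oper A f (ps @ y # xs)) \<in> ?R\<^sup>*"
      using Cons by (intro step) auto
    moreover have "(oper A f (ps @ y # xs), oper A f (ps @ y # ys)) \<in> ?R\<^sup>*"
      using Cons.IH[of "ps @ [y]"] Cons.prems Cons(1) by auto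
    ultimately show ?case by (rule rtrancl_trans)
  qed simp
  have "congruence A ?\<theta>"
    unfolding congruence_def equiv_def
  proof (intro conjI allI impI)
    show "?\<theta> \<subseteq> ?S \<times> ?S" by auto
    show "refl_on ?S ?\<theta>" by (auto simp: refl_on_def)
    show "sym ?\<theta>" using s by (auto simp: sym_def)
    show "trans ?\<theta>" by (auto simp: trans_def intro: rtrancl_trans)
    fix f n xs ys
    assume f: "arity A f = Some n" "length xs = n" "list_all2 (\<lambda>x y. (x, y) \<in> ?\<theta>) xs ys"
    \<comment> \<open>Closure under the operations is read off from compatibility of \<alpha>,
      applied to a tuple paired with itself.\<close>
    have cl: "oper A f zs \<in> ?S" if "length zs = n" "set zs \<subseteq> ?S" for zs
    proof -
      have "\<forall>z \<in> ?S. (z, z) \<in> \<alpha>" using assms(1)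
        by (auto simp: congruence_def equiv_def refl_on_def)
      then have "list_all2 (\<lambda>x y. (x, y) \<in> \<alpha>) zs zs" using that by (auto intro!: list.rel_refl_strong)
      then show ?thesis using congruence_oper[OF assms(1), of f zs zs] f(1) that e(3)[of \<alpha>] by auto
    qed
    have "set xs \<subseteq> ?S \<and> set ys \<subseteq> ?S \<and> length ys = length xs"
      using f(3) by (induction xs ys rule: list_all2_induct) auto
    then show "(oper A f xs, oper A f ys) \<in> ?\<theta>" using ops[of xs ys f "[]"] f cl by auto
  qed
  moreover have "\<alpha> \<union> \<beta> \<subseteq> ?\<theta>" using e(3) by blast
  ultimately show ?thesis using cong_join_least[of A ?\<theta> \<alpha> \<beta>] by blast
qed

text \<open>
  The term operations of \<open>A\<close> with variables indexed by \<open>'v\<close> form a subalgebra of a power of \<open>A\<close>,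
  which is free in the variety generated by \<open>A\<close>.  They are cut off outside of the assignments with
  values in \<open>carrier A\<close>, where the identities of the variety need not hold.
\<close>

definition clone_algebra :: "('a, 'f) ualgebra \<Rightarrow> (('v \<Rightarrow> 'a) \<Rightarrow> 'a, 'f) ualgebra" where
  "clone_algebra A = \<lparr>carrier = {restrict p {v. range v \<subseteq> carrier A} | p. term_fun A p},
     arity = arity A,
     oper = \<lambda>f ps. restrict (\<lambda>v. oper A f (map (\<lambda>p. p v) ps)) {v. range v \<subseteq> carrier A}\<rparr>"

lemma clone_algebra_simps [simp]:
  "carrier (clone_algebra A) = {restrict p {v. range v \<subseteq> carrier A} | p. term_fun A p}"
  "arity (clone_algebra A) = arity A"
  "oper (clone_algebra A) f ps =
    restrict (\<lambda>v. oper A f (map (\<lambda>p. p v) ps)) {v. range v \<subseteq> carrier A}"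
  by (simp_all add: clone_algebra_def)

lemma clone_algebraI:
  "term_fun A p \<Longrightarrow> restrict p {v. range v \<subseteq> carrier A} \<in> carrier (clone_algebra A)"
  by auto

lemma is_algebra_clone: "is_algebra (clone_algebra A)"
  unfolding is_algebra_def
proof (intro allI impI ballI)
  fix f n ps assume f: "arity (clone_algebra A) f = Some n"
    and ps: "ps \<in> tuples (carrier (clone_algebra A)) n"
  let ?V = "{v. range v \<subseteq> carrier A}"
  have "\<exists>q. term_fun A q \<and> ps ! k = restrict q ?V" if "k < n" for k
  proof -
    have "length ps = n" "set ps \<subseteq> carrier (clone_algebra A)" using ps unfolding tuples_def by blast+
    then have "ps ! k \<in> carrier (clone_algebra A)" using that nth_mem[of k ps] by (metis subsetD)
    then show ?thesis unfolding clone_algebra_simps by blast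
  qed
  then obtain q where q: "\<And>k. k < n \<Longrightarrow> term_fun A (q k) \<and> ps ! k = restrict (q k) ?V" by metis
  have "map (\<lambda>p. p v) ps = map (\<lambda>k. q k v) [0..<n]" if "range v \<subseteq> carrier A" for v
    using q ps that by (intro nth_equalityI) (auto simp: tuples_def)
  then have "oper (clone_algebra A) f ps = restrict (\<lambda>v. oper A f (map (\<lambda>k. q k v) [0..<n])) ?V"
    by (auto intro!: restrict_ext)
  then show "oper (clone_algebra A) f ps \<in> carrier (clone_algebra A)"
    using term_fun_oper[of A f n q] f q by auto
qed

lemma eval_clone:
  assumes "range v \<subseteq> carrier A"
  shows "eval (clone_algebra A) w t v = eval A (\<lambda>i. w i v) t"
  using assms by (induction t) (auto simp: comp_def intro!: arg_cong[of _ _ "oper A _"])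

text \<open>Values of terms in the clone are cut off, so they need only be compared at assignments
  into the carrier. There evaluation is pointwise and the identities of \<open>A\<close>
  apply.\<close>

lemma clone_variety:
  fixes A :: "('a, 'f) ualgebra"
  assumes "A \<in> variety sig E" "\<forall>(s, t) \<in> E. wf_trm sig s \<and> wf_trm sig t"
  shows "(clone_algebra A :: (('v \<Rightarrow> 'a) \<Rightarrow> 'a, 'f) ualgebra) \<in> variety sig E"
proof -
  let ?B = "clone_algebra A :: (('v \<Rightarrow> 'a) \<Rightarrow> 'a, 'f) ualgebra"
  have A: "is_algebra A" "arity A = sig" using assms(1) by (auto simp: variety_def)
  have "eval ?B w s = eval ?B w t" if st: "(s, t) \<in> E" and w: "range w \<subseteq> carrier ?B" for w s t
  proof -
    have "eval ?B w s \<in> carrier ?B" "eval ?B w t \<in> carrier ?B"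
      using st assms(2) A w by (auto simp del: clone_algebra_simps(1) intro!: eval_closed is_algebra_clone)
    then have ext: "eval ?B w s \<in> extensional {v. range v \<subseteq> carrier A}"
      "eval ?B w t \<in> extensional {v. range v \<subseteq> carrier A}" by auto
    show ?thesis
    proof (rule extensionalityI[OF ext])
      fix v :: "'v \<Rightarrow> 'a" assume "v \<in> {v. range v \<subseteq> carrier A}"
      then have v: "range v \<subseteq> carrier A" by simp
      have "range (\<lambda>i. w i v) \<subseteq> carrier A"
      proof (rule image_subsetI)
        fix i
        have "w i \<in> carrier ?B" using w by (rule subsetD) (rule rangeI)
        then obtain q where "term_fun A q" "w i = restrict q {v. range v \<subseteq> carrier A}"
          unfolding clone_algebra_simps by blast
        then show "w i v \<in> carrier A" using term_fun_closed[OF A(1) _ v] v by simp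
      qed
      moreover have "\<forall>v. range v \<subseteq> carrier A \<longrightarrow> eval A v s = eval A v t"
        using assms(1) st unfolding variety_def by blast
      ultimately show "eval ?B w s v = eval ?B w t v"
        unfolding eval_clone[OF v] by blast
    qed
  qed
  then show ?thesis using A is_algebra_clone[of A] by (auto simp: variety_def)
qed

text \<open>If \<open>C\<close> consists of the assignments satisfying some equations between
  variables, two term operations are related when \<open>A\<close> identifies them after the
  corresponding variables are made equal.\<close>

lemma clone_kernel:
  fixes C :: "('v \<Rightarrow> 'a) set"
  assumes "C \<subseteq> {v. range v \<subseteq> carrier A}"
  shows "congruence (clone_algebra A)
    {(p, q). p \<in> carrier (clone_algebra A) \<and> q \<in> carrier (clone_algebra A) \<and> (\<forall>v \<in> C. p v = q v)}"
    (is "congruence ?B ?R")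
  unfolding congruence_def equiv_def
proof (intro conjI allI impI)
  show "?R \<subseteq> carrier ?B \<times> carrier ?B" by auto
  show "refl_on (carrier ?B) ?R" by (auto simp: refl_on_def)
  show "sym ?R" by (auto simp: sym_def)
  show "trans ?R" by (auto simp: trans_def)
  fix f n ps qs
  assume f: "arity ?B f = Some n" "length ps = n" "list_all2 (\<lambda>x y. (x, y) \<in> ?R) ps qs"
  have *: "set ps \<subseteq> carrier ?B \<and> set qs \<subseteq> carrier ?B \<and> length qs = length ps \<and>
      (\<forall>v \<in> C. map (\<lambda>p. p v) ps = map (\<lambda>p. p v) qs)"
    using f(3) by (induction ps qs rule: list_all2_induct) auto
  then have "oper ?B f ps \<in> carrier ?B" "oper ?B f qs \<in> carrier ?B"
    using is_algebra_clone[of A] f(1,2) unfolding is_algebra_def tuples_def by blast+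
  moreover have "oper ?B f ps v = oper ?B f qs v" if "v \<in> C" for v
    using * that by simp
  ultimately show "(oper ?B f ps, oper ?B f qs) \<in> ?R" by blast
qed

text \<open>This is the construction of Day terms from modularity. In the free algebra on x, y, z,
  u, the path x, y, z, u shows that (x, u) lies in the join of \<alpha> and \<beta>, and it lies in
  \<gamma>. By modularity it lies in the join of \<alpha> and \<beta> \<inter> \<gamma>, and a path
  witnessing this consists of Day terms.\<close>

theorem day_terms:
  fixes A :: "('a, 'f) ualgebra"
  assumes "in_congruence_modular_variety A"
  shows "(\<lambda>v. v (True, True), \<lambda>v. v (False, False)) \<in> (day_step A)\<^sup>*"
proof -
  let ?V = "{v :: bool \<times> bool \<Rightarrow> 'a. range v \<subseteq> carrier A}"
  let ?B = "clone_algebra A :: ((bool \<times> bool \<Rightarrow> 'a) \<Rightarrow> 'a, 'f) ualgebra"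
  obtain sig E where E: "congruence_modular_variety sig E" "A \<in> variety sig E"
    using assms by (auto simp: in_congruence_modular_variety_def)
  have A: "is_algebra A" using E(2) by (simp add: variety_def)
  have "?B \<in> variety sig E"
    using E by (intro clone_variety) (auto simp: congruence_modular_variety_def)
  \<comment> \<open>The carrier type of \<open>?B\<close> differs from the one in the definition of
    \<open>congruence_modular_variety\<close>, which the adequacy theorem makes up for.\<close>
  then have mod: "modular_Con ?B" using E(1) congruence_modular_varietyD by blast
  define ker where "ker C =
    {(p, q). p \<in> carrier ?B \<and> q \<in> carrier ?B \<and> (\<forall>v \<in> C. p v = q v)}" for C
  have ker: "(p, q) \<in> ker C \<longleftrightarrow> p \<in> carrier ?B \<and> q \<in> carrier ?B \<and> (\<forall>v \<in> C. p v = q v)" for p q C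
    by (simp only: ker_def mem_Collect_eq prod.case)
  have kerI: "(p, q) \<in> ker C" if "p \<in> carrier ?B" "q \<in> carrier ?B" "\<And>v. v \<in> C \<Longrightarrow> p v = q v" for p q C
    using that ker by blast
  have kerD: "p v = q v" if "(p, q) \<in> ker C" "v \<in> C" for p q C v
    using that ker by blast
  have ker_mono: "ker D \<subseteq> ker C" if "C \<subseteq> D" for C D
    unfolding ker_def using that by (intro Collect_mono) fast
  \<comment> \<open>The congruence \<alpha> makes y = z, while \<beta> makes x = y and z = u, and
    \<gamma> makes x = u and y = z.\<close>
  define \<alpha> where "\<alpha> = ker {v \<in> ?V. v (True, False) = v (False, True)}"
  define \<beta> where "\<beta> = ker {v \<in> ?V. v (True, True) = v (True, False) \<and> v (False, True) = v (False, False)}"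
  define \<gamma> where "\<gamma> = ker {v \<in> ?V. v (True, True) = v (False, False) \<and> v (True, False) = v (False, True)}"
  have c: "congruence ?B \<alpha>" "congruence ?B \<beta>" "congruence ?B \<gamma>"
    unfolding \<alpha>_def \<beta>_def \<gamma>_def ker_def by (rule clone_kernel; blast)+
  have le: "\<alpha> \<subseteq> \<gamma>" unfolding \<alpha>_def \<gamma>_def by (intro ker_mono) blast
  define P where "P k = restrict (\<lambda>v. v k) ?V" for k
  have P: "P k \<in> carrier ?B" for k 
    unfolding P_def by (rule clone_algebraI[OF term_fun_proj])
  have Pv: "P k v = v k" if "v \<in> ?V" for k v using that by (simp add: P_def)
  have 1: "(P (True, True), P (True, False)) \<in> \<beta>" "(P (True, False), P (False, True)) \<in> \<alpha>"
    "(P (False, True), P (False, False)) \<in> \<beta>" "(P (True, True), P (False, False)) \<in> \<gamma>"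
    unfolding \<alpha>_def \<beta>_def \<gamma>_def by (intro kerI P; simp add: Pv)+
  have "(P (True, True), P (False, False)) \<in> cong_join ?B \<alpha> \<beta>"
    unfolding cong_join_def
  proof (intro InterI, elim CollectE conjE)
    fix \<theta> assume "congruence ?B \<theta>" "\<alpha> \<union> \<beta> \<subseteq> \<theta>"
    then have "trans \<theta>" "(P (True, True), P (True, False)) \<in> \<theta>" "(P (True, False), P (False, True)) \<in> \<theta>"
      "(P (False, True), P (False, False)) \<in> \<theta>"
      using 1 by (auto simp: congruence_def equiv_def)
    then show "(P (True, True), P (False, False)) \<in> \<theta>" by (meson transD)
  qed
  moreover have "cong_join ?B \<alpha> \<beta> \<inter> \<gamma> = cong_join ?B \<alpha> (\<beta> \<inter> \<gamma>)"
    using mod c le unfolding modular_Con_def by blast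
  ultimately have chain: "(P (True, True), P (False, False)) \<in> (\<alpha> \<union> (\<beta> \<inter> \<gamma>))\<^sup>*"
    using cong_join_rtrancl[OF c(1) congruence_Int[OF c(2,3)]] 1(4) by blast
  let ?x = "\<lambda>v :: bool \<times> bool \<Rightarrow> 'a. v (True, True)"
  have V: "quad x y z u \<in> ?V" if "x \<in> carrier A" "y \<in> carrier A" "z \<in> carrier A" "u \<in> carrier A" for x y z u
    using that by (simp add: range_quad)
  \<comment> \<open>Every link of the path lies in \<gamma>, so d (x, y, y, x) = x passes from each
    term to the next. Links in \<alpha> give agreement at (x, y, y, u), links in \<beta> at (x, x,
    u, u). The path consists of cut-off functions, hence the quantification over all term functions
    \<open>p\<close> with restriction \<open>f\<close>.\<close>
  have "day_fun A p \<and> (?x, p) \<in> (day_step A)\<^sup>*"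
    if "(P (True, True), f) \<in> (\<alpha> \<union> (\<beta> \<inter> \<gamma>))\<^sup>*" "term_fun A p" "f = restrict p ?V" for f p
    using that
  proof (induction arbitrary: p rule: rtrancl_induct)
    case base
    \<comment> \<open>The function \<open>p\<close> is known to equal the first projection only at
      assignments into the carrier, so one Day step is spent on passing between them.\<close>
    then have p: "p v = v (True, True)" if "v \<in> ?V" for v
      using Pv[OF that, of "(True, True)"] base(2) that by simp
    then have "day_fun A p" using base(1) V by (simp add: day_fun_def)
    moreover have "day_fun A ?x" by (simp add: day_fun_def term_fun_proj)
    moreover have "?x (quad x x u u) = p (quad x x u u)" if "x \<in> carrier A" "u \<in> carrier A" for x u
      using p[of "quad x x u u"] V that by simp
    ultimately have "(?x, p) \<in> day_step A" by (auto simp: day_step_def)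
    then show ?case using \<open>day_fun A p\<close> by blast
  next
    case (step f g)
    have "f \<in> carrier ?B" using step(2) ker unfolding \<alpha>_def \<beta>_def by blast
    then obtain q where q: "term_fun A q" "f = restrict q ?V" unfolding clone_algebra_simps by blast
    have IH: "day_fun A q" "(?x, q) \<in> (day_step A)\<^sup>*" using step.IH[OF q] by auto
    have eq: "f v = q v" "g v = p v" if "v \<in> ?V" for v using that q step.prems by auto
    have "(f, g) \<in> \<gamma>" using step(2) le by blast
    then have "p (quad x y y x) = q (quad x y y x)" if "x \<in> carrier A" "y \<in> carrier A" for x y
      using eq[of "quad x y y x"] V that kerD[of f g _ "quad x y y x"] unfolding \<gamma>_def by simp
    then have p: "day_fun A p" using IH(1) step.prems(1) by (simp add: day_fun_def)
    have "(f, g) \<in> \<alpha> \<or> (f, g) \<in> \<beta>" using step(2) by blast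
    then have "(q, p) \<in> day_step A"
    proof
      assume "(f, g) \<in> \<alpha>"
      then have "q (quad x y y u) = p (quad x y y u)"
        if "x \<in> carrier A" "y \<in> carrier A" "u \<in> carrier A" for x y u
        using eq[of "quad x y y u"] V that kerD[of f g _ "quad x y y u"] unfolding \<alpha>_def by simp
      then show ?thesis using IH(1) p by (auto simp: day_step_def)
    next
      assume "(f, g) \<in> \<beta>"
      then have "q (quad x x u u) = p (quad x x u u)"
        if "x \<in> carrier A" "u \<in> carrier A" for x u
        using eq[of "quad x x u u"] V that kerD[of f g _ "quad x x u u"] unfolding \<beta>_def by simp
      then show ?thesis using IH(1) p by (auto simp: day_step_def)
    qed
    then show ?case using IH(2) p by (meson rtrancl.rtrancl_into_rtrancl)
  qed
  from this[OF chain term_fun_proj P_def] show ?thesis by blast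
qed

section \<open>Monotonicity of centrality\<close>

lemma term_fun_day:
  assumes "term_fun A d" "term_fun A q1" "term_fun A q2" "term_fun A q3" "term_fun A q4"
  shows "term_fun A (\<lambda>v. d (quad (q1 v) (q2 v) (q3 v) (q4 v)))"
proof -
  have *: "term_fun A (\<lambda>v. quad (q1 v) (q2 v) (q3 v) (q4 v) w)" for w
    using assms(2-5) by (cases w; cases "fst w"; cases "snd w") (simp_all add: quad_def)
  show ?thesis using term_fun_comp[OF assms(1) *] .
qed

text \<open>The matrix has rows \<open>p a b\<close>, \<open>p a c\<close> and
  \<open>p a' b\<close>, \<open>p a' c\<close>. The second value of \<open>d\<close> takes the
  entries in the order u11, u12, u22, u21, that is, running around the matrix.\<close>

definition day_centralizes ::
    "('a, 'f) ualgebra \<Rightarrow> ('a \<times> 'a) filter \<Rightarrow> ('a \<times> 'a) filter \<Rightarrow> ('a \<times> 'a) filter \<Rightarrow> bool" where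
  "day_centralizes A F G H \<longleftrightarrow>
     (\<forall>d. \<forall>p :: (nat \<Rightarrow> 'a) \<Rightarrow> (nat \<Rightarrow> 'a) \<Rightarrow> 'a. \<forall>W \<in> entourages (carrier A) H.
        day_fun A d \<longrightarrow> term_fun2 A p \<longrightarrow>
        (\<exists>U \<in> entourages (carrier A) F. \<exists>V \<in> entourages (carrier A) G.
          \<forall>a a' b c. (\<forall>i. (a i, a' i) \<in> U) \<longrightarrow> (\<forall>j. (b j, c j) \<in> V) \<longrightarrow>
            (d (quad (p a b) (p a b) (p a' b) (p a' b)),
             d (quad (p a b) (p a c) (p a' c) (p a' b))) \<in> W))"

lemma day_centralizes_mono:
  fixes A :: "('a, 'f) ualgebra"
  assumes "day_centralizes A F G H" "H \<le> H'"
  shows "day_centralizes A F G H'"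
  unfolding day_centralizes_def
proof (intro allI ballI impI)
  fix d and p :: "(nat \<Rightarrow> 'a) \<Rightarrow> (nat \<Rightarrow> 'a) \<Rightarrow> 'a" and W
  assume "W \<in> entourages (carrier A) H'" and dp: "day_fun A d" "term_fun2 A p"
  then have W: "W \<in> entourages (carrier A) H" using entourages_mono[OF assms(2)] by blast
  from assms(1)[unfolded day_centralizes_def, rule_format, OF W dp]
  show "\<exists>U \<in> entourages (carrier A) F. \<exists>V \<in> entourages (carrier A) G.
      \<forall>a a' b c. (\<forall>i. (a i, a' i) \<in> U) \<longrightarrow> (\<forall>j. (b j, c j) \<in> V) \<longrightarrow>
        (d (quad (p a b) (p a b) (p a' b) (p a' b)), d (quad (p a b) (p a c) (p a' c) (p a' b))) \<in> W" .
qed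

lemma range_entourage:
  assumes "U \<in> entourages S F" "\<And>i. (a i, a' i) \<in> U"
  shows "range a \<subseteq> S" "range a' \<subseteq> S"
  using entourages_sub[OF assms(1)] assms(2) by auto

text \<open>Centrality is applied to the term d (p (a, b), p (a, z), p (x, z), p (x, b)), with x
  moving from a to a' and z from b to c. For x = a both entries of the row equal p (a, b), by the
  identity d (x, y, y, x) = x; the row for x = a' is the desired pair.\<close>

lemma centralizes_imp_day_centralizes:
  assumes A: "is_algebra A" and H: "H \<in> Unif A"
    and "centralizes A F G H" and G: "G \<in> Unif A"
  shows "day_centralizes A F G H"
  unfolding day_centralizes_def
proof (intro allI ballI impI)
  let ?S = "carrier A"
  fix d and p :: "(nat \<Rightarrow> 'a) \<Rightarrow> (nat \<Rightarrow> 'a) \<Rightarrow> 'a" and W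
  assume W: "W \<in> entourages ?S H" and d: "day_fun A d" and p: "term_fun2 A p"
  \<comment> \<open>In \<open>y\<close> the block \<open>Inl\<close> is the moving column variable
    z; the other two blocks hold the parameters \<open>a\<close> and \<open>b\<close>, which stay
    fixed.\<close>
  define q where "q x y = d (quad (p (\<lambda>i. y (Inr (Inl i))) (\<lambda>j. y (Inr (Inr j))))
    (p (\<lambda>i. y (Inr (Inl i))) (\<lambda>j. y (Inl j))) (p x (\<lambda>j. y (Inl j))) (p x (\<lambda>j. y (Inr (Inr j)))))"
    for x :: "nat \<Rightarrow> 'a" and y :: "nat + nat + nat \<Rightarrow> 'a"
  have "term_fun2 A q"
    unfolding q_def using d
    by (intro term_fun2I term_fun_day term_fun2_comp[OF p] term_fun_proj) (simp add: day_fun_def)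
  from centralizesD[OF assms(3) this W] obtain U V W' where
    UV: "U \<in> entourages ?S F" "V \<in> entourages ?S G" "W' \<in> entourages ?S H"
    and q: "\<And>a a' b c. (\<And>i. (a i, a' i) \<in> U) \<Longrightarrow> (\<And>j. (b j, c j) \<in> V) \<Longrightarrow> (q a b, q a c) \<in> W' \<Longrightarrow>
      (q a' b, q a' c) \<in> W" by metis
  have "(d (quad (p a b) (p a b) (p a' b) (p a' b)), d (quad (p a b) (p a c) (p a' c) (p a' b))) \<in> W"
    if ab: "\<forall>i. (a i, a' i) \<in> U" "\<forall>j. (b j, c j) \<in> V" for a a' b c
  proof -
    note r = range_entourage[OF UV(1), of a a'] range_entourage[OF UV(2), of b c]
    have S: "p a b \<in> ?S" "p a c \<in> ?S" using term_fun2_closed[OF A p] r ab by auto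
    let ?y = "\<lambda>z. case_sum z (case_sum a b)"
    have "(?y b j, ?y c j) \<in> V" for j
      using ab(2) entourages_refl[OF G UV(2)] r(1,3) ab
      by (auto simp: image_subset_iff split: sum.split)
    moreover have "q a (?y b) = p a b" "q a (?y c) = p a b"
      using d S by (auto simp: q_def day_fun_def)
    then have "(q a (?y b), q a (?y c)) \<in> W'" using entourages_refl[OF H UV(3) S(1)] by simp
    ultimately have "(q a' (?y b), q a' (?y c)) \<in> W" using q[of a a' "?y b" "?y c"] ab(1) by blast
    then show ?thesis by (simp add: q_def)
  qed
  then show "\<exists>U \<in> entourages ?S F. \<exists>V \<in> entourages ?S G.
      \<forall>a a' b c. (\<forall>i. (a i, a' i) \<in> U) \<longrightarrow> (\<forall>j. (b j, c j) \<in> V) \<longrightarrow>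
        (d (quad (p a b) (p a b) (p a' b) (p a' b)), d (quad (p a b) (p a c) (p a' c) (p a' b))) \<in> W"
    using UV(1,2) by blast
qed

text \<open>
  Along a chain of Day terms from \<open>x\<close> to \<open>u\<close>, the values \<open>d (x, x, u, u)\<close> and
  \<open>d (x, y, z, u)\<close> stay close to each other, and one of them changes little in each step
  provided that \<open>y\<close> and \<open>z\<close> are close.
\<close>

lemma day_centralizes_imp_centralizes:
  assumes cm: "in_congruence_modular_variety A" and A: "is_algebra A"
    and Unif: "F \<in> Unif A" "G \<in> Unif A" "H \<in> Unif A" and dc: "day_centralizes A F G H"
  shows "centralizes A G F H"
proof (rule centralizesI[OF A Unif(2,1,3)])
  let ?S = "carrier A"
  fix p :: "(nat \<Rightarrow> 'a) \<Rightarrow> (nat \<Rightarrow> 'a) \<Rightarrow> 'a" and W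
  assume p: "term_fun2 A p" and W: "W \<in> entourages ?S H"
  \<comment> \<open>The conclusion has the two uniformities exchanged, so the blocks are exchanged
    as well: rows of \<open>p\<close> are columns of \<open>p'\<close>.\<close>
  define p' where "p' a b = p b a" for a b
  have p': "term_fun2 A p'"
    unfolding p'_def by (intro term_fun2I term_fun2_comp[OF p] term_fun_proj)
  \<comment> \<open>Write x, y, z, u for \<open>p' a b\<close>, \<open>p' a c\<close>,
    \<open>p' a' c\<close>, \<open>p' a' b\<close>. If y and z are close, x is to be close to d (x,
    x, u, u). This is reflexivity for the first projection, and for the last projection it says that
    x is close to u, as centrality requires.\<close>
  define close where "close d W \<longleftrightarrow>
    (\<exists>U \<in> entourages ?S F. \<exists>V \<in> entourages ?S G. \<exists>W' \<in> entourages ?S H.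
      \<forall>a a' b c. (\<forall>i. (a i, a' i) \<in> U) \<longrightarrow> (\<forall>j. (b j, c j) \<in> V) \<longrightarrow> (p' a c, p' a' c) \<in> W' \<longrightarrow>
        (p' a b, d (quad (p' a b) (p' a b) (p' a' b) (p' a' b))) \<in> W)"
    for d :: "(bool \<times> bool \<Rightarrow> 'a) \<Rightarrow> 'a" and W
  have "close d W"
    if "(\<lambda>v. v (True, True), d) \<in> (day_step A)\<^sup>*" "W \<in> entourages ?S H" for d W
    using that
  proof (induction arbitrary: W rule: rtrancl_induct)
    case base
    have "(p' a b, p' a b) \<in> W"
      if "\<forall>i. (a i, a' i) \<in> ?S \<times> ?S" "\<forall>j. (b j, c j) \<in> ?S \<times> ?S" for a a' b c
      using that term_fun2_closed[OF A p', of a b] entourages_refl[OF Unif(3) base] by auto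
    then show ?case
      unfolding close_def using Unif[THEN entourages_full] quad_simps(1) by metis
  next
    case (step d e)
    have d: "day_fun A d" "day_fun A e" using step(2) by (auto simp: day_step_def)
    obtain W1 where W1: "W1 \<in> entourages ?S H" "W1 O W1 \<subseteq> W"
      using entourages_O[OF Unif(3) step.prems] by blast
    obtain U V W' where IH: "U \<in> entourages ?S F" "V \<in> entourages ?S G" "W' \<in> entourages ?S H"
      "\<And>a a' b c. \<forall>i. (a i, a' i) \<in> U \<Longrightarrow> \<forall>j. (b j, c j) \<in> V \<Longrightarrow> (p' a c, p' a' c) \<in> W' \<Longrightarrow>
        (p' a b, d (quad (p' a b) (p' a b) (p' a' b) (p' a' b))) \<in> W1"
      using step.IH[OF W1(1)] unfolding close_def by metis
    have S: "p' a b \<in> ?S" "p' a c \<in> ?S" "p' a' b \<in> ?S" "p' a' c \<in> ?S"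
      if "\<forall>i. (a i, a' i) \<in> U" "\<forall>j. (b j, c j) \<in> V" for a a' b c
      using range_entourage[OF IH(1), of a a'] range_entourage[OF IH(2), of b c] that
        term_fun2_closed[OF A p'] by auto
    from step(2) consider
        "\<forall>x \<in> ?S. \<forall>u \<in> ?S. d (quad x x u u) = e (quad x x u u)"
      | "\<forall>x \<in> ?S. \<forall>y \<in> ?S. \<forall>u \<in> ?S. d (quad x y y u) = e (quad x y y u)"
      by (auto simp: day_step_def)
    then show ?case
    proof cases
      case 1
      have "W1 \<subseteq> W" using W1 entourages_refl[OF Unif(3) W1(1)] entourages_sub[OF W1(1)] by blast
      then have "(p' a b, e (quad (p' a b) (p' a b) (p' a' b) (p' a' b))) \<in> W"
        if "\<forall>i. (a i, a' i) \<in> U" "\<forall>j. (b j, c j) \<in> V" "(p' a c, p' a' c) \<in> W'" for a a' b c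
        using IH(4)[OF that] S[OF that(1,2)] 1 by auto
      then show ?thesis unfolding close_def using IH(1-3) by blast
    next
      \<comment> \<open>The route from x runs through d (x, x, u, u), d (x, y, z, u), d (x, y, y, u)
        = e (x, y, y, u), e (x, y, z, u) and e (x, x, u, u). The induction hypothesis gives the
        first step, \<open>day_centralizes\<close> the second and the last, and uniform continuity
        of \<open>d\<close> and \<open>e\<close> the two that replace z by y or y by z.\<close>
      case 2
      obtain W2 where W2: "W2 \<in> entourages ?S H" "W2 O W2 \<subseteq> W1"
        using entourages_O[OF Unif(3) W1(1)] by blast
      obtain W3 where W3: "W3 \<in> entourages ?S H" "W3 O W3 \<subseteq> W2"
        using entourages_O[OF Unif(3) W2(1)] by blast
      define W4 where "W4 = W3 \<inter> W3\<inverse>"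
      have W4: "W4 \<in> entourages ?S H"
        unfolding W4_def by (intro entourages_Int entourages_converse[OF Unif(3)] W3)
      have W4s: "(x, y) \<in> W4 \<Longrightarrow> (y, x) \<in> W3" "(x, y) \<in> W4 \<Longrightarrow> (x, y) \<in> W3" for x y
        by (auto simp: W4_def)
      obtain Ud Vd where dd: "Ud \<in> entourages ?S F" "Vd \<in> entourages ?S G"
        "\<And>a a' b c. \<forall>i. (a i, a' i) \<in> Ud \<Longrightarrow> \<forall>j. (b j, c j) \<in> Vd \<Longrightarrow>
          (d (quad (p' a b) (p' a b) (p' a' b) (p' a' b)),
           d (quad (p' a b) (p' a c) (p' a' c) (p' a' b))) \<in> W4"
        using dc[unfolded day_centralizes_def, rule_format, OF W4 d(1) p'] by metis
      obtain Ue Ve where ee: "Ue \<in> entourages ?S F" "Ve \<in> entourages ?S G"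
        "\<And>a a' b c. \<forall>i. (a i, a' i) \<in> Ue \<Longrightarrow> \<forall>j. (b j, c j) \<in> Ve \<Longrightarrow>
          (e (quad (p' a b) (p' a b) (p' a' b) (p' a' b)),
           e (quad (p' a b) (p' a c) (p' a' c) (p' a' b))) \<in> W4"
        using dc[unfolded day_centralizes_def, rule_format, OF W4 d(2) p'] by metis
      obtain Xd where Xd: "Xd \<in> entourages ?S H" "\<And>v w. (\<And>i. (v i, w i) \<in> Xd) \<Longrightarrow> (d v, d w) \<in> W4"
        using term_fun_uniform[OF Unif(3) _ W4] d(1) unfolding day_fun_def by metis
      obtain Xe where Xe: "Xe \<in> entourages ?S H" "\<And>v w. (\<And>i. (v i, w i) \<in> Xe) \<Longrightarrow> (e v, e w) \<in> W4"
        using term_fun_uniform[OF Unif(3) _ W4] d(2) unfolding day_fun_def by metis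
      have "(p' a b, e (quad (p' a b) (p' a b) (p' a' b) (p' a' b))) \<in> W"
        if ab: "\<forall>i. (a i, a' i) \<in> U \<inter> Ud \<inter> Ue" "\<forall>j. (b j, c j) \<in> V \<inter> Vd \<inter> Ve"
          and c: "(p' a c, p' a' c) \<in> W' \<inter> Xd \<inter> Xe" for a a' b c
      proof -
        let ?x = "p' a b" and ?y = "p' a c" and ?z = "p' a' c" and ?u = "p' a' b"
        have S': "?x \<in> ?S" "?y \<in> ?S" "?z \<in> ?S" "?u \<in> ?S"
          using S[of a a' b c] ab by auto
        have r: "(s, s) \<in> Xd" "(s, s) \<in> Xe" if "s \<in> ?S" for s
          using that entourages_refl[OF Unif(3)] Xd(1) Xe(1) by auto
        have q: "(quad ?x ?y ?y ?u k, quad ?x ?y ?z ?u k) \<in> Xd \<inter> Xe" for k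
          using r S' c by (cases k) (auto simp: quad_def)
        have "(?x, d (quad ?x ?x ?u ?u)) \<in> W1" using IH(4)[of a a' b c] ab c by blast
        moreover have "(d (quad ?x ?x ?u ?u), d (quad ?x ?y ?y ?u)) \<in> W3 O W3"
        proof (rule relcompI)
          show "(d (quad ?x ?x ?u ?u), d (quad ?x ?y ?z ?u)) \<in> W3"
            using dd(3)[of a a' b c] ab W4s by blast
          show "(d (quad ?x ?y ?z ?u), d (quad ?x ?y ?y ?u)) \<in> W3"
            using Xd(2)[of "quad ?x ?y ?y ?u" "quad ?x ?y ?z ?u"] q W4s by blast
        qed
        moreover have "(e (quad ?x ?y ?y ?u), e (quad ?x ?x ?u ?u)) \<in> W3 O W3"
        proof (rule relcompI)
          show "(e (quad ?x ?y ?y ?u), e (quad ?x ?y ?z ?u)) \<in> W3"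
            using Xe(2)[of "quad ?x ?y ?y ?u" "quad ?x ?y ?z ?u"] q W4s by blast
          show "(e (quad ?x ?y ?z ?u), e (quad ?x ?x ?u ?u)) \<in> W3"
            using ee(3)[of a a' b c] ab W4s by blast
        qed
        moreover have "d (quad ?x ?y ?y ?u) = e (quad ?x ?y ?y ?u)" using 2 S' by blast
        ultimately have "(?x, e (quad ?x ?x ?u ?u)) \<in> W1 O W2 O W2"
          using W3(2) by auto
        then show ?thesis using W1(2) W2(2) by blast
      qed
      moreover have "U \<inter> Ud \<inter> Ue \<in> entourages ?S F" "V \<inter> Vd \<inter> Ve \<in> entourages ?S G"
        "W' \<inter> Xd \<inter> Xe \<in> entourages ?S H"
        using IH dd ee Xd Xe by (auto intro!: entourages_Int)
      ultimately show ?thesis unfolding close_def by blast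
    qed
  qed
  from this[OF day_terms[OF cm] W] obtain U V W' where
    UV: "U \<in> entourages ?S F" "V \<in> entourages ?S G" "W' \<in> entourages ?S H"
    and *: "\<And>a a' b c. \<forall>i. (a i, a' i) \<in> U \<Longrightarrow> \<forall>j. (b j, c j) \<in> V \<Longrightarrow> (p' a c, p' a' c) \<in> W' \<Longrightarrow>
        (p' a b, p' a' b) \<in> W"
    unfolding close_def quad_simps by metis
  \<comment> \<open>The premise of \<open>*\<close> is at \<open>c\<close> and its conclusion at
    \<open>b\<close>, whereas centrality leads from the row of \<open>b\<close> to that of
    \<open>c\<close>; hence the converse of \<open>V\<close>.\<close>
  have "(p c a, p c a') \<in> W"
    if "\<forall>j. (b j, c j) \<in> V\<inverse>" "\<forall>i. (a i, a' i) \<in> U" "(p b a, p b a') \<in> W'" for a a' b c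
    using *[of a a' c b] that by (simp add: p'_def)
  then show "\<exists>V \<in> entourages ?S G. \<exists>U \<in> entourages ?S F. \<exists>W' \<in> entourages ?S H.
      \<forall>b c a a'. (\<forall>j. (b j, c j) \<in> V) \<longrightarrow> (\<forall>i. (a i, a' i) \<in> U) \<longrightarrow> (p b a, p b a') \<in> W' \<longrightarrow>
        (p c a, p c a') \<in> W"
    using UV(1,3) entourages_converse[OF Unif(2) UV(2)] by blast
qed

text \<open>Passing to the Day condition makes it possible to replace \<open>H\<close> by
  \<open>H'\<close>, but the return exchanges \<open>F\<close> and \<open>G\<close>. A second
  passage through the Day condition, now modulo \<open>H'\<close>, restores their order.\<close>

theorem centralizes_mono_right:
  assumes "in_congruence_modular_variety A" "is_algebra A"
    and "F \<in> Unif A" "G \<in> Unif A" "H \<in> Unif A" "H' \<in> Unif A"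
    and "centralizes A F G H" "H \<le> H'"
  shows "centralizes A F G H'"
  using assms
  by (meson centralizes_imp_day_centralizes day_centralizes_imp_centralizes day_centralizes_mono)

section \<open>Joins of finitely many permuting uniformities\<close>

lemma entourages_filter_comp:
  assumes "F \<in> Unif A" "G \<in> Unif A"
  shows "U \<in> entourages (carrier A) (filter_comp (carrier A) F G) \<longleftrightarrow> U \<subseteq> carrier A \<times> carrier A \<and>
    (\<exists>U1 \<in> entourages (carrier A) F. \<exists>U2 \<in> entourages (carrier A) G. U1 O U2 \<subseteq> U)"
  unfolding entourages_def[of _ "filter_comp (carrier A) F G"] mem_Collect_eq
    eventually_filter_comp[OF assms[THEN Unif_le]] subset_eq[symmetric] ..

lemma relcomp_entourage:
  assumes "F \<in> Unif A" "G \<in> Unif A" "U \<in> entourages (carrier A) F" "V \<in> entourages (carrier A) G"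
  shows "U O V \<in> entourages (carrier A) (filter_comp (carrier A) F G)"
  unfolding entourages_filter_comp[OF assms(1,2)]
  using assms(3,4) entourages_sub[OF assms(3)] entourages_sub[OF assms(4)] by blast

lemma filter_comp_le:
  assumes "F \<in> Unif A" "G \<in> Unif A"
  shows "filter_comp (carrier A) F G \<le> principal (carrier A \<times> carrier A)"
  using relcomp_entourage[OF assms entourages_full[OF assms(1)] entourages_full[OF assms(2)]]
  by (auto simp: entourages_def le_principal elim: eventually_mono)

lemma filter_comp_upper:
  assumes "F \<in> Unif A" "G \<in> Unif A"
  shows "F \<le> filter_comp (carrier A) F G" "G \<le> filter_comp (carrier A) F G"
proof -
  let ?S = "carrier A"
  have "eventually P F \<and> eventually P G" if P: "eventually P (filter_comp ?S F G)" for P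
  proof -
    obtain U V where UV: "U \<in> entourages ?S F" "V \<in> entourages ?S G" "\<forall>p \<in> U O V. P p"
      using P unfolding eventually_filter_comp[OF assms[THEN Unif_le]] by blast
    have "p \<in> U O V" if "p \<in> U \<or> p \<in> V" for p
    proof (cases p)
      case (Pair x y)
      then have "x \<in> carrier A" "y \<in> carrier A"
        using that entourages_sub[OF UV(1)] entourages_sub[OF UV(2)] by auto
      then have "(x, x) \<in> U" "(y, y) \<in> V"
        using entourages_refl[OF assms(1) UV(1)] entourages_refl[OF assms(2) UV(2)] by auto
      then show ?thesis using that Pair by auto
    qed
    then have "\<forall>p \<in> U. P p" "\<forall>p \<in> V. P p" using UV(3) by blast+
    then show ?thesis using UV(1,2) by (auto simp: entourages_def elim: eventually_mono)
  qed
  then show "F \<le> filter_comp ?S F G" "G \<le> filter_comp ?S F G" by (auto simp: le_filter_def)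
qed

lemma list_all2_relcompD:
  assumes "list_all2 (\<lambda>x y. (x, y) \<in> U O V) xs ys"
  shows "\<exists>zs. list_all2 (\<lambda>x y. (x, y) \<in> U) xs zs \<and> list_all2 (\<lambda>x y. (x, y) \<in> V) zs ys"
  using assms
proof (induction xs ys rule: list_all2_induct)
  case (Cons x xs y ys)
  then obtain z zs where "(x, z) \<in> U" "(z, y) \<in> V" "list_all2 (\<lambda>x y. (x, y) \<in> U) xs zs"
    "list_all2 (\<lambda>x y. (x, y) \<in> V) zs ys" by auto
  then show ?case by (intro exI[of _ "z # zs"]) auto
qed simp

text \<open>The converse of a composite is a composite in the opposite order, so permutability gives
  symmetry. It also gives the square root of an entourage: in a fourfold composite the two middle
  factors are replaced by a composite in the other order, and then equal factors are
  adjacent.\<close>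

lemma Unif_filter_comp:
  assumes F: "F \<in> Unif A" and G: "G \<in> Unif A" and perm: "permute A F G"
  shows "filter_comp (carrier A) F G \<in> Unif A"
proof -
  let ?S = "carrier A"
  let ?H = "filter_comp ?S F G"
  note ent = entourages_filter_comp[OF F G]
  have ent': "V O U \<in> entourages ?S ?H" if "U \<in> entourages ?S F" "V \<in> entourages ?S G" for U V
    using relcomp_entourage[OF G F that(2,1)] perm by (simp add: permute_def)
  have "uniformity_on ?S ?H"
    unfolding uniformity_on_def
  proof (intro conjI ballI)
    show "?H \<le> principal (?S \<times> ?S)" using F G by (rule filter_comp_le)
  next
    fix U assume U: "U \<in> entourages ?S ?H"
    then obtain U1 U2 where U12: "U1 \<in> entourages ?S F" "U2 \<in> entourages ?S G" "U1 O U2 \<subseteq> U"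
      unfolding ent by blast
    show "refl_on ?S U"
      using entourages_refl[OF F U12(1)] entourages_refl[OF G U12(2)] U12(3)
      by (auto simp: refl_on_def)
    have "U2\<inverse> O U1\<inverse> \<in> entourages ?S ?H"
      by (intro ent' entourages_converse[OF F] entourages_converse[OF G] U12)
    then show "U\<inverse> \<in> entourages ?S ?H"
      by (rule entourages_superset) (use U12(3) entourages_sub[OF U] in auto)
    obtain X1 where X1: "X1 \<in> entourages ?S F" "X1 O X1 \<subseteq> U1" using entourages_O[OF F U12(1)] by blast
    obtain X2 where X2: "X2 \<in> entourages ?S G" "X2 O X2 \<subseteq> U2" using entourages_O[OF G U12(2)] by blast
    have "X1 O X2 \<in> entourages ?S (filter_comp ?S G F)"
      using relcomp_entourage[OF F G X1(1) X2(1)] perm by (simp add: permute_def)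
    then obtain Y1 Y2 where Y: "Y1 \<in> entourages ?S F" "Y2 \<in> entourages ?S G" "Y2 O Y1 \<subseteq> X1 O X2"
      unfolding entourages_filter_comp[OF G F] by blast
    \<comment> \<open>The outer factors use the sets \<open>X1\<close> and \<open>X2\<close>, the
      inner factors the sets \<open>Y1\<close> and \<open>Y2\<close>, so the root consists of
      intersections.\<close>
    have "(X1 \<inter> Y1) O (X2 \<inter> Y2) \<in> entourages ?S ?H"
      using X1 X2 Y by (intro relcomp_entourage[OF F G] entourages_Int)
    moreover have "((X1 \<inter> Y1) O (X2 \<inter> Y2)) O ((X1 \<inter> Y1) O (X2 \<inter> Y2)) \<subseteq> U"
    proof -
      have "((X1 \<inter> Y1) O (X2 \<inter> Y2)) O ((X1 \<inter> Y1) O (X2 \<inter> Y2)) \<subseteq> X1 O (Y2 O Y1) O X2" by blast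
      also have "\<dots> \<subseteq> X1 O (X1 O X2) O X2" 
        by (rule relcomp_mono[OF order_refl relcomp_mono[OF Y(3) order_refl]])
      also have "\<dots> = (X1 O X1) O (X2 O X2)" by (simp add: O_assoc)
      also have "\<dots> \<subseteq> U1 O U2" using X1(2) X2(2) by (rule relcomp_mono)
      finally show ?thesis using U12(3) by blast
    qed
    ultimately show "\<exists>V \<in> entourages ?S ?H. V O V \<subseteq> U" by blast
  qed
  moreover have "compatible A ?H"
    unfolding compatible_def
  proof (intro allI impI ballI)
    fix f n U assume f: "arity A f = Some n" and "U \<in> entourages ?S ?H"
    then obtain U1 U2 where U12: "U1 \<in> entourages ?S F" "U2 \<in> entourages ?S G" "U1 O U2 \<subseteq> U"
      unfolding ent by blast
    have c: "compatible A F" "compatible A G" using F G by (auto simp: Unif_def)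
    obtain V1 where V1: "V1 \<in> entourages ?S F"
      "\<forall>xs \<in> tuples ?S n. \<forall>ys \<in> tuples ?S n.
        list_all2 (\<lambda>x y. (x, y) \<in> V1) xs ys \<longrightarrow> (oper A f xs, oper A f ys) \<in> U1"
      using c(1)[unfolded compatible_def, rule_format, OF f U12(1)] by blast
    obtain V2 where V2: "V2 \<in> entourages ?S G"
      "\<forall>xs \<in> tuples ?S n. \<forall>ys \<in> tuples ?S n.
        list_all2 (\<lambda>x y. (x, y) \<in> V2) xs ys \<longrightarrow> (oper A f xs, oper A f ys) \<in> U2"
      using c(2)[unfolded compatible_def, rule_format, OF f U12(2)] by blast
    have "(oper A f xs, oper A f ys) \<in> U"
      if "xs \<in> tuples ?S n" "ys \<in> tuples ?S n" and l: "list_all2 (\<lambda>x y. (x, y) \<in> V1 O V2) xs ys" for xs ys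
    proof -
      obtain zs where zs: "list_all2 (\<lambda>x y. (x, y) \<in> V1) xs zs" "list_all2 (\<lambda>x y. (x, y) \<in> V2) zs ys"
        using list_all2_relcompD[OF l] by blast
      have "set zs \<subseteq> ?S"
        using zs(1) entourages_sub[OF V1(1)] by (induction xs zs rule: list_all2_induct) auto
      then have "zs \<in> tuples ?S n"
        using that(1) list_all2_lengthD[OF zs(1)] by (simp add: tuples_def)
      then show ?thesis using V1(2) V2(2) zs that(1,2) U12(3) by blast
    qed
    then show "\<exists>U' \<in> entourages ?S ?H. \<forall>xs \<in> tuples ?S n. \<forall>ys \<in> tuples ?S n.
        list_all2 (\<lambda>x y. (x, y) \<in> U') xs ys \<longrightarrow> (oper A f xs, oper A f ys) \<in> U"
      using relcomp_entourage[OF F G V1(1) V2(1)] by blast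
  qed
  ultimately show ?thesis by (simp add: Unif_def)
qed

lemma eventually_filter_comp_left:
  assumes "F \<in> Unif A" "G \<in> Unif A" "H \<in> Unif A"
  shows "eventually P (filter_comp (carrier A) (filter_comp (carrier A) F G) H) \<longleftrightarrow>
    (\<exists>U \<in> entourages (carrier A) F. \<exists>V \<in> entourages (carrier A) G. \<exists>W \<in> entourages (carrier A) H.
      \<forall>p \<in> U O V O W. P p)" (is "?L \<longleftrightarrow> ?R")
proof
  assume ?L
  then obtain X W where X: "X \<in> entourages (carrier A) (filter_comp (carrier A) F G)"
    and W: "W \<in> entourages (carrier A) H" "\<forall>p \<in> X O W. P p"
    unfolding eventually_filter_comp[OF filter_comp_le[OF assms(1,2)] Unif_le[OF assms(3)]] by blast
  obtain U V where "U \<in> entourages (carrier A) F" "V \<in> entourages (carrier A) G" "U O V \<subseteq> X"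
    using X unfolding entourages_filter_comp[OF assms(1,2)] by blast
  moreover from this have "\<forall>p \<in> U O V O W. P p" using W(2) by blast
  ultimately show ?R using W(1) by blast
next
  assume ?R
  then obtain U V W where UVW: "U \<in> entourages (carrier A) F" "V \<in> entourages (carrier A) G"
    "W \<in> entourages (carrier A) H" "\<forall>p \<in> (U O V) O W. P p" by (auto simp: O_assoc)
  then show ?L
    unfolding eventually_filter_comp[OF filter_comp_le[OF assms(1,2)] Unif_le[OF assms(3)]]
    using relcomp_entourage[OF assms(1,2)] by blast
qed

lemma eventually_filter_comp_right:
  assumes "F \<in> Unif A" "G \<in> Unif A" "H \<in> Unif A"
  shows "eventually P (filter_comp (carrier A) F (filter_comp (carrier A) G H)) \<longleftrightarrow>
    (\<exists>U \<in> entourages (carrier A) F. \<exists>V \<in> entourages (carrier A) G. \<exists>W \<in> entourages (carrier A) H.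
      \<forall>p \<in> U O V O W. P p)" (is "?L \<longleftrightarrow> ?R")
proof
  assume ?L
  then obtain X U where X: "X \<in> entourages (carrier A) (filter_comp (carrier A) G H)"
    and U: "U \<in> entourages (carrier A) F" "\<forall>p \<in> U O X. P p"
    unfolding eventually_filter_comp[OF Unif_le[OF assms(1)] filter_comp_le[OF assms(2,3)]] by blast
  obtain V W where "V \<in> entourages (carrier A) G" "W \<in> entourages (carrier A) H" "V O W \<subseteq> X"
    using X unfolding entourages_filter_comp[OF assms(2,3)] by blast
  moreover from this have "\<forall>p \<in> U O V O W. P p" using U(2) by blast
  ultimately show ?R using U(1) by blast
next
  assume ?R
  then show ?L
    unfolding eventually_filter_comp[OF Unif_le[OF assms(1)] filter_comp_le[OF assms(2,3)]]
    using relcomp_entourage[OF assms(2,3)] by blast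
qed

text \<open>The triple composites of entourages form a base of both sides.\<close>

lemma filter_comp_assoc:
  assumes "F \<in> Unif A" "G \<in> Unif A" "H \<in> Unif A"
  shows "filter_comp (carrier A) (filter_comp (carrier A) F G) H =
    filter_comp (carrier A) F (filter_comp (carrier A) G H)"
  unfolding filter_eq_iff eventually_filter_comp_left[OF assms] eventually_filter_comp_right[OF assms]
  by simp

text \<open>By associativity, \<open>H\<close> moves first past \<open>F\<close> and then past
  \<open>G\<close>.\<close>

lemma permute_filter_comp:
  assumes "F \<in> Unif A" "G \<in> Unif A" "H \<in> Unif A" "permute A H F" "permute A H G"
  shows "permute A H (filter_comp (carrier A) F G)"
  using assms(4,5) filter_comp_assoc[OF assms(3,1,2)] filter_comp_assoc[OF assms(1,3,2)]
    filter_comp_assoc[OF assms(1-3)]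
  by (simp add: permute_def)

text \<open>A pair in a composite \<open>U1 O U2\<close> has an intermediate point z, chosen for
  each variable. Centrality of \<open>F\<close> carries closeness from the row of a to that of z,
  and centrality of \<open>G\<close> from there to the row of a'; the entourages are chosen in the
  reverse order.\<close>

lemma centralizes_filter_comp:
  assumes A: "is_algebra A" and Unif: "F \<in> Unif A" "G \<in> Unif A" "K \<in> Unif A" "H \<in> Unif A"
    and "filter_comp (carrier A) F G \<in> Unif A"
    and F: "centralizes A F K H" and G: "centralizes A G K H"
  shows "centralizes A (filter_comp (carrier A) F G) K H"
proof (rule centralizesI[OF A assms(6) Unif(3,4)])
  let ?S = "carrier A"
  fix p :: "(nat \<Rightarrow> 'a) \<Rightarrow> (nat \<Rightarrow> 'a) \<Rightarrow> 'a" and W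
  assume p: "term_fun2 A p" and W: "W \<in> entourages ?S H"
  obtain U2 V2 W2 where 2: "U2 \<in> entourages ?S G" "V2 \<in> entourages ?S K" "W2 \<in> entourages ?S H"
    "\<And>a a' b c. (\<And>i. (a i, a' i) \<in> U2) \<Longrightarrow> (\<And>j. (b j, c j) \<in> V2) \<Longrightarrow> (p a b, p a c) \<in> W2 \<Longrightarrow>
      (p a' b, p a' c) \<in> W" using centralizesD[OF G p W] by metis
  obtain U1 V1 W1 where 1: "U1 \<in> entourages ?S F" "V1 \<in> entourages ?S K" "W1 \<in> entourages ?S H"
    "\<And>a a' b c. (\<And>i. (a i, a' i) \<in> U1) \<Longrightarrow> (\<And>j. (b j, c j) \<in> V1) \<Longrightarrow> (p a b, p a c) \<in> W1 \<Longrightarrow>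
      (p a' b, p a' c) \<in> W2" using centralizesD[OF F p 2(3)] by metis
  have "(p a' b, p a' c) \<in> W"
    if a: "\<forall>i. (a i, a' i) \<in> U1 O U2" and b: "\<forall>j. (b j, c j) \<in> V1 \<inter> V2" and "(p a b, p a c) \<in> W1"
    for a a' b c
  proof -
    have "\<forall>i. \<exists>z. (a i, z) \<in> U1 \<and> (z, a' i) \<in> U2" using a by blast
    then obtain z where "\<And>i. (a i, z i) \<in> U1" "\<And>i. (z i, a' i) \<in> U2" by metis
    then show ?thesis using 1(4)[of a z b c] 2(4)[of z a' b c] b that(3) by blast
  qed
  moreover have "U1 O U2 \<in> entourages ?S (filter_comp ?S F G)"
    using relcomp_entourage[OF Unif(1,2) 1(1) 2(1)] .
  moreover have "V1 \<inter> V2 \<in> entourages ?S K" using 1(2) 2(2) by (rule entourages_Int)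
  ultimately show "\<exists>U \<in> entourages ?S (filter_comp ?S F G). \<exists>V \<in> entourages ?S K.
      \<exists>W' \<in> entourages ?S H. \<forall>a a' b c. (\<forall>i. (a i, a' i) \<in> U) \<longrightarrow> (\<forall>j. (b j, c j) \<in> V) \<longrightarrow>
        (p a b, p a c) \<in> W' \<longrightarrow> (p a' b, p a' c) \<in> W"
    using 1(3) by blast
qed

text \<open>The uniformity generated by the diagonal serves as the join of the empty family and
  starts the induction over finite sets of uniformities.\<close>

lemma Unif_Id:
  assumes "is_algebra A"
  shows "principal (Id_on (carrier A)) \<in> Unif A" (is "?I \<in> _")
proof -
  let ?S = "carrier A"
  have e: "entourages ?S ?I = {U. U \<subseteq> ?S \<times> ?S \<and> Id_on ?S \<subseteq> U}"
    by (auto simp: entourages_def eventually_principal)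
  have "(oper A f xs, oper A f ys) \<in> U"
    if "Id_on ?S \<subseteq> U" "arity A f = Some n" "xs \<in> tuples ?S n" "list_all2 (\<lambda>x y. (x, y) \<in> Id_on ?S) xs ys"
    for f n U xs ys
  proof -
    have "xs = ys" using that(4) by (induction xs ys rule: list_all2_induct) auto
    then show ?thesis using that assms by (auto simp: is_algebra_def)
  qed
  then have "compatible A ?I"
    unfolding compatible_def e by (intro allI impI ballI bexI[of _ "Id_on ?S"]) auto
  moreover have "uniformity_on ?S ?I"
    unfolding uniformity_on_def
  proof (intro conjI ballI)
    show "?I \<le> principal (?S \<times> ?S)" by auto
    fix U assume "U \<in> entourages ?S ?I"
    then have U: "U \<subseteq> ?S \<times> ?S" "Id_on ?S \<subseteq> U" unfolding e by auto
    then show "refl_on ?S U" "U\<inverse> \<in> entourages ?S ?I"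
      unfolding e by (auto simp: refl_on_def Id_on_def)
    show "\<exists>V \<in> entourages ?S ?I. V O V \<subseteq> U"
      using U unfolding e by (intro bexI[of _ "Id_on ?S"]) auto
  qed
  ultimately show ?thesis by (simp add: Unif_def)
qed

lemma permute_Id:
  assumes "is_algebra A" "F \<in> Unif A"
  shows "permute A F (principal (Id_on (carrier A)))"
proof -
  let ?S = "carrier A"
  let ?I = "principal (Id_on ?S)"
  note I = Unif_Id[OF assms(1)]
  have e: "Id_on ?S \<in> entourages ?S ?I" "\<And>V. V \<in> entourages ?S ?I \<Longrightarrow> Id_on ?S \<subseteq> V"
    by (auto simp: entourages_def eventually_principal)
  have Id: "U O Id_on ?S = U" "Id_on ?S O U = U" if "U \<in> entourages ?S F" for U
    using entourages_sub[OF that] by auto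
  have "eventually P (filter_comp ?S F ?I) \<longleftrightarrow> (\<exists>U \<in> entourages ?S F. \<forall>p \<in> U. P p)" for P
    unfolding eventually_filter_comp[OF assms(2)[THEN Unif_le] I[THEN Unif_le]]
  proof (intro bex_cong refl iffI)
    fix U assume U: "U \<in> entourages ?S F"
    show "\<forall>p \<in> U. P p" if "\<exists>V \<in> entourages ?S ?I. \<forall>p \<in> U O V. P p"
      using that e(2) Id(1)[OF U] relcomp_mono[OF order_refl[of U]] by (metis subsetD)
    show "\<exists>V \<in> entourages ?S ?I. \<forall>p \<in> U O V. P p" if "\<forall>p \<in> U. P p"
      using that Id(1)[OF U] by (intro bexI[OF _ e(1)]) simp
  qed
  moreover have "eventually P (filter_comp ?S ?I F) \<longleftrightarrow> (\<exists>U \<in> entourages ?S F. \<forall>p \<in> U. P p)" for P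
    unfolding eventually_filter_comp[OF I[THEN Unif_le] assms(2)[THEN Unif_le]]
  proof (intro iffI)
    assume "\<exists>V \<in> entourages ?S ?I. \<exists>U \<in> entourages ?S F. \<forall>p \<in> V O U. P p"
    then obtain V U where "V \<in> entourages ?S ?I" and U: "U \<in> entourages ?S F" and "\<forall>p \<in> V O U. P p"
      by blast
    moreover from this have "Id_on ?S O U \<subseteq> V O U" using e(2) by (intro relcomp_mono) auto
    ultimately show "\<exists>U \<in> entourages ?S F. \<forall>p \<in> U. P p" using Id(2)[OF U] by (metis subsetD)
  next
    assume "\<exists>U \<in> entourages ?S F. \<forall>p \<in> U. P p"
    then show "\<exists>V \<in> entourages ?S ?I. \<exists>U \<in> entourages ?S F. \<forall>p \<in> V O U. P p"
      using Id(2) by (intro bexI[OF _ e(1)]) auto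
  qed
  ultimately show ?thesis by (simp add: permute_def filter_eq_iff)
qed

lemma centralizes_Id:
  assumes "is_algebra A" "G \<in> Unif A" "H \<in> Unif A"
  shows "centralizes A (principal (Id_on (carrier A))) G H"
proof (rule centralizesI[OF assms(1) Unif_Id[OF assms(1)] assms(2,3)])
  let ?S = "carrier A"
  fix p :: "(nat \<Rightarrow> 'a) \<Rightarrow> (nat \<Rightarrow> 'a) \<Rightarrow> 'a" and W
  assume W: "W \<in> entourages ?S H"
  have *: "(p a' b, p a' c) \<in> W" if "\<forall>i. (a i, a' i) \<in> Id_on ?S" "(p a b, p a c) \<in> W" for a a' b c
  proof -
    have "a i = a' i" for i using that(1) by (auto simp: Id_on_iff)
    then have "a = a'" by blast
    then show ?thesis using that(2) by simp
  qed
  have "Id_on ?S \<in> entourages ?S (principal (Id_on ?S))"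
    by (auto simp: entourages_def eventually_principal)
  then show "\<exists>U \<in> entourages ?S (principal (Id_on ?S)). \<exists>V \<in> entourages ?S G.
      \<exists>W' \<in> entourages ?S H. \<forall>a a' b c. (\<forall>i. (a i, a' i) \<in> U) \<longrightarrow> (\<forall>j. (b j, c j) \<in> V) \<longrightarrow>
        (p a b, p a c) \<in> W' \<longrightarrow> (p a' b, p a' c) \<in> W"
    by (rule bexI[rotated], intro bexI[OF _ entourages_full[OF assms(2)]] bexI[OF _ W] allI impI)
      (rule *)
qed

text \<open>Successive composites give an upper bound \<open>C\<close> of \<open>X\<close> that
  centralizes \<open>G\<close> modulo \<open>H\<close>. The join lies below \<open>C\<close>, and
  centrality passes to smaller first arguments.\<close>

theorem centralizes_Join_permute:
  assumes A: "is_algebra A" and "finite X" "X \<subseteq> Unif A"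
    and "\<And>F F'. F \<in> X \<Longrightarrow> F' \<in> X \<Longrightarrow> permute A F F'"
    and G: "G \<in> Unif A" and H: "H \<in> Unif A" and "\<And>F. F \<in> X \<Longrightarrow> centralizes A F G H"
  shows "centralizes A (Unif_Join A X) G H"
proof -
  \<comment> \<open>The last conjunct carries permutability through the induction: it makes the next
    member of \<open>X\<close> permute with the composite of those already treated.\<close>
  have "\<exists>C \<in> Unif A. (\<forall>F \<in> X. F \<le> C) \<and> centralizes A C G H \<and>
      (\<forall>K \<in> Unif A. (\<forall>F \<in> X. permute A K F) \<longrightarrow> permute A K C)"
    using assms(2,3,4,7)
  proof (induction X rule: finite_induct)
    case empty
    then show ?case using Unif_Id[OF A] centralizes_Id[OF A G H] permute_Id[OF A] by blast
  next
    case (insert F X)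
    then obtain C where C: "C \<in> Unif A" "\<forall>F \<in> X. F \<le> C" "centralizes A C G H"
      "\<forall>K \<in> Unif A. (\<forall>F \<in> X. permute A K F) \<longrightarrow> permute A K C" by auto
    have F: "F \<in> Unif A" using insert.prems by blast
    have "permute A F C" using C(4) F insert.prems(2) by blast
    let ?C = "filter_comp (carrier A) F C"
    have FC: "?C \<in> Unif A" using F C(1) \<open>permute A F C\<close> by (rule Unif_filter_comp)
    moreover have "\<forall>F' \<in> insert F X. F' \<le> ?C"
      using filter_comp_upper[OF F C(1)] C(2) by (auto intro: order_trans)
    moreover have "centralizes A ?C G H"
      using centralizes_filter_comp[OF A F C(1) G H FC] insert.prems(3) C(3) by blast
    moreover have "permute A K ?C" if "K \<in> Unif A" "\<forall>F' \<in> insert F X. permute A K F'" for K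
      using permute_filter_comp[OF F C(1) that(1)] C(4) that by blast
    ultimately show ?case by blast
  qed
  then obtain C where C: "C \<in> Unif A" "\<forall>F \<in> X. F \<le> C" "centralizes A C G H" by blast
  have "Unif_Join A X \<le> C" using C(1,2) by (intro Unif_Join_is_lub(3)[OF A assms(3)]) auto
  then show ?thesis using centralizes_mono_left[OF C(3)] by blast
qed

section \<open>Algebras with an underlying group\<close>

lemma term_fun_term_op:
  assumes "t \<in> nary_terms A (length qs)" "\<And>q. q \<in> set qs \<Longrightarrow> term_fun A q"
  shows "term_fun A (\<lambda>v. term_op A t (map (\<lambda>q. q v) qs))"
proof -
  have t: "wf_trm (arity A) t" "vars t \<subseteq> {..<length qs}" using assms(1) by (auto simp: nary_terms_def)
  \<comment> \<open>Indices beyond the list do not occur in \<open>t\<close>; an arbitrary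
    projection fills their places.\<close>
  define r where "r i = (if i < length qs then qs ! i else (\<lambda>v. v undefined))" for i
  have "term_fun A (r i)" for i
    using assms(2) term_fun_proj by (auto simp: r_def)
  moreover have "term_fun A (\<lambda>w. eval A w t)" using t(1) by (auto simp: term_fun_def)
  ultimately have "term_fun A (\<lambda>v. eval A (\<lambda>i. r i v) t)" using term_fun_comp by blast
  moreover have "eval A (\<lambda>i. r i v) t = term_op A t (map (\<lambda>q. q v) qs)" for v
    unfolding term_op_def by (rule eval_cong_vars) (use t(2) in \<open>auto simp: r_def\<close>)
  ultimately show ?thesis by simp
qed

definition binary_term_fun :: "('a, 'f) ualgebra \<Rightarrow> ('a \<Rightarrow> 'a \<Rightarrow> 'a) \<Rightarrow> bool" where
  "binary_term_fun A d \<longleftrightarrow> term_fun A (\<lambda>v. d (v True) (v False))"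

lemma binary_term_fun_comp:
  assumes "binary_term_fun A d" "term_fun A p" "term_fun A q"
  shows "term_fun A (\<lambda>v. d (p v) (q v))"
proof -
  have "term_fun A (if b then p else q)" for b using assms by simp
  from term_fun_comp[OF assms(1)[unfolded binary_term_fun_def], of "\<lambda>b. if b then p else q", OF this]
  show ?thesis by simp
qed

lemma binary_term_fun_closed:
  assumes "is_algebra A" "binary_term_fun A d" "x \<in> carrier A" "y \<in> carrier A"
  shows "d x y \<in> carrier A"
proof -
  have "range (\<lambda>b. if b then x else y) \<subseteq> carrier A" using assms(3,4) by auto
  from term_fun_closed[OF assms(1) assms(2)[unfolded binary_term_fun_def] this] show ?thesis by simp
qed

lemma binary_term_fun_uniform:
  assumes "F \<in> Unif A" "binary_term_fun A d" "W \<in> entourages (carrier A) F"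
  obtains W' where "W' \<in> entourages (carrier A) F"
    "\<And>x x' y y'. (x, x') \<in> W' \<Longrightarrow> (y, y') \<in> W' \<Longrightarrow> (d x y, d x' y') \<in> W"
proof -
  obtain W' where W': "W' \<in> entourages (carrier A) F"
    "\<And>v w. (\<And>i. (v i, w i) \<in> W') \<Longrightarrow> (d (v True) (v False), d (w True) (w False)) \<in> W"
    using term_fun_uniform[OF assms(1) assms(2)[unfolded binary_term_fun_def] assms(3)] by metis
  have "(d x y, d x' y') \<in> W" if "(x, x') \<in> W'" "(y, y') \<in> W'" for x x' y y'
    using W'(2)[of "\<lambda>b. if b then x else y" "\<lambda>b. if b then x' else y'"] that by auto
  then show thesis using that W'(1) by blast
qed

text \<open>In the group, \<open>\<delta> x y\<close> is y * inverse x, the displacement from x to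
  y, and \<open>\<sigma>\<close> is multiplication, which applies a displacement to a point. The
  element \<open>e\<close> is the identity.\<close>

lemma group_difference_terms:
  fixes A :: "('a, 'f) ualgebra"
  assumes "has_underlying_group A"
  obtains \<delta> \<sigma> e where "binary_term_fun A \<delta>" "binary_term_fun A \<sigma>"
    "\<And>x. x \<in> carrier A \<Longrightarrow> \<delta> x x = e" "\<And>x. x \<in> carrier A \<Longrightarrow> \<sigma> e x = x"
    "\<And>x y. x \<in> carrier A \<Longrightarrow> y \<in> carrier A \<Longrightarrow> \<sigma> (\<delta> x y) x = y"
proof -
  obtain G :: "'a monoid" and m i where G: "group G" "carrier G = carrier A"
    and m: "m \<in> nary_terms A 2"
      "\<And>x y. x \<in> carrier A \<Longrightarrow> y \<in> carrier A \<Longrightarrow> x \<otimes>\<^bsub>G\<^esub> y = term_op A m [x, y]"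
    and i: "i \<in> nary_terms A 1" "\<And>x. x \<in> carrier A \<Longrightarrow> inv\<^bsub>G\<^esub> x = term_op A i [x]"
    using assms unfolding has_underlying_group_def by blast
  interpret G: group G by fact
  define \<sigma> where "\<sigma> x y = term_op A m [x, y]" for x y
  define \<delta> where "\<delta> x y = \<sigma> y (term_op A i [x])" for x y
  have "term_fun A (\<lambda>v. term_op A m (map (\<lambda>q. q v) [\<lambda>v :: bool \<Rightarrow> 'a. v True, \<lambda>v. v False]))"
    by (rule term_fun_term_op) (use m(1) term_fun_proj in \<open>auto simp: numeral_2_eq_2\<close>)
  then have \<sigma>: "binary_term_fun A \<sigma>" by (simp add: binary_term_fun_def \<sigma>_def)
  have "term_fun A (\<lambda>v. term_op A i (map (\<lambda>q. q v) [\<lambda>v :: bool \<Rightarrow> 'a. v True]))"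
    by (rule term_fun_term_op) (use i(1) term_fun_proj in auto)
  then have "term_fun A (\<lambda>v :: bool \<Rightarrow> 'a. term_op A i [v True])" by simp
  from binary_term_fun_comp[OF \<sigma> term_fun_proj this]
  have \<delta>: "binary_term_fun A \<delta>" unfolding binary_term_fun_def \<delta>_def .
  have eq: "\<sigma> x y = x \<otimes>\<^bsub>G\<^esub> y" "\<delta> x y = y \<otimes>\<^bsub>G\<^esub> inv\<^bsub>G\<^esub> x" if "x \<in> carrier A" "y \<in> carrier A" for x y
    using that m(2)[of y "inv\<^bsub>G\<^esub> x"] m(2)[of x y] i(2)[of x] G(2) G.inv_closed[of x]
    by (auto simp: \<sigma>_def \<delta>_def)
  show thesis
  proof
    show "binary_term_fun A \<delta>" "binary_term_fun A \<sigma>" by fact+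
    show "\<delta> x x = \<one>\<^bsub>G\<^esub>" if "x \<in> carrier A" for x
      using eq that G(2) by simp
    show "\<sigma> \<one>\<^bsub>G\<^esub> x = x" if "x \<in> carrier A" for x
      using eq that G(2) G.one_closed by simp
    show "\<sigma> (\<delta> x y) x = y" if "x \<in> carrier A" "y \<in> carrier A" for x y
    proof -
      have xy: "x \<in> carrier G" "y \<in> carrier G" using that G(2) by auto
      then have "\<delta> x y \<in> carrier A" using eq(2)[OF that] G(2) G.m_closed G.inv_closed by metis
      then have "\<sigma> (\<delta> x y) x = y \<otimes>\<^bsub>G\<^esub> inv\<^bsub>G\<^esub> x \<otimes>\<^bsub>G\<^esub> x" using eq that by simp
      also have "\<dots> = y" using xy by (simp add: G.m_assoc)
      finally show ?thesis .
    qed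
  qed
qed

text \<open>
  The sets below form a base of the initial uniformity for which, for every term \<open>p\<close>, the maps
  \<open>z \<mapsto> (\<lambda>(x, b, c). \<delta> (p (x(k := z)) b) (p (x(k := z)) c))\<close> are uniformly continuous with
  respect to uniform convergence.
\<close>

definition diff_entourage :: "('a, 'f) ualgebra \<Rightarrow> ('a \<Rightarrow> 'a \<Rightarrow> 'a) \<Rightarrow> ('a \<times> 'a) set \<Rightarrow>
    (nat \<times> ((nat \<Rightarrow> 'a) \<Rightarrow> (nat \<Rightarrow> 'a) \<Rightarrow> 'a)) set \<Rightarrow> ('a \<times> 'a) set \<Rightarrow> ('a \<times> 'a) set" where
  "diff_entourage A \<delta> \<alpha> T W = {(a, a') \<in> carrier A \<times> carrier A.
     \<forall>(k, p) \<in> T. \<forall>x b c. range x \<subseteq> carrier A \<longrightarrow> (\<forall>j. (b j, c j) \<in> \<alpha>) \<longrightarrow>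
       (\<delta> (p (x(k := a)) b) (p (x(k := a)) c), \<delta> (p (x(k := a')) b) (p (x(k := a')) c)) \<in> W}"

text \<open>The pair \<open>(k, p)\<close> marks the variable \<open>k\<close> of the term
  \<open>p\<close> that is moved. Sets of finitely many pairs make the entourages a filter base; one
  \<open>W\<close> can serve for all of them because entourages can be intersected.\<close>

definition diff_base :: "('a, 'f) ualgebra \<Rightarrow> ('a \<times> 'a) filter \<Rightarrow>
    ((nat \<times> ((nat \<Rightarrow> 'a) \<Rightarrow> (nat \<Rightarrow> 'a) \<Rightarrow> 'a)) set \<times> ('a \<times> 'a) set) set" where
  "diff_base A H = {(T, W). finite T \<and> (\<forall>(k, p) \<in> T. term_fun2 A p) \<and> W \<in> entourages (carrier A) H}"

text \<open>Under the group assumptions, this is the largest member of \<open>Unif A\<close> that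
  centralizes \<open>Ug \<alpha>\<close> modulo \<open>H\<close>, as \<open>diff_Unif\<close>,
  \<open>centralizes_diff\<close> and \<open>diff_upper\<close> show.\<close>

definition diff_uniformity :: "('a, 'f) ualgebra \<Rightarrow> ('a \<Rightarrow> 'a \<Rightarrow> 'a) \<Rightarrow> ('a \<times> 'a) set \<Rightarrow>
    ('a \<times> 'a) filter \<Rightarrow> ('a \<times> 'a) filter" where
  "diff_uniformity A \<delta> \<alpha> H = (INF (T, W) \<in> diff_base A H. principal (diff_entourage A \<delta> \<alpha> T W))"

lemma diff_entourageD:
  assumes "(a, a') \<in> diff_entourage A \<delta> \<alpha> T W" "(k, p) \<in> T" "range x \<subseteq> carrier A"
    "\<And>j. (b j, c j) \<in> \<alpha>"
  shows "(\<delta> (p (x(k := a)) b) (p (x(k := a)) c), \<delta> (p (x(k := a')) b) (p (x(k := a')) c)) \<in> W"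
proof -
  have "\<forall>(k, p) \<in> T. \<forall>x b c. range x \<subseteq> carrier A \<longrightarrow> (\<forall>j. (b j, c j) \<in> \<alpha>) \<longrightarrow>
      (\<delta> (p (x(k := a)) b) (p (x(k := a)) c), \<delta> (p (x(k := a')) b) (p (x(k := a')) c)) \<in> W"
    using assms(1) by (simp add: diff_entourage_def)
  from bspec[OF this assms(2)] show ?thesis using assms(3,4) by simp
qed

lemma diff_entourageI:
  assumes "a \<in> carrier A" "a' \<in> carrier A"
    "\<And>k p x b c. (k, p) \<in> T \<Longrightarrow> range x \<subseteq> carrier A \<Longrightarrow> \<forall>j. (b j, c j) \<in> \<alpha> \<Longrightarrow>
      (\<delta> (p (x(k := a)) b) (p (x(k := a)) c), \<delta> (p (x(k := a')) b) (p (x(k := a')) c)) \<in> W"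
  shows "(a, a') \<in> diff_entourage A \<delta> \<alpha> T W"
  using assms(1,2) by (auto simp: diff_entourage_def intro!: assms(3))

lemma diff_entourage_sub: "diff_entourage A \<delta> \<alpha> T W \<subseteq> carrier A \<times> carrier A"
  unfolding diff_entourage_def by fast

lemma diff_entourage_mono:
  assumes "T \<subseteq> T'" "W' \<subseteq> W"
  shows "diff_entourage A \<delta> \<alpha> T' W' \<subseteq> diff_entourage A \<delta> \<alpha> T W"
proof safe
  fix a a' assume a: "(a, a') \<in> diff_entourage A \<delta> \<alpha> T' W'"
  then show "(a, a') \<in> diff_entourage A \<delta> \<alpha> T W"
    using diff_entourage_sub[of A \<delta> \<alpha> T' W'] diff_entourageD[OF a] assms
    by (intro diff_entourageI) blast+
qed

lemma eventually_diff_uniformity: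
  assumes "H \<in> Unif A"
  shows "eventually P (diff_uniformity A \<delta> \<alpha> H) \<longleftrightarrow>
    (\<exists>(T, W) \<in> diff_base A H. \<forall>z \<in> diff_entourage A \<delta> \<alpha> T W. P z)"
proof -
  have "eventually P (diff_uniformity A \<delta> \<alpha> H) \<longleftrightarrow> (\<exists>i \<in> diff_base A H.
      eventually P (case i of (T, W) \<Rightarrow> principal (diff_entourage A \<delta> \<alpha> T W)))"
    unfolding diff_uniformity_def
  proof (rule eventually_INF_base)
    have "({}, carrier A \<times> carrier A) \<in> diff_base A H"
      using entourages_full[OF assms] by (simp add: diff_base_def)
    then show "diff_base A H \<noteq> {}" by blast
  next
    fix i j assume "i \<in> diff_base A H" "j \<in> diff_base A H"
    moreover obtain T W T' W' where [simp]: "i = (T, W)" "j = (T', W')" by (cases i; cases j)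
    ultimately have "(T \<union> T', W \<inter> W') \<in> diff_base A H"
      by (auto simp: diff_base_def intro: entourages_Int)
    then show "\<exists>x \<in> diff_base A H. (case x of (T, W) \<Rightarrow> principal (diff_entourage A \<delta> \<alpha> T W))
        \<le> inf (case i of (T, W) \<Rightarrow> principal (diff_entourage A \<delta> \<alpha> T W))
            (case j of (T, W) \<Rightarrow> principal (diff_entourage A \<delta> \<alpha> T W))"
      using diff_entourage_mono[of T "T \<union> T'" "W \<inter> W'" W A \<delta> \<alpha>]
        diff_entourage_mono[of T' "T \<union> T'" "W \<inter> W'" W' A \<delta> \<alpha>]
      by (intro bexI[of _ "(T \<union> T', W \<inter> W')"]) auto
  qed
  then show ?thesis by (simp add: eventually_principal case_prod_unfold)
qed

lemma entourages_diff_uniformity: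
  assumes "H \<in> Unif A"
  shows "U \<in> entourages (carrier A) (diff_uniformity A \<delta> \<alpha> H) \<longleftrightarrow> U \<subseteq> carrier A \<times> carrier A \<and>
    (\<exists>T W. (T, W) \<in> diff_base A H \<and> diff_entourage A \<delta> \<alpha> T W \<subseteq> U)"
  unfolding entourages_def eventually_diff_uniformity[OF assms] by (auto simp: subset_eq)

lemma diff_entourage_in:
  assumes "H \<in> Unif A" "(T, W) \<in> diff_base A H"
  shows "diff_entourage A \<delta> \<alpha> T W \<in> entourages (carrier A) (diff_uniformity A \<delta> \<alpha> H)"
  unfolding entourages_diff_uniformity[OF assms(1)] using assms(2) diff_entourage_sub by blast

text \<open>This reduces a change of all variables of the first block to finitely many changes of a
  single variable.\<close>

lemma term_fun2_finite_vars:
  assumes "term_fun2 A p"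
  obtains N where "finite N" "\<And>a a' b. (\<And>i. i \<in> N \<Longrightarrow> a i = a' i) \<Longrightarrow> p a b = p a' b"
proof -
  obtain t where t: "\<And>v. p (v \<circ> Inl) (v \<circ> Inr) = eval A v t"
    using assms unfolding term_fun2_def term_fun_def by metis
  have p: "p a b = eval A (case_sum a b) t" for a b
    using t[of "case_sum a b"] by (simp add: comp_def)
  have "p a b = p a' b" if "\<And>i. i \<in> Inl -` vars t \<Longrightarrow> a i = a' i" for a a' b
    unfolding p by (rule eval_cong_vars) (use that in \<open>auto split: sum.split\<close>)
  then show thesis using that[of "Inl -` vars t"] finite_vimageI[OF finite_vars inj_Inl] by blast
qed

section \<open>The largest uniformity that centralizes a congruence\<close>

context
  fixes A :: "('a, 'f) ualgebra" and \<delta> \<sigma> :: "'a \<Rightarrow> 'a \<Rightarrow> 'a" and e :: 'a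
    and \<alpha> :: "('a \<times> 'a) set" and H :: "('a \<times> 'a) filter"
  assumes A: "is_algebra A"
    and \<delta>: "binary_term_fun A \<delta>" and \<sigma>: "binary_term_fun A \<sigma>"
    and \<delta>_self: "\<And>x. x \<in> carrier A \<Longrightarrow> \<delta> x x = e"
    and \<sigma>_e: "\<And>x. x \<in> carrier A \<Longrightarrow> \<sigma> e x = x"
    and \<sigma>_\<delta>: "\<And>x y. x \<in> carrier A \<Longrightarrow> y \<in> carrier A \<Longrightarrow> \<sigma> (\<delta> x y) x = y"
    and \<alpha>: "congruence A \<alpha>" and H: "H \<in> Unif A"
begin

private abbreviation "D \<equiv> diff_uniformity A \<delta> \<alpha> H"

lemma diff_closed:
  assumes "term_fun2 A p" "range x \<subseteq> carrier A" "\<forall>j. (b j, c j) \<in> \<alpha>"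
  shows "p x b \<in> carrier A" "p x c \<in> carrier A" "\<delta> (p x b) (p x c) \<in> carrier A"
proof -
  have "range b \<subseteq> carrier A" "range c \<subseteq> carrier A" using assms(3) congruence_sub[OF \<alpha>] by auto
  then show "p x b \<in> carrier A" "p x c \<in> carrier A" using term_fun2_closed[OF A assms(1,2)] by auto
  then show "\<delta> (p x b) (p x c) \<in> carrier A" by (rule binary_term_fun_closed[OF A \<delta>])
qed

text \<open>For fixed \<open>T\<close>, each axiom is inherited from the corresponding property of
  \<open>W\<close> in \<open>H\<close>.\<close>

lemma diff_uniformity_on: "uniformity_on (carrier A) D"
  unfolding uniformity_on_def
proof (intro conjI ballI)
  let ?S = "carrier A"
  have "({}, ?S \<times> ?S) \<in> diff_base A H"
    using entourages_full[OF H] by (simp add: diff_base_def)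
  from diff_entourage_in[OF H this]
  have "eventually (\<lambda>z. z \<in> diff_entourage A \<delta> \<alpha> {} (?S \<times> ?S)) D" by (simp add: entourages_def)
  then show "D \<le> principal (?S \<times> ?S)"
    unfolding le_principal by (rule eventually_mono) (use diff_entourage_sub in blast)
  fix U assume U: "U \<in> entourages ?S D"
  then obtain T W where TW: "(T, W) \<in> diff_base A H" "diff_entourage A \<delta> \<alpha> T W \<subseteq> U"
    unfolding entourages_diff_uniformity[OF H] by blast
  then have T: "\<And>k p. (k, p) \<in> T \<Longrightarrow> term_fun2 A p" "finite T" and W: "W \<in> entourages ?S H"
    by (auto simp: diff_base_def)
  have base: "(T, W') \<in> diff_base A H" if "W' \<in> entourages ?S H" for W'
    using that T by (auto simp: diff_base_def)
  have "(a, a) \<in> diff_entourage A \<delta> \<alpha> T W" if a: "a \<in> ?S" for a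
  proof (rule diff_entourageI[OF a a])
    fix k p and x b c :: "nat \<Rightarrow> 'a" assume *: "(k, p) \<in> T" "range x \<subseteq> ?S" "\<forall>j. (b j, c j) \<in> \<alpha>"
    then have "range (x(k := a)) \<subseteq> ?S" using a by (auto simp: image_subset_iff)
    from diff_closed(3)[OF T(1)[OF *(1)] this *(3)]
    show "(\<delta> (p (x(k := a)) b) (p (x(k := a)) c), \<delta> (p (x(k := a)) b) (p (x(k := a)) c)) \<in> W"
      by (rule entourages_refl[OF H W])
  qed
  then show "refl_on ?S U" using TW(2) by (auto simp: refl_on_def)
  have "diff_entourage A \<delta> \<alpha> T (W\<inverse>) \<subseteq> U\<inverse>"
  proof safe
    fix a a' assume a: "(a, a') \<in> diff_entourage A \<delta> \<alpha> T (W\<inverse>)"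
    then have "(a', a) \<in> diff_entourage A \<delta> \<alpha> T W"
      using diff_entourage_sub[of A \<delta> \<alpha> T "W\<inverse>"] diff_entourageD[OF a]
      by (intro diff_entourageI) blast+
    then show "(a', a) \<in> U" using TW(2) by blast
  qed
  then show "U\<inverse> \<in> entourages ?S D"
    using base[OF entourages_converse[OF H W]] entourages_sub[OF U]
    unfolding entourages_diff_uniformity[OF H] by blast
  obtain W' where W': "W' \<in> entourages ?S H" "W' O W' \<subseteq> W" using entourages_O[OF H W] by blast
  have "diff_entourage A \<delta> \<alpha> T W' O diff_entourage A \<delta> \<alpha> T W' \<subseteq> U"
  proof safe
    fix a a' a'' assume a: "(a, a') \<in> diff_entourage A \<delta> \<alpha> T W'" "(a', a'') \<in> diff_entourage A \<delta> \<alpha> T W'"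
    have "(a, a'') \<in> diff_entourage A \<delta> \<alpha> T W"
      using diff_entourage_sub[of A \<delta> \<alpha> T W'] a W'(2) diff_entourageD[OF a(1)] diff_entourageD[OF a(2)]
      by (intro diff_entourageI) (blast, blast, meson relcomp.relcompI subsetD)
    then show "(a, a'') \<in> U" using TW(2) by blast
  qed
  then show "\<exists>V \<in> entourages ?S D. V O V \<subseteq> U"
    using diff_entourage_in[OF H base[OF W'(1)]] by blast
qed

lemma diff_refl: "U \<in> entourages (carrier A) D \<Longrightarrow> x \<in> carrier A \<Longrightarrow> (x, x) \<in> U"
  using diff_uniformity_on unfolding uniformity_on_def refl_on_def by blast

lemma diff_full: "carrier A \<times> carrier A \<in> entourages (carrier A) D"
  using diff_uniformity_on by (auto simp: uniformity_on_def entourages_def le_principal)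

text \<open>The definition of \<open>D\<close> controls a change of one variable of
  \<open>p\<close>. Moving the finitely many variables that occur in \<open>p\<close> one after
  another, with a square root of \<open>W\<close> at each stage, controls a simultaneous
  change.\<close>

lemma diff_uniform:
  fixes p :: "(nat \<Rightarrow> 'a) \<Rightarrow> (nat \<Rightarrow> 'a) \<Rightarrow> 'a"
  assumes p: "term_fun2 A p" and W: "W \<in> entourages (carrier A) H"
  shows "\<exists>U \<in> entourages (carrier A) D. \<forall>a a' b c. (\<forall>i. (a i, a' i) \<in> U) \<longrightarrow>
    (\<forall>j. (b j, c j) \<in> \<alpha>) \<longrightarrow> (\<delta> (p a b) (p a c), \<delta> (p a' b) (p a' c)) \<in> W"
proof -
  let ?S = "carrier A"
  \<comment> \<open>The set \<open>N\<close> contains the variables in which \<open>a\<close> and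
    \<open>a'\<close> may differ.\<close>
  have step: "\<exists>U \<in> entourages ?S D. \<forall>a a' b c. (\<forall>i. (a i, a' i) \<in> U) \<longrightarrow> (\<forall>i. i \<notin> N \<longrightarrow> a i = a' i) \<longrightarrow>
      (\<forall>j. (b j, c j) \<in> \<alpha>) \<longrightarrow> (\<delta> (p a b) (p a c), \<delta> (p a' b) (p a' c)) \<in> W"
    if "finite N" "W \<in> entourages ?S H" for N W
    using that
  proof (induction N arbitrary: W rule: finite_induct)
    case empty
    have "(\<delta> (p a b) (p a c), \<delta> (p a' b) (p a' c)) \<in> W"
      if "\<forall>i. (a i, a' i) \<in> ?S \<times> ?S" "\<forall>i. a i = a' i" "\<forall>j. (b j, c j) \<in> \<alpha>" for a a' b c
    proof -
      have "a = a'" "range a \<subseteq> ?S" using that by auto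
      then show ?thesis using entourages_refl[OF H empty] diff_closed(3)[OF p _ that(3)] by auto
    qed
    then show ?case by (intro bexI[OF _ diff_full]) blast
  next
    case (insert k N)
    obtain W' where W': "W' \<in> entourages ?S H" "W' O W' \<subseteq> W" using entourages_O[OF H insert.prems] by blast
    obtain U where U: "U \<in> entourages ?S D" "\<And>a a' b c. \<forall>i. (a i, a' i) \<in> U \<Longrightarrow>
        \<forall>i. i \<notin> N \<longrightarrow> a i = a' i \<Longrightarrow> \<forall>j. (b j, c j) \<in> \<alpha> \<Longrightarrow> (\<delta> (p a b) (p a c), \<delta> (p a' b) (p a' c)) \<in> W'"
      using insert.IH[OF W'(1)] by metis
    let ?E = "diff_entourage A \<delta> \<alpha> {(k, p)} W'"
    have "({(k, p)}, W') \<in> diff_base A H" using p W'(1) by (simp add: diff_base_def)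
    then have E: "?E \<in> entourages ?S D" by (rule diff_entourage_in[OF H])
    have "(\<delta> (p a b) (p a c), \<delta> (p a' b) (p a' c)) \<in> W"
      if a: "\<forall>i. (a i, a' i) \<in> U \<inter> ?E" "\<forall>i. i \<notin> insert k N \<longrightarrow> a i = a' i" and bc: "\<forall>j. (b j, c j) \<in> \<alpha>"
      for a a' b c
    proof -
      let ?a = "a(k := a' k)"
      have S: "range a \<subseteq> ?S" "range a' \<subseteq> ?S" using a(1) entourages_sub[OF U(1)] by auto
      have "(\<delta> (p a b) (p a c), \<delta> (p ?a b) (p ?a c)) \<in> W'"
        using diff_entourageD[of "a k" "a' k" A \<delta> \<alpha> "{(k, p)}" W' k p a b c] a(1) S(1) bc by simp
      moreover have "(\<delta> (p ?a b) (p ?a c), \<delta> (p a' b) (p a' c)) \<in> W'"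
        using a diff_refl[OF U(1) subsetD[OF S(2) rangeI]] bc by (intro U(2)) auto
      ultimately show ?thesis using W'(2) by blast
    qed
    then show ?case by (intro bexI[OF _ entourages_Int[OF U(1) E]]) blast
  qed
  obtain N where N: "finite N" "\<And>a a' b. (\<And>i. i \<in> N \<Longrightarrow> a i = a' i) \<Longrightarrow> p a b = p a' b"
    using term_fun2_finite_vars[OF p] by metis
  obtain U where U: "U \<in> entourages ?S D" "\<And>a a' b c. \<forall>i. (a i, a' i) \<in> U \<Longrightarrow>
      \<forall>i. i \<notin> N \<longrightarrow> a i = a' i \<Longrightarrow> \<forall>j. (b j, c j) \<in> \<alpha> \<Longrightarrow> (\<delta> (p a b) (p a c), \<delta> (p a' b) (p a' c)) \<in> W"
    using step[OF N(1) W] by metis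
  have "(\<delta> (p a b) (p a c), \<delta> (p a' b) (p a' c)) \<in> W"
    if a: "\<forall>i. (a i, a' i) \<in> U" and bc: "\<forall>j. (b j, c j) \<in> \<alpha>" for a a' b c
  proof -
    \<comment> \<open>This sequence takes the values of \<open>a'\<close> on the variables of
      \<open>p\<close> and those of \<open>a\<close> elsewhere: it differs from \<open>a\<close>
      only on \<open>N\<close>, and \<open>p\<close> does not distinguish it from
      \<open>a'\<close>.\<close>
    let ?a = "\<lambda>i. if i \<in> N then a' i else a i"
    have "(a i, a i) \<in> U" for i using a entourages_sub[OF U(1)] diff_refl[OF U(1)] by blast
    then have "(\<delta> (p a b) (p a c), \<delta> (p ?a b) (p ?a c)) \<in> W" using a bc by (intro U(2)) auto
    moreover have "p ?a b = p a' b" "p ?a c = p a' c" by (rule N(2); simp)+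
    ultimately show ?thesis by simp
  qed
  then show ?thesis by (intro bexI[OF _ U(1)]) blast
qed

text \<open>Compatibility holds because substituting a basic operation for the variable
  \<open>k\<close> of \<open>p\<close> yields another term function, to which
  \<open>diff_uniform\<close> applies.\<close>

lemma diff_Unif: "D \<in> Unif A"
proof -
  let ?S = "carrier A"
  have "compatible A D"
    unfolding compatible_def
  proof (intro allI impI ballI)
    fix f n U assume f: "arity A f = Some n" and "U \<in> entourages ?S D"
    then obtain T W where TW: "(T, W) \<in> diff_base A H" "diff_entourage A \<delta> \<alpha> T W \<subseteq> U"
      unfolding entourages_diff_uniformity[OF H] by blast
    then have T: "\<And>k p. (k, p) \<in> T \<Longrightarrow> term_fun2 A p" "finite T" and W: "W \<in> entourages ?S H"
      by (auto simp: diff_base_def)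
    \<comment> \<open>The arguments of \<open>f\<close> occupy the variables below \<open>n\<close>,
      and the remaining variables of \<open>p\<close> are shifted up by \<open>n\<close> to make
      room.\<close>
    define sub where "sub k p x y = p (\<lambda>i. if i = k then oper A f (map x [0..<n]) else x (n + i)) y"
      for k :: nat and p :: "(nat \<Rightarrow> 'a) \<Rightarrow> (nat \<Rightarrow> 'a) \<Rightarrow> 'a" and x y
    let ?Q = "\<lambda>(k, p) V. \<forall>a a' b c. (\<forall>i. (a i, a' i) \<in> V) \<longrightarrow> (\<forall>j. (b j, c j) \<in> \<alpha>) \<longrightarrow>
      (\<delta> (sub k p a b) (sub k p a c), \<delta> (sub k p a' b) (sub k p a' c)) \<in> W"
    have "\<exists>V \<in> entourages ?S D. \<forall>kp \<in> T. ?Q kp V"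
    proof (rule entourages_finite_ball[OF diff_full T(2)])
      fix kp assume "kp \<in> T"
      moreover obtain k p where kp: "kp = (k, p)" by fastforce
      ultimately have p: "term_fun2 A p" using T(1) by blast
      have "term_fun A (\<lambda>v. if i = k then oper A f (map (\<lambda>j. v (Inl j)) [0..<n]) else v (Inl (n + i)))"
        for i
      proof (cases "i = k")
        case True
        show ?thesis unfolding if_P[OF True] by (rule term_fun_oper[OF f term_fun_proj])
      qed (simp add: term_fun_proj)
      then have "term_fun2 A (sub k p)"
        unfolding sub_def by (intro term_fun2I term_fun2_comp[OF p] term_fun_proj)
      from diff_uniform[OF this W] show "\<exists>V \<in> entourages ?S D. ?Q kp V" by (simp add: kp)
    next
      fix kp V V' assume "?Q kp V" "V' \<subseteq> V"
      then show "?Q kp V'" by (auto simp: subset_iff)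
    qed
    then obtain V where V: "V \<in> entourages ?S D" "\<And>k p a a' b c. (k, p) \<in> T \<Longrightarrow>
        \<forall>i. (a i, a' i) \<in> V \<Longrightarrow> \<forall>j. (b j, c j) \<in> \<alpha> \<Longrightarrow>
        (\<delta> (sub k p a b) (sub k p a c), \<delta> (sub k p a' b) (sub k p a' c)) \<in> W" by blast
    have "(oper A f xs, oper A f ys) \<in> U"
      if xs: "xs \<in> tuples ?S n" and ys: "ys \<in> tuples ?S n" and l: "list_all2 (\<lambda>x y. (x, y) \<in> V) xs ys"
      for xs ys
    proof -
      have "(oper A f xs, oper A f ys) \<in> diff_entourage A \<delta> \<alpha> T W"
      proof (rule diff_entourageI)
        show "oper A f xs \<in> ?S" "oper A f ys \<in> ?S" using A f xs ys by (auto simp: is_algebra_def)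
        fix k p and x b c :: "nat \<Rightarrow> 'a"
        assume *: "(k, p) \<in> T" "range x \<subseteq> ?S" "\<forall>j. (b j, c j) \<in> \<alpha>"
        \<comment> \<open>The sequences for \<open>xs\<close> and \<open>ys\<close> coincide from
          position \<open>n\<close> on, so there reflexivity suffices for closeness.\<close>
        define ext where "ext zs i = (if i < n then zs ! i else x (i - n))" for zs i
        have "map (ext zs) [0..<n] = zs" if "length zs = n" for zs
          using that by (intro nth_equalityI) (auto simp: ext_def)
        then have sub: "sub k p (ext zs) y = p (x(k := oper A f zs)) y" if "length zs = n" for zs y
          using that by (auto simp: sub_def ext_def intro!: arg_cong2[of _ _ _ _ p])
        have "(ext xs i, ext ys i) \<in> V" for i
          using l xs diff_refl[OF V(1)] *(2)
          by (auto simp: ext_def list_all2_conv_all_nth tuples_def)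
        then have "(\<delta> (sub k p (ext xs) b) (sub k p (ext xs) c),
            \<delta> (sub k p (ext ys) b) (sub k p (ext ys) c)) \<in> W"
          using *(1,3) by (intro V(2)) auto
        then show "(\<delta> (p (x(k := oper A f xs)) b) (p (x(k := oper A f xs)) c),
            \<delta> (p (x(k := oper A f ys)) b) (p (x(k := oper A f ys)) c)) \<in> W"
          using sub xs ys by (simp add: tuples_def)
      qed
      then show ?thesis using TW(2) by blast
    qed
    then show "\<exists>U' \<in> entourages ?S D. \<forall>xs \<in> tuples ?S n. \<forall>ys \<in> tuples ?S n.
        list_all2 (\<lambda>x y. (x, y) \<in> U') xs ys \<longrightarrow> (oper A f xs, oper A f ys) \<in> U"
      using V(1) by blast
  qed
  then show ?thesis using diff_uniformity_on by (simp add: Unif_def)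
qed

text \<open>If the first row is close, its \<delta> is close to \<open>e\<close>. Closeness in
  \<open>D\<close> carries this over to the \<delta> of the second row, and applying
  \<open>\<sigma>\<close> to \<open>p a' b\<close> turns it back into closeness of the second
  row.\<close>

lemma centralizes_diff:
  assumes "Ug \<alpha> \<in> Unif A"
  shows "centralizes A D (Ug \<alpha>) H"
proof (rule centralizesI[OF A diff_Unif assms H])
  let ?S = "carrier A"
  fix p :: "(nat \<Rightarrow> 'a) \<Rightarrow> (nat \<Rightarrow> 'a) \<Rightarrow> 'a" and W
  assume p: "term_fun2 A p" and W: "W \<in> entourages ?S H"
  obtain W1 where W1: "W1 \<in> entourages ?S H"
    "\<And>x x' y y'. (x, x') \<in> W1 \<Longrightarrow> (y, y') \<in> W1 \<Longrightarrow> (\<sigma> x y, \<sigma> x' y') \<in> W"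
    using binary_term_fun_uniform[OF H \<sigma> W] by metis
  obtain W2 where W2: "W2 \<in> entourages ?S H" "W2 O W2 \<subseteq> W1" using entourages_O[OF H W1(1)] by blast
  obtain W' where W': "W' \<in> entourages ?S H"
    "\<And>x x' y y'. (x, x') \<in> W' \<Longrightarrow> (y, y') \<in> W' \<Longrightarrow> (\<delta> x y, \<delta> x' y') \<in> W2"
    using binary_term_fun_uniform[OF H \<delta> W2(1)] by metis
  obtain U where U: "U \<in> entourages ?S D" "\<And>a a' b c. \<forall>i. (a i, a' i) \<in> U \<Longrightarrow>
      \<forall>j. (b j, c j) \<in> \<alpha> \<Longrightarrow> (\<delta> (p a b) (p a c), \<delta> (p a' b) (p a' c)) \<in> W2"
    using diff_uniform[OF p W2(1)] by metis
  have "(p a' b, p a' c) \<in> W"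
    if a: "\<forall>i. (a i, a' i) \<in> U" and bc: "\<forall>j. (b j, c j) \<in> \<alpha>" and pp: "(p a b, p a c) \<in> W'" for a a' b c
  proof -
    have "range a \<subseteq> ?S" "range a' \<subseteq> ?S" using a entourages_sub[OF U(1)] by auto
    note cl = diff_closed(1,2)[OF p this(1) bc] diff_closed(1,2)[OF p this(2) bc]
    have "(\<delta> (p a b) (p a b), \<delta> (p a b) (p a c)) \<in> W2"
      using W'(2)[OF entourages_refl[OF H W'(1) cl(1)] pp] .
    then have "(e, \<delta> (p a' b) (p a' c)) \<in> W1"
      using U(2)[OF a bc] W2(2) \<delta>_self[OF cl(1)] by auto
    then have "(\<sigma> e (p a' b), \<sigma> (\<delta> (p a' b) (p a' c)) (p a' b)) \<in> W"
      using W1(2) entourages_refl[OF H W1(1) cl(3)] by blast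
    then show ?thesis using \<sigma>_e \<sigma>_\<delta> cl by simp
  qed
  moreover have "\<alpha> \<in> entourages ?S (Ug \<alpha>)"
    using congruence_sub[OF \<alpha>] by (auto simp: entourages_Ug)
  ultimately show "\<exists>U \<in> entourages ?S D. \<exists>V \<in> entourages ?S (Ug \<alpha>). \<exists>W' \<in> entourages ?S H.
      \<forall>a a' b c. (\<forall>i. (a i, a' i) \<in> U) \<longrightarrow> (\<forall>j. (b j, c j) \<in> V) \<longrightarrow> (p a b, p a c) \<in> W' \<longrightarrow>
        (p a' b, p a' c) \<in> W"
    using U(1) W'(1) by blast
qed

text \<open>Let g and g' be the \<delta> of the rows at a and a'. Centrality is applied to a term
  with first row (e, e) and second row (e, \<delta> g g'). Thus \<delta> g g' is close to
  \<open>e\<close>, and \<sigma> gives closeness of g and g'. The premise on the first row holds by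
  reflexivity, so centrality modulo a smaller \<open>H'\<close> yields an estimate by entourages of
  \<open>H\<close>.\<close>

lemma diff_upper:
  assumes F: "F \<in> Unif A" and H': "H' \<in> Unif A" "H' \<le> H" and c: "centralizes A F (Ug \<alpha>) H'"
  shows "F \<le> D"
  unfolding diff_uniformity_def
proof (rule INF_greatest)
  let ?S = "carrier A"
  have \<alpha>_refl: "(z, z) \<in> \<alpha>" if "z \<in> ?S" for z
    using \<alpha> that by (auto simp: congruence_def equiv_def refl_on_def)
  have key: "\<exists>U \<in> entourages ?S F. \<forall>(a, a') \<in> U. \<forall>x b c. range x \<subseteq> ?S \<longrightarrow> (\<forall>j. (b j, c j) \<in> \<alpha>) \<longrightarrow>
      (\<delta> (p (x(k := a)) b) (p (x(k := a)) c), \<delta> (p (x(k := a')) b) (p (x(k := a')) c)) \<in> W"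
    if p: "term_fun2 A p" and "W \<in> entourages ?S H" for k :: nat and p :: "(nat \<Rightarrow> 'a) \<Rightarrow> (nat \<Rightarrow> 'a) \<Rightarrow> 'a" and W
  proof -
    have W: "W \<in> entourages ?S H'" using that(2) entourages_mono[OF H'(2)] by blast
    obtain W1 where W1: "W1 \<in> entourages ?S H'"
      "\<And>x x' y y'. (x, x') \<in> W1 \<Longrightarrow> (y, y') \<in> W1 \<Longrightarrow> (\<sigma> x y, \<sigma> x' y') \<in> W"
      using binary_term_fun_uniform[OF H'(1) \<sigma> W] by metis
    \<comment> \<open>This is \<open>p (x(k := z)) y\<close>, written so that it is visibly composed
      from term functions.\<close>
    define P where "P z x y = p (\<lambda>i. if i = k then z else x i) y" for z and x y :: "nat \<Rightarrow> 'a"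
    \<comment> \<open>The only row variable is the value substituted at \<open>k\<close>. The blocks
      of \<open>y\<close> are, in order, the moving column variable and the parameters b, x and
      a.\<close>
    define q where "q x y = \<delta> (\<delta> (P (y (Inr (Inr (Inr ())))) (\<lambda>i. y (Inr (Inr (Inl i)))) (\<lambda>j. y (Inr (Inl j))))
        (P (y (Inr (Inr (Inr ())))) (\<lambda>i. y (Inr (Inr (Inl i)))) (\<lambda>j. y (Inl j))))
      (\<delta> (P (x ()) (\<lambda>i. y (Inr (Inr (Inl i)))) (\<lambda>j. y (Inr (Inl j))))
        (P (x ()) (\<lambda>i. y (Inr (Inr (Inl i)))) (\<lambda>j. y (Inl j))))"
      for x :: "unit \<Rightarrow> 'a" and y :: "nat + nat + nat + unit \<Rightarrow> 'a"
    have tP: "term_fun A (\<lambda>v. P (z v) (\<lambda>i. x i v) (\<lambda>j. y j v))"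
      if "term_fun A z" "\<And>i. term_fun A (x i)" "\<And>j. term_fun A (y j)"
      for z :: "(unit + nat + nat + nat + unit \<Rightarrow> 'a) \<Rightarrow> 'a" and x y
    proof -
      have "term_fun A (\<lambda>v. if i = k then z v else x i v)" for i
        using that(1) that(2)[of i] by (cases "i = k") auto
      from term_fun2_comp[OF p this that(3)] show ?thesis by (simp add: P_def)
    qed
    have "term_fun2 A q"
      unfolding q_def by (intro term_fun2I binary_term_fun_comp[OF \<delta>] tP term_fun_proj)
    from centralizesD[OF c this W1(1)] obtain U V W' where
      UV: "U \<in> entourages ?S F" "V \<in> entourages ?S (Ug \<alpha>)" "W' \<in> entourages ?S H'"
      and q: "\<And>a a' b c. (\<And>i. (a i, a' i) \<in> U) \<Longrightarrow> (\<And>j. (b j, c j) \<in> V) \<Longrightarrow>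
        (q a b, q a c) \<in> W' \<Longrightarrow> (q a' b, q a' c) \<in> W1" by metis
    have "(\<delta> (p (x(k := a)) b) (p (x(k := a)) c), \<delta> (p (x(k := a')) b) (p (x(k := a')) c)) \<in> W"
      if aa: "(a, a') \<in> U" and x: "range x \<subseteq> ?S" and bc: "\<forall>j. (b j, c j) \<in> \<alpha>" for a a' x b c
    proof -
      have S: "a \<in> ?S" "a' \<in> ?S" using aa entourages_sub[OF UV(1)] by auto
      have P: "P z x y = p (x(k := z)) y" for z y
        by (auto simp: P_def fun_upd_def)
      have r: "range (x(k := z)) \<subseteq> ?S" if "z \<in> ?S" for z using x that by (auto simp: image_subset_iff)
      note cl = diff_closed[OF p r[OF S(1)] bc] diff_closed[OF p r[OF S(2)] bc]
      let ?g = "\<delta> (p (x(k := a)) b) (p (x(k := a)) c)" and ?g' = "\<delta> (p (x(k := a')) b) (p (x(k := a')) c)"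
      let ?y = "\<lambda>z. case_sum z (case_sum b (case_sum x (\<lambda>_ :: unit. a)))"
      have e: "e \<in> ?S" "\<delta> e e = e"
        using \<delta>_self[OF cl(1)] \<delta>_self binary_term_fun_closed[OF A \<delta> cl(1) cl(1)] by auto
      have b: "b j \<in> ?S" for j using bc congruence_sub[OF \<alpha>] by blast
      have "(?y b j, ?y c j) \<in> \<alpha>" for j
        using bc \<alpha>_refl b S(1) x by (auto simp: image_subset_iff split: sum.split)
      then have V: "(?y b j, ?y c j) \<in> V" for j using UV(2) by (auto simp: entourages_Ug)
      have "q (\<lambda>_. a) (?y b) = e" "q (\<lambda>_. a) (?y c) = e"
        using \<delta>_self cl e(2) by (simp_all add: q_def P)
      then have "(q (\<lambda>_. a) (?y b), q (\<lambda>_. a) (?y c)) \<in> W'"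
        using entourages_refl[OF H'(1) UV(3) e(1)] by simp
      then have "(q (\<lambda>_. a') (?y b), q (\<lambda>_. a') (?y c)) \<in> W1"
        using q[of "\<lambda>_. a" "\<lambda>_. a'" "?y b" "?y c"] aa V by blast
      moreover have "q (\<lambda>_. a') (?y b) = e" "q (\<lambda>_. a') (?y c) = \<delta> ?g ?g'"
        using \<delta>_self cl e(2) by (simp_all add: q_def P)
      ultimately have "(\<sigma> e ?g, \<sigma> (\<delta> ?g ?g') ?g) \<in> W"
        using W1(2) entourages_refl[OF H'(1) W1(1) cl(3)] by simp
      then show ?thesis using \<sigma>_e \<sigma>_\<delta> cl by simp
    qed
    then show ?thesis by (intro bexI[OF _ UV(1)]) blast
  qed
  fix TW assume TW: "TW \<in> diff_base A H"
  obtain T W where [simp]: "TW = (T, W)" by (cases TW)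
  have T: "finite T" "\<And>k p. (k, p) \<in> T \<Longrightarrow> term_fun2 A p" and W: "W \<in> entourages ?S H"
    using TW by (auto simp: diff_base_def)
  let ?Q = "\<lambda>(k, p) U. \<forall>(a, a') \<in> U. \<forall>x b c. range x \<subseteq> ?S \<longrightarrow> (\<forall>j. (b j, c j) \<in> \<alpha>) \<longrightarrow>
    (\<delta> (p (x(k := a)) b) (p (x(k := a)) c), \<delta> (p (x(k := a')) b) (p (x(k := a')) c)) \<in> W"
  have "\<exists>U \<in> entourages ?S F. \<forall>kp \<in> T. ?Q kp U"
  proof (rule entourages_finite_ball[OF entourages_full[OF F] T(1)])
    fix kp assume "kp \<in> T"
    moreover obtain k p where kp: "kp = (k, p)" by fastforce
    ultimately have "term_fun2 A p" using T(2) by blast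
    from key[OF this W] show "\<exists>U \<in> entourages ?S F. ?Q kp U" unfolding kp prod.case .
  next
    fix kp U U' assume "?Q kp U" "U' \<subseteq> U"
    then show "?Q kp U'" by (cases kp) blast
  qed
  then obtain U where U: "U \<in> entourages ?S F" "\<forall>kp \<in> T. ?Q kp U" by blast
  have "U \<subseteq> diff_entourage A \<delta> \<alpha> T W"
  proof safe
    fix a a' assume "(a, a') \<in> U"
    then show "(a, a') \<in> diff_entourage A \<delta> \<alpha> T W"
      using U entourages_sub[OF U(1)] by (intro diff_entourageI) blast+
  qed
  then show "F \<le> (case TW of (T, W) \<Rightarrow> principal (diff_entourage A \<delta> \<alpha> T W))"
    using U(1) by (auto simp: entourages_def le_principal elim: eventually_mono)
qed

end

text \<open>Each \<open>F\<close> may come with its own \<open>H'\<close> below \<open>H\<close>,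
  since the commutators of the members of \<open>X\<close> with \<open>Ug \<alpha>\<close> differ.
  All these \<open>F\<close> lie below one uniformity that centralizes \<open>Ug \<alpha>\<close>
  modulo \<open>H\<close>, and hence so does their join.\<close>

theorem centralizes_Join_group:
  assumes A: "is_algebra A" and "has_underlying_group A" "congruence A \<alpha>"
    and Unif: "X \<subseteq> Unif A" "Ug \<alpha> \<in> Unif A" "H \<in> Unif A"
    and X: "\<And>F. F \<in> X \<Longrightarrow> \<exists>H' \<in> Unif A. H' \<le> H \<and> centralizes A F (Ug \<alpha>) H'"
  shows "centralizes A (Unif_Join A X) (Ug \<alpha>) H"
proof -
  obtain \<delta> \<sigma> e where terms: "binary_term_fun A \<delta>" "binary_term_fun A \<sigma>"
    "\<And>x. x \<in> carrier A \<Longrightarrow> \<delta> x x = e" "\<And>x. x \<in> carrier A \<Longrightarrow> \<sigma> e x = x"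
    "\<And>x y. x \<in> carrier A \<Longrightarrow> y \<in> carrier A \<Longrightarrow> \<sigma> (\<delta> x y) x = y"
    using group_difference_terms[OF assms(2)] by metis
  let ?D = "diff_uniformity A \<delta> \<alpha> H"
  note D = A terms assms(3) Unif(3)
  have "F \<le> ?D" if "F \<in> X" for F
    using X[OF that] diff_upper[OF D] that Unif(1) by blast
  then have "Unif_Join A X \<le> ?D"
    using diff_Unif[OF D] by (intro Unif_Join_is_lub(3)[OF A Unif(1)]) auto
  then show ?thesis using centralizes_mono_left centralizes_diff[OF D Unif(2)] by blast
qed

section \<open>Joins in the first argument of the commutator\<close>

theorem theorem7p2:
  fixes A :: "('a, 'f) ualgebra"
    and I :: "'i set"
    and \<U> :: "'i \<Rightarrow> ('a \<times> 'a) filter"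
    and \<V> :: "('a \<times> 'a) filter"
  assumes "in_congruence_modular_variety A"
    and "\<And>i. i \<in> I \<Longrightarrow> \<U> i \<in> Unif A"
    and "\<V> \<in> Unif A"
  shows "Unif_Join A ((\<lambda>i. commutator A (\<U> i) \<V>) ` I) \<le> commutator A (Unif_Join A (\<U> ` I)) \<V> \<and>
    (((\<exists>\<alpha>. congruence A \<alpha> \<and> \<V> = Ug \<alpha>) \<and> has_underlying_group A) \<or>
     (finite I \<and> (\<forall>i \<in> I. \<forall>j \<in> I. permute A (\<U> i) (\<U> j))) \<longrightarrow>
       Unif_Join A ((\<lambda>i. commutator A (\<U> i) \<V>) ` I) = commutator A (Unif_Join A (\<U> ` I)) \<V>)"
    (is "?L \<le> ?R \<and> (?C \<longrightarrow> ?L = ?R)")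
proof -
  let ?X = "(\<lambda>i. commutator A (\<U> i) \<V>) ` I"
  have A: "is_algebra A"
    using assms(1) by (auto simp: in_congruence_modular_variety_def variety_def)
  have U: "\<U> ` I \<subseteq> Unif A" using assms(2) by blast
  note J = Unif_Join_is_lub[OF A U]
  note R = commutator_is_least[OF A J(1) assms(3)]
  note K = commutator_is_least[OF A assms(2,3)]
  have X: "?X \<subseteq> Unif A" using K(1) by blast
  note L = Unif_Join_is_lub[OF A X]
  have le: "?L \<le> ?R"
  proof (rule L(3)[OF R(1)])
    fix F assume "F \<in> ?X"
    then obtain i where i: "i \<in> I" "F = commutator A (\<U> i) \<V>" by blast
    have "\<U> i \<le> Unif_Join A (\<U> ` I)" using i(1) by (intro J(2)) blast
    then have "centralizes A (\<U> i) \<V> ?R" by (rule centralizes_mono_left[OF R(2)])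
    then show "F \<le> ?R" unfolding i(2) by (rule K(3)[OF i(1) R(1)])
  qed
  have below: "commutator A (\<U> i) \<V> \<le> ?L" if "i \<in> I" for i
    using that by (intro L(2)) blast
  have "centralizes A (Unif_Join A (\<U> ` I)) \<V> ?L" if ?C
    using that
  proof (elim disjE conjE exE)
    fix \<alpha> assume \<alpha>: "congruence A \<alpha>" "\<V> = Ug \<alpha>" and G: "has_underlying_group A"
    \<comment> \<open>The commutator of \<open>F\<close> and \<V> is a suitable
      \<open>H'\<close>.\<close>
    have "\<exists>H' \<in> Unif A. H' \<le> ?L \<and> centralizes A F \<V> H'" if "F \<in> \<U> ` I" for F
      using that K(1,2) below by blast
    then show ?thesis
      using centralizes_Join_group[OF A G \<alpha>(1) U _ L(1)] assms(3) unfolding \<alpha>(2) by blast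
  next
    assume "finite I" "\<forall>i \<in> I. \<forall>j \<in> I. permute A (\<U> i) (\<U> j)"
    \<comment> \<open>Monotonicity in the last argument leads from the commutator of
      \<open>F\<close> and \<V> up to \<open>?L\<close>.\<close>
    moreover have "centralizes A F \<V> ?L" if "F \<in> \<U> ` I" for F
      using that centralizes_mono_right[OF assms(1) A assms(2,3) K(1) L(1) K(2) below] by blast
    ultimately show ?thesis
      using centralizes_Join_permute[OF A _ U _ assms(3) L(1)] by blast
  qed
  then have "?R \<le> ?L" if ?C using R(3)[OF L(1)] that by blast
  then show ?thesis using le by (auto intro: antisym)
qed

end
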